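(* Let $G$ be an infinite countable discrete amenable group, let $(X,G)$ be a $G$-topological dynamical system with metric $d$ on $X$, let $(G_n)_{n\ge 1}$ be a sequence of non-empty finite subsets of $G$, and let $\mu$ be an ergodic measure of $(X,G)$. Assume $h_\mu(G)>0$ and $\lim_{n\to\infty}|G_n|=\infty$. Let $\mu=\int\mu_y\,d\mu(y)$ be the disintegration of $\mu$ with respect to the Pinsker $\sigma$-algebra $\mathcal{P}_\mu(G)$. For $x\in X$ put $$W_{S,(G_n)_{n\ge 1}}(x)=\Big\{y\in X:\lim_{n\to\infty}\frac{1}{|G_n|}\sum_{g\in G_n}d(gx,gy)=0\Big\}.$$ If $$\overline{\operatorname{supp}(\mu_x)\cap W_{S,(G_n)_{n\ge 1}}(x)}=\operatorname{supp}(\mu_x)$$ for $\mu$-a.e. $x\in X$, then for $\mu$-a.e. $x\in X$ there are $\delta_x>0$ and a dense Mycielski $((G_n)_{n\ge 1},\delta_x)$-mean scrambled subset $K_x$ of $\operatorname{supp}(\mu_x)$.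
   Context: A $G$-topological dynamical system ($G$-tds) $(X,G)$ is a compact metric space $X$ with metric $d$ on which $G$ acts continuously. $\mathcal{B}_X$ is the Borel $\sigma$-algebra of $X$, and $\mathcal{B}_X^\mu$ its completion under $\mu$. An ergodic measure of $(X,G)$ is a $G$-invariant Borel probability measure $\mu$ on $X$ with $\mu(\bigcup_{g\in G}gA)\in\{0,1\}$ for every $A\in\mathcal{B}_X$. $\operatorname{supp}(\nu)$ is the smallest closed set of full $\nu$-measure. A Følner sequence is a sequence $(F_n)$ of non-empty finite subsets of $G$ with $|gF_n\Delta F_n|/|F_n|\to0$ for every $g\in G$. For a finite measurable partition $\alpha$, $H_\mu(\alpha)=-\sum_{A\in\alpha}\mu(A)\log\mu(A)$ and $h_\mu(G,\alpha)=\lim_{n\to\infty}\frac{1}{|F_n|}H_\mu(\bigvee_{g\in F_n}g^{-1}\alpha)$, where $(F_n)$ is any Følner sequence (the limit exists and is independent of it). The measure-theoretic entropy is $h_\mu(G)=\sup_\alpha h_\mu(G,\alpha)$ over finite Borel partitions $\alpha$. The Pinsker $\sigma$-algebra is $\mathcal{P}_\mu(G)=\{A\in\mathcal{B}_X^\mu: h_\mu(G,\{A,A^c\})=0\}$. The disintegration $\mu=\int\mu_y\,d\mu(y)$ of $\mu$ with respect to a sub-$\sigma$-algebra $\mathcal{F}$ of $\mathcal{B}_X^\mu$ is a measurable map $y\mapsto\mu_y$ from $X$ to the Borel probability measures on $X$ such that for every $f\in L^1(X,\mathcal{B}_X^\mu,\mu)$, $\mathbb{E}(f|\mathcal{F})(y)=\int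 f\,d\mu_y$ for $\mu$-a.e. $y\in X$. For $\delta>0$, a pair $(x_1,x_2)\in X\times X$ is $((G_n)_{n\ge1},\delta)$-mean scrambled if $\liminf_{n\to\infty}\frac{1}{|G_n|}\sum_{g\in G_n}d(gx_1,gx_2)=0$ and $\limsup_{n\to\infty}\frac{1}{|G_n|}\sum_{g\in G_n}d(gx_1,gx_2)>\delta$. A subset $K$ of $X$ with at least two points is a $((G_n)_{n\ge1},\delta)$-mean scrambled subset if every two distinct points of $K$ form a $((G_n)_{n\ge1},\delta)$-mean scrambled pair. A Mycielski set is a union of countably many Cantor sets. *)

theory Defs
  imports "HOL-Probability.Probability" "HOL-Algebra.Group_Action"
begin

section \<open>Amenable groups and topological dynamical systems\<close>

definition folner_seq :: "('g, 'm) monoid_scheme \<Rightarrow> (nat \<Rightarrow> 'g set) \<Rightarrow> bool" where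
  "folner_seq G F \<longleftrightarrow>
     (\<forall>n. finite (F n) \<and> F n \<noteq> {} \<and> F n \<subseteq> carrier G) \<and>
     (\<forall>g\<in>carrier G.
        (\<lambda>n. real (card (sym_diff (g <#\<^bsub>G\<^esub> F n) (F n))) / real (card (F n))) \<longlonglongrightarrow> 0)"

text \<open>For countable discrete groups, amenability is the existence of a Folner sequence.\<close>

definition countable_amenable_group :: "('g, 'm) monoid_scheme \<Rightarrow> bool" where
  "countable_amenable_group G \<longleftrightarrow>
     group G \<and> countable (carrier G) \<and> (\<exists>F. folner_seq G F)"

text \<open>The phase space is the whole type \<open>'x\<close>, with metric \<^const>\<open>dist\<close>; as the acting group is
  discrete, the action is continuous iff every group element acts continuously.\<close>

locale G_tds = group_action G "UNIV :: 'x::metric_space set" \<phi>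
  for G :: "('g, 'm) monoid_scheme" (structure) and \<phi> :: "'g \<Rightarrow> 'x::metric_space \<Rightarrow> 'x" +
  assumes compact_phase_space: "compact (UNIV :: 'x::metric_space set)"
    and continuous_action: "g \<in> carrier G \<Longrightarrow> continuous_on UNIV (\<phi> g)"

definition invariant_measure ::
    "('g, 'm) monoid_scheme \<Rightarrow> ('g \<Rightarrow> 'x::metric_space \<Rightarrow> 'x) \<Rightarrow> 'x measure \<Rightarrow> bool" where
  "invariant_measure G \<phi> \<mu> \<longleftrightarrow>
     sets \<mu> = sets borel \<and> prob_space \<mu> \<and> (\<forall>g\<in>carrier G. distr \<mu> borel (\<phi> g) = \<mu>)"

definition ergodic_measure ::
    "('g, 'm) monoid_scheme \<Rightarrow> ('g \<Rightarrow> 'x::metric_space \<Rightarrow> 'x) \<Rightarrow> 'x measure \<Rightarrow> bool" where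
  "ergodic_measure G \<phi> \<mu> \<longleftrightarrow>
     invariant_measure G \<phi> \<mu> \<and>
     (\<forall>A\<in>sets borel. measure \<mu> (\<Union>g\<in>carrier G. \<phi> g ` A) \<in> {0, 1})"

text \<open>On a compact metric space the intersection below is itself of full measure, hence the
  smallest closed set of full measure.\<close>

definition supp :: "'x::topological_space measure \<Rightarrow> 'x set" where
  "supp \<nu> = \<Inter>{C. closed C \<and> (AE x in \<nu>. x \<in> C)}"


section \<open>Measure-theoretic entropy\<close>

text \<open>Here \<open>M\<close> is either the Borel measure itself or its completion. Null sets contribute
  nothing to \<open>partition_entropy\<close>, as \<^term>\<open>0 * ln 0 = (0::real)\<close>, so it is harmless that a join
  or a pair \<open>{A, space M - A}\<close> may contain the empty set.\<close>

definition partition_entropy :: "'x measure \<Rightarrow> 'x set set \<Rightarrow> real" where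
  "partition_entropy M \<alpha> = - (\<Sum>A\<in>\<alpha>. measure M A * ln (measure M A))"

text \<open>The join of the partitions \<open>g\<^sup>-\<^sup>1 \<alpha>\<close>, \<open>g \<in> F\<close>.\<close>

definition dynamical_join :: "('g \<Rightarrow> 'x \<Rightarrow> 'x) \<Rightarrow> 'g set \<Rightarrow> 'x set set \<Rightarrow> 'x set set" where
  "dynamical_join \<phi> F \<alpha> = {(\<Inter>g\<in>F. \<phi> g -` c g) | c. \<forall>g\<in>F. c g \<in> \<alpha>}"

text \<open>The common limit along all Folner sequences. For an amenable group it exists and is unique
  (Ornstein--Weiss) for invariant \<open>M\<close> and finite measurable partitions \<open>\<alpha>\<close>.\<close>

definition entropy_wrt ::
    "('g, 'm) monoid_scheme \<Rightarrow> ('g \<Rightarrow> 'x \<Rightarrow> 'x) \<Rightarrow> 'x measure \<Rightarrow> 'x set set \<Rightarrow> real" where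
  "entropy_wrt G \<phi> M \<alpha> =
     (THE h. \<forall>F. folner_seq G F \<longrightarrow>
        (\<lambda>n. partition_entropy M (dynamical_join \<phi> (F n) \<alpha>) / real (card (F n))) \<longlonglongrightarrow> h)"

definition measure_entropy ::
    "('g, 'm) monoid_scheme \<Rightarrow> ('g \<Rightarrow> 'x \<Rightarrow> 'x) \<Rightarrow> 'x measure \<Rightarrow> ereal" where
  "measure_entropy G \<phi> \<mu> =
     (SUP \<alpha>\<in>{\<alpha>. finite \<alpha> \<and> partition_on (space \<mu>) \<alpha> \<and> \<alpha> \<subseteq> sets \<mu>}. ereal (entropy_wrt G \<phi> \<mu> \<alpha>))"

definition pinsker_sets ::
    "('g, 'm) monoid_scheme \<Rightarrow> ('g \<Rightarrow> 'x \<Rightarrow> 'x) \<Rightarrow> 'x measure \<Rightarrow> 'x set set" where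
  "pinsker_sets G \<phi> \<mu> =
     {A \<in> sets (completion \<mu>). entropy_wrt G \<phi> (completion \<mu>) {A, space \<mu> - A} = 0}"


section \<open>Disintegration\<close>

text \<open>The sub-\<open>\<sigma>\<close>-algebra of the completed Borel sets is given by its family of sets
  \<open>\<F>\<close>; \<^term>\<open>sigma (space \<mu>) \<F>\<close> only packages it as the measurable space required by
  \<^const>\<open>real_cond_exp\<close>, which takes the measure from its first argument. A function that is
  measurable for the completed Borel sets need only be measurable for the completion of the fibre
  measure, hence the completion in the integral.\<close>

definition disintegration ::
    "'x::topological_space measure \<Rightarrow> 'x set set \<Rightarrow> ('x \<Rightarrow> 'x measure) \<Rightarrow> bool" where
  "disintegration \<mu> \<F> \<kappa> \<longleftrightarrow>
     \<kappa> \<in> completion \<mu> \<rightarrow>\<^sub>M prob_algebra borel \<and>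
     (\<forall>f :: 'x \<Rightarrow> real. integrable (completion \<mu>) f \<longrightarrow>
        (AE y in \<mu>. real_cond_exp (completion \<mu>) (sigma (space \<mu>) \<F>) f y
                      = (\<integral>x. f x \<partial>completion (\<kappa> y))))"


section \<open>Mean scrambled sets\<close>

definition mean_dist :: "('g \<Rightarrow> 'x::metric_space \<Rightarrow> 'x) \<Rightarrow> 'g set \<Rightarrow> 'x \<Rightarrow> 'x \<Rightarrow> real" where
  "mean_dist \<phi> F x y = (\<Sum>g\<in>F. dist (\<phi> g x) (\<phi> g y)) / real (card F)"

definition mean_stable_set ::
    "('g \<Rightarrow> 'x::metric_space \<Rightarrow> 'x) \<Rightarrow> (nat \<Rightarrow> 'g set) \<Rightarrow> 'x \<Rightarrow> 'x set" where
  "mean_stable_set \<phi> Gs x = {y. (\<lambda>n. mean_dist \<phi> (Gs n) x y) \<longlonglongrightarrow> 0}"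

definition mean_scrambled_pair ::
    "('g \<Rightarrow> 'x::metric_space \<Rightarrow> 'x) \<Rightarrow> (nat \<Rightarrow> 'g set) \<Rightarrow> real \<Rightarrow> 'x \<Rightarrow> 'x \<Rightarrow> bool" where
  "mean_scrambled_pair \<phi> Gs \<delta> x y \<longleftrightarrow>
     liminf (\<lambda>n. ereal (mean_dist \<phi> (Gs n) x y)) = 0 \<and>
     limsup (\<lambda>n. ereal (mean_dist \<phi> (Gs n) x y)) > ereal \<delta>"

definition mean_scrambled_set ::
    "('g \<Rightarrow> 'x::metric_space \<Rightarrow> 'x) \<Rightarrow> (nat \<Rightarrow> 'g set) \<Rightarrow> real \<Rightarrow> 'x set \<Rightarrow> bool" where
  "mean_scrambled_set \<phi> Gs \<delta> K \<longleftrightarrow>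
     (\<exists>x\<in>K. \<exists>y\<in>K. x \<noteq> y) \<and>
     (\<forall>x\<in>K. \<forall>y\<in>K. x \<noteq> y \<longrightarrow> mean_scrambled_pair \<phi> Gs \<delta> x y)"

text \<open>The type \<^typ>\<open>nat \<Rightarrow> bool\<close> carries the product topology of the discrete space
  \<^typ>\<open>bool\<close>, i.e. it is the standard Cantor space.\<close>

definition cantor_set :: "'x::topological_space set \<Rightarrow> bool" where
  "cantor_set C \<longleftrightarrow> C homeomorphic (UNIV :: (nat \<Rightarrow> bool) set)"

definition mycielski_set :: "'x::topological_space set \<Rightarrow> bool" where
  "mycielski_set K \<longleftrightarrow> (\<exists>\<C>. countable \<C> \<and> (\<forall>C\<in>\<C>. cantor_set C) \<and> K = \<Union>\<C>)"

end

theory Submission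
  imports Defs "HOL-Library.Ramsey" "HOL-Library.Diagonal_Subsequence" "HOL-Real_Asymp.Real_Asymp"
begin

text \<open>
  The proof combines a mixing property over the Pinsker algebra, its consequence for the fibre
  measures \<open>\<kappa> x\<close>, and a category argument.

  \<^bold>\<open>Mixing.\<close> Say that \<open>B\<close> is a zero-entropy set if the partition into \<open>B\<close> and its complement has
  entropy rate \<open>0\<close> along every Folner sequence. By Shearer's inequality the entropy of a finite
  partition is an infimum over finite sets, hence the same limit along all Folner sequences
  (\<open>entropy_limit_exists\<close>), and the zero-entropy sets are the members of the Pinsker algebra. A set
  that can be recovered from very few translates of a finite partition has zero entropy: suppose
  that, up to a small error, \<open>B\<close> is a function of \<open>f \<circ> \<phi> (k i)\<close>, \<open>i \<in> I\<close>, for \<^emph>\<open>every\<close> set \<open>I\<close> of \<open>m\<close>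
  large indices. A subset \<open>R\<close> of small density of a Folner set \<open>F\<close> can be chosen so that for most
  \<open>g \<in> F\<close> it contains \<open>m\<close> of the elements \<open>k i \<otimes> g\<close> (\<open>sparse_hitting_set\<close>). So the values of \<open>f\<close> along
  \<open>R\<close> determine most of the translates of \<open>B\<close> along \<open>F\<close>, and their entropy is small compared with
  \<open>card F\<close>. This applies to weak limits: a bounded sequence has a subsequence all of whose averages
  over \<open>m\<close> large indices are close in \<open>L\<^sup>1\<close> to one function \<open>u\<close> (\<open>blum_hanson_subsequence\<close>), so for a
  sequence \<open>f \<circ> \<phi> (k i)\<close>, possibly multiplied with Pinsker measurable signs, the function \<open>u\<close> is
  Pinsker measurable (\<open>zero_entropy_level_set\<close>). As \<open>u\<close> is then orthogonal to \<open>h - E(h|P)\<close>, where \<open>P\<close>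
  is the Pinsker algebra, it follows that \<open>E((f \<circ> \<phi> g) h|P) - (E(f|P) \<circ> \<phi> g) E(h|P)\<close> tends to \<open>0\<close>
  in \<open>L\<^sup>1\<close> as \<open>g\<close> leaves finite sets (\<open>relative_mixing\<close>).

  \<^bold>\<open>Fibres.\<close> Let \<open>f\<^sub>j\<close> be the distance to the \<open>j\<close>-th point of a dense sequence and \<open>v\<^sub>j\<close> its
  conditional variance given \<open>P\<close>. All \<open>v\<^sub>j\<close> vanish at \<open>x\<close> iff \<open>\<kappa> x\<close> is a Dirac measure. This is an
  invariant condition; if it held almost everywhere, then all Borel sets would have zero entropy.
  By ergodicity almost every \<open>x\<close> has some \<open>v\<^sub>j x > 0\<close>, and by Markov's inequality the averages of
  some \<open>v\<^sub>j (\<phi> g x)\<close> over \<open>g \<in> G\<^sub>n\<close> exceed some \<open>\<eta> > 0\<close> infinitely often (\<open>AE_frequent_variance\<close>).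
  For an open set \<open>V\<close>, mixing shows that on average over \<open>g \<in> G\<^sub>n\<close> the quantity
  \<open>\<kappa> x V * (\<integral>\<^sub>V (f\<^sub>j \<circ> \<phi> g)\<^sup>2) - (\<integral>\<^sub>V f\<^sub>j \<circ> \<phi> g)\<^sup>2\<close>, with integrals with respect to \<open>\<kappa> x\<close>, is close to
  \<open>(\<kappa> x V)\<^sup>2 v\<^sub>j (\<phi> g x)\<close>. It is at most a constant times \<open>\<kappa> x V\<close> times the integral over \<open>V\<close> of
  \<open>dist (\<phi> g x) (\<phi> g y)\<close>. So every \<open>V\<close> of positive measure contains points \<open>y\<close> of the support with
  mean distances to \<open>x\<close> above a \<open>\<delta>\<close> that does not depend on \<open>V\<close> (\<open>AE_far_points\<close>).

  \<^bold>\<open>Category.\<close> Points of the support that are mean asymptotic to \<open>x\<close> are dense by assumption. By the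
  triangle inequality, both small and large mean distances occur for a dense open set of pairs in
  the support, and a construction of Mycielski gives the dense union of Cantor sets.
\<close>

section \<open>Shannon entropy of finite-valued random variables\<close>

context prob_space
begin

definition rv_entropy :: "('a \<Rightarrow> 'b) \<Rightarrow> real" where
  "rv_entropy X = entropy (exp 1) (count_space (X ` space M)) X"

lemma information_space_exp: "information_space M (exp 1)"
  by unfold_locales auto

lemma rv_entropy_eq:
  assumes "simple_function M X"
  shows "rv_entropy X = - (\<Sum>v\<in>X ` space M. prob (X -` {v} \<inter> space M) * ln (prob (X -` {v} \<inter> space M)))"
proof -
  interpret information_space M "exp 1" by (rule information_space_exp)
  show ?thesis
    unfolding rv_entropy_def
    by (subst entropy_simple_distributed[OF simple_distributedI[OF assms measure_nonneg refl]])
       (simp add: log_def)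
qed

lemma rv_entropy_nonneg:
  assumes "simple_function M X"
  shows "0 \<le> rv_entropy X"
proof -
  have "prob A * ln (prob A) \<le> 0" for A
    by (cases "prob A = 0") (auto simp: mult_le_0_iff ln_le_zero_iff zero_less_measure_iff)
  then show ?thesis
    unfolding rv_entropy_eq[OF assms] by (simp add: sum_nonpos)
qed

lemma rv_entropy_mono:
  assumes X: "simple_function M X"
    and det: "\<And>x y. x \<in> space M \<Longrightarrow> y \<in> space M \<Longrightarrow> X x = X y \<Longrightarrow> Y x = Y y"
  shows "rv_entropy Y \<le> rv_entropy X" "simple_function M Y"
proof -
  interpret information_space M "exp 1" by (rule information_space_exp)
  define f where "f v = Y (SOME x. x \<in> space M \<and> X x = v)" for v
  have eq: "(f \<circ> X) x = Y x" if "x \<in> space M" for x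
  proof -
    have "(SOME z. z \<in> space M \<and> X z = X x) \<in> space M \<and> X (SOME z. z \<in> space M \<and> X z = X x) = X x"
      by (rule someI[of _ x]) (use that in auto)
    then show ?thesis unfolding f_def o_def using det that by blast
  qed
  show sY: "simple_function M Y"
    using simple_function_compose[OF X, of f] simple_function_cong[of M "f \<circ> X" Y] eq by auto
  have "rv_entropy Y = rv_entropy (f \<circ> X)"
  proof -
    have "Y ` space M = (f \<circ> X) ` space M" using eq by force
    moreover have "Y -` {v} \<inter> space M = (f \<circ> X) -` {v} \<inter> space M" for v using eq by auto
    ultimately show ?thesis
      unfolding rv_entropy_eq[OF sY] rv_entropy_eq[OF simple_function_compose[OF X, of f]] by simp
  qed
  also have "\<dots> \<le> rv_entropy X"
    using entropy_data_processing[OF X, of f] unfolding rv_entropy_def by simp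
  finally show "rv_entropy Y \<le> rv_entropy X" .
qed

lemma rv_entropy_cong_det:
  assumes X: "simple_function M X"
    and det: "\<And>x y. x \<in> space M \<Longrightarrow> y \<in> space M \<Longrightarrow> X x = X y \<longleftrightarrow> Y x = Y y"
  shows "rv_entropy Y = rv_entropy X"
  using rv_entropy_mono[of X Y] rv_entropy_mono[of Y X] assms by (metis antisym)

lemma rv_entropy_Pair_le:
  assumes X: "simple_function M X" and Y: "simple_function M Y"
  shows "rv_entropy (\<lambda>x. (X x, Y x)) \<le> rv_entropy X + rv_entropy Y"
proof -
  interpret information_space M "exp 1" by (rule information_space_exp)
  show ?thesis
    using entropy_chain_rule[OF X Y] conditional_entropy_less_eq_entropy[OF Y X]
    unfolding rv_entropy_def by simp
qed

lemma rv_entropy_le_ln_card: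
  assumes X: "simple_function M X" and S: "X ` space M \<subseteq> S" "finite S"
  shows "rv_entropy X \<le> ln (card S)"
proof -
  interpret information_space M "exp 1" by (rule information_space_exp)
  have "rv_entropy X \<le> ln (card (X ` space M))"
    using entropy_le_card[OF simple_distributedI[OF X measure_nonneg refl]]
    unfolding rv_entropy_def by (simp add: log_def)
  also have "\<dots> \<le> ln (card S)"
    using S not_empty by (subst ln_le_cancel_iff) (auto intro: card_mono simp: card_gt_0_iff finite_subset)
  finally show ?thesis .
qed

text \<open>Summing a function of \<open>h \<circ> W\<close> against the law of \<open>W\<close> only sees the law of \<open>h \<circ> W\<close>. This turns the
  explicit formula for conditional mutual information into a combination of four entropies.\<close>

lemma sum_prob_image_marginal:
  fixes g :: "'c \<Rightarrow> real"
  assumes W: "simple_function M W"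
  shows "(\<Sum>w\<in>W ` space M. prob (W -` {w} \<inter> space M) * g (h w)) =
    (\<Sum>v\<in>(\<lambda>x. h (W x)) ` space M. prob ((\<lambda>x. h (W x)) -` {v} \<inter> space M) * g v)"
proof -
  have fin: "finite (W ` space M)" using W by (rule simple_functionD)
  have "prob ((\<lambda>x. h (W x)) -` {v} \<inter> space M) =
      (\<Sum>w\<in>{w \<in> W ` space M. h w = v}. prob (W -` {w} \<inter> space M))" for v
  proof -
    have "(\<lambda>x. h (W x)) -` {v} \<inter> space M = (\<Union>w\<in>{w \<in> W ` space M. h w = v}. W -` {w} \<inter> space M)"
      by auto
    also have "prob \<dots> = (\<Sum>w\<in>{w \<in> W ` space M. h w = v}. prob (W -` {w} \<inter> space M))"
      by (rule finite_measure_finite_Union)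
         (use fin simple_functionD(2)[OF W] in \<open>auto simp: disjoint_family_on_def\<close>)
    finally show ?thesis .
  qed
  then have "(\<Sum>v\<in>(\<lambda>x. h (W x)) ` space M. prob ((\<lambda>x. h (W x)) -` {v} \<inter> space M) * g v) =
    (\<Sum>v\<in>h ` W ` space M. \<Sum>w\<in>{w \<in> W ` space M. h w = v}. prob (W -` {w} \<inter> space M) * g (h w))"
    by (auto simp: image_image sum_distrib_right intro!: sum.cong)
  also have "\<dots> = (\<Sum>w\<in>W ` space M. prob (W -` {w} \<inter> space M) * g (h w))"
    by (rule sum.group) (use fin in auto)
  finally show ?thesis by simp
qed

text \<open>This is nonnegativity of the conditional mutual information of \<open>X\<close> and \<open>Y\<close> given \<open>Z\<close>, with the
  logarithm of the quotient expanded.\<close>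

lemma rv_entropy_submodular:
  assumes X: "simple_function M X" and Y: "simple_function M Y" and Z: "simple_function M Z"
  shows "rv_entropy (\<lambda>x. (X x, Y x, Z x)) + rv_entropy Z \<le>
    rv_entropy (\<lambda>x. (X x, Z x)) + rv_entropy (\<lambda>x. (Y x, Z x))"
proof -
  interpret information_space M "exp 1" by (rule information_space_exp)
  let ?W = "\<lambda>x. (X x, Y x, Z x)"
  have sW: "simple_function M ?W" and sXZ: "simple_function M (\<lambda>x. (X x, Z x))"
    and sYZ: "simple_function M (\<lambda>x. (Y x, Z x))"
    using X Y Z by auto
  note sd = simple_distributedI[OF _ measure_nonneg refl]
  let ?p = "\<lambda>V v. prob (V -` {v} \<inter> space M)"
  let ?pw = "?p ?W" and ?pxz = "?p (\<lambda>x. (X x, Z x))" and ?pyz = "?p (\<lambda>x. (Y x, Z x))" and ?pz = "?p Z"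
  have "0 \<le> conditional_mutual_information (exp 1) (count_space (X ` space M))
     (count_space (Y ` space M)) (count_space (Z ` space M)) X Y Z"
    by (rule conditional_mutual_information_nonneg[OF X Y Z])
  also have "\<dots> = (\<Sum>(x, y, z)\<in>?W ` space M. ?pw (x, y, z) *
      ln (?pw (x, y, z) / (?pxz (x, z) * (?pyz (y,z) / ?pz z))))"
    by (subst conditional_mutual_information_eq[OF sd[OF Z] sd[OF sYZ] sd[OF sXZ] sd[OF sW]])
       (simp add: log_def)
  also have "\<dots> = (\<Sum>w\<in>?W ` space M. ?pw w * ln (?pw w)
      + ?pw w * ln (?pz (snd (snd w))) - ?pw w * ln (?pxz (fst w, snd (snd w)))
      - ?pw w * ln (?pyz (snd w)))"
  proof (rule sum.cong[OF refl], clarify)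
    fix x y z
    show "?pw (x, y, z) * ln (?pw (x, y, z) / (?pxz (x, z) * (?pyz (y,z) / ?pz z))) =
      ?pw (x, y, z) * ln (?pw (x, y, z)) + ?pw (x, y, z) * ln (?pz (snd (snd (x, y, z))))
      - ?pw (x, y, z) * ln (?pxz (fst (x, y, z), snd (snd (x, y, z))))
      - ?pw (x, y, z) * ln (?pyz (snd (x, y, z)))"
    proof (cases "?pw (x, y, z) = 0")
      case False
      then have 0: "?pw (x, y, z) > 0" by (simp add: zero_less_measure_iff)
      have "?pw (x, y, z) \<le> ?pxz (x, z)" "?pw (x, y, z) \<le> ?pyz (y, z)" "?pw (x, y, z) \<le> ?pz z"
        using simple_functionD(2)[OF sXZ] simple_functionD(2)[OF sYZ] simple_functionD(2)[OF Z]
        by (auto intro!: finite_measure_mono)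
      with 0 have "?pxz (x, z) > 0" "?pyz (y, z) > 0" "?pz z > 0" by auto
      with 0 show ?thesis by (simp add: ln_div ln_mult algebra_simps)
    qed simp
  qed
  also have "\<dots> = (\<Sum>w\<in>?W ` space M. ?pw w * ln (?pw w))
      + (\<Sum>w\<in>?W ` space M. ?pw w * ln (?pz (snd (snd w))))
      - (\<Sum>w\<in>?W ` space M. ?pw w * ln (?pxz (fst w, snd (snd w))))
      - (\<Sum>w\<in>?W ` space M. ?pw w * ln (?pyz (snd w)))"
    by (simp add: sum.distrib sum_subtractf)
  also have "(\<Sum>w\<in>?W ` space M. ?pw w * ln (?pw w)) = - rv_entropy ?W"
    by (simp add: rv_entropy_eq[OF sW])
  also have "(\<Sum>w\<in>?W ` space M. ?pw w * ln (?pz (snd (snd w)))) = - rv_entropy Z"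
    using sum_prob_image_marginal[OF sW, of "\<lambda>v. ln (?pz v)" "\<lambda>w. snd (snd w)"]
    by (simp add: rv_entropy_eq[OF Z])
  also have "(\<Sum>w\<in>?W ` space M. ?pw w * ln (?pxz (fst w, snd (snd w)))) = - rv_entropy (\<lambda>x. (X x, Z x))"
    using sum_prob_image_marginal[OF sW, of "\<lambda>v. ln (?pxz v)" "\<lambda>w. (fst w, snd (snd w))"]
    by (simp add: rv_entropy_eq[OF sXZ])
  also have "(\<Sum>w\<in>?W ` space M. ?pw w * ln (?pyz (snd w))) = - rv_entropy (\<lambda>x. (Y x, Z x))"
    using sum_prob_image_marginal[OF sW, of "\<lambda>v. ln (?pyz v)" "\<lambda>w. snd w"]
    by (simp add: rv_entropy_eq[OF sYZ])
  finally show ?thesis by simp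
qed

end

lemma binary_entropy_small:
  fixes e :: real
  assumes "e > 0"
  shows "\<exists>d>0. d < 1 \<and> (\<forall>p. 0 \<le> p \<longrightarrow> p \<le> d \<longrightarrow> - (p * ln p) - (1 - p) * ln (1 - p) \<le> e)"
proof -
  have "((\<lambda>p. - (p * ln p) - (1 - p) * ln (1 - p)) \<longlongrightarrow> 0) (at_right (0::real))"
    by real_asymp
  then have "\<forall>\<^sub>F p in at_right 0. - (p * ln p) - (1 - p) * ln (1 - p) < e"
    using assms by (rule order_tendstoD)
  then obtain b where b: "b > 0" "\<And>p. 0 < p \<Longrightarrow> p < b \<Longrightarrow> - (p * ln p) - (1 - p) * ln (1 - p) < e"
    by (auto simp: eventually_at_right_field)
  show ?thesis
  proof (intro exI[of _ "min (b/2) (1/2)"] conjI allI impI)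
    fix p :: real assume "0 \<le> p" "p \<le> min (b/2) (1/2)"
    then show "- (p * ln p) - (1 - p) * ln (1 - p) \<le> e"
      using b(2)[of p] b(1) assms by (cases "p = 0") auto
  qed (use b in auto)
qed

lemma (in prob_space) simple_function_mem: "B \<in> events \<Longrightarrow> simple_function M (\<lambda>x. x \<in> B)"
  unfolding simple_function_def
proof (intro conjI ballI)
  assume B: "B \<in> events"
  show "finite ((\<lambda>x. x \<in> B) ` space M)" by (rule finite_subset[of _ UNIV]) auto
  fix v
  have "(\<lambda>x. x \<in> B) -` {v} \<inter> space M = (if v then B \<inter> space M else space M - B)" by auto
  then show "(\<lambda>x. x \<in> B) -` {v} \<inter> space M \<in> events" using B by auto
qed

lemma (in prob_space) rv_entropy_indicator:
  assumes B: "B \<in> events"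
  shows "rv_entropy (\<lambda>x. x \<in> B) = - (prob B * ln (prob B)) - (1 - prob B) * ln (1 - prob B)"
proof -
  note s = simple_function_mem[OF B]
  let ?g = "\<lambda>v. prob ((\<lambda>x. x \<in> B) -` {v} \<inter> space M) * ln (prob ((\<lambda>x. x \<in> B) -` {v} \<inter> space M))"
  have T: "(\<lambda>x. x \<in> B) -` {True} \<inter> space M = B"
    using sets.sets_into_space[OF B] by auto
  have F: "(\<lambda>x. x \<in> B) -` {False} \<inter> space M = space M - B" by auto
  have "rv_entropy (\<lambda>x. x \<in> B) = - sum ?g ((\<lambda>x. x \<in> B) ` space M)"
    by (rule rv_entropy_eq[OF s])
  also have "sum ?g ((\<lambda>x. x \<in> B) ` space M) = sum ?g UNIV"
  proof (rule sum.mono_neutral_left)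
    show "\<forall>v\<in>UNIV - (\<lambda>x. x \<in> B) ` space M. ?g v = 0"
    proof
      fix v assume "v \<in> UNIV - (\<lambda>x. x \<in> B) ` space M"
      then have "(\<lambda>x. x \<in> B) -` {v} \<inter> space M = {}" by auto
      then show "?g v = 0" by simp
    qed
  qed auto
  also have "\<dots> = ?g True + ?g False" by (simp add: UNIV_bool)
  finally show ?thesis using T F prob_compl[OF B] by simp
qed

section \<open>Shearer inequality and the infimum rule for amenable groups\<close>

text \<open>When an element \<open>a\<close> is added to \<open>F\<close>, submodularity gives each of the at least \<open>k\<close> sets of the cover
  that contain \<open>a\<close> a gain no smaller than the gain of \<open>h F\<close>.\<close>

lemma shearer_submodular:
  fixes h :: "'a set \<Rightarrow> real"
  assumes "finite F"
    and empty: "h {} = 0"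
    and mono: "\<And>S a. insert a S \<subseteq> F \<Longrightarrow> h S \<le> h (insert a S)"
    and submod: "\<And>S S' a. S \<subseteq> S' \<Longrightarrow> insert a S' \<subseteq> F \<Longrightarrow> h (insert a S') + h S \<le> h (insert a S) + h S'"
    and T: "finite T"
    and cover: "\<And>a. a \<in> F \<Longrightarrow> k \<le> card {t \<in> T. a \<in> C t}"
  shows "real k * h F \<le> (\<Sum>t\<in>T. h (C t \<inter> F))"
  using assms(1) mono submod cover
proof (induction F rule: finite_induct)
  case empty
  then show ?case using assms(2) by simp
next
  case (insert a F)
  have IH: "real k * h F \<le> (\<Sum>t\<in>T. h (C t \<inter> F))"
  proof (rule insert.IH)
    show "h S \<le> h (insert b S)" if "insert b S \<subseteq> F" for S b
      by (rule insert.prems(1)) (use that in auto)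
    show "h (insert b S') + h S \<le> h (insert b S) + h S'" if "S \<subseteq> S'" "insert b S' \<subseteq> F" for S S' b
      by (rule insert.prems(2)) (use that in auto)
    show "k \<le> card {t \<in> T. b \<in> C t}" if "b \<in> F" for b
      by (rule insert.prems(3)) (use that in auto)
  qed
  let ?T = "{t \<in> T. a \<in> C t}"
  have gain: "h F \<le> h (insert a F)" using insert.prems(1) by blast
  have k: "k \<le> card ?T" using insert.prems(3) by blast
  have 1: "h (insert a F) - h F \<le> h (C t \<inter> insert a F) - h (C t \<inter> F)" if "t \<in> ?T" for t
  proof -
    have "C t \<inter> insert a F = insert a (C t \<inter> F)" using that by auto
    then show ?thesis using insert.prems(2)[of "C t \<inter> F" F a] by auto
  qed
  have 2: "C t \<inter> insert a F = C t \<inter> F" if "t \<in> T - ?T" for t using that by auto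
  have "real k * (h (insert a F) - h F) \<le> card ?T * (h (insert a F) - h F)"
    using k gain by (intro mult_right_mono) auto
  also have "\<dots> = (\<Sum>t\<in>?T. h (insert a F) - h F)" by simp
  also have "\<dots> \<le> (\<Sum>t\<in>?T. h (C t \<inter> insert a F) - h (C t \<inter> F))" using 1 by (rule sum_mono)
  also have "\<dots> = (\<Sum>t\<in>T. h (C t \<inter> insert a F) - h (C t \<inter> F))"
    by (rule sum.mono_neutral_left) (use T 2 in auto)
  finally show ?case using IH by (simp add: sum_subtractf algebra_simps)
qed

lemma (in group) folner_shift_small:
  assumes F: "folner_seq G F" and g: "g \<in> carrier G"
  shows "(\<lambda>n. real (card {f \<in> F n. g \<otimes> f \<notin> F n}) / real (card (F n))) \<longlonglongrightarrow> 0"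
proof (rule tendsto_sandwich[OF _ _ tendsto_const])
  show "(\<lambda>n. real (card (sym_diff (g <# F n) (F n))) / real (card (F n))) \<longlonglongrightarrow> 0"
    using F g unfolding folner_seq_def by blast
  have "card {f \<in> F n. g \<otimes> f \<notin> F n} \<le> card (sym_diff (g <# F n) (F n))" for n
  proof (rule card_inj_on_le[of "\<lambda>f. g \<otimes> f"])
    have fin: "finite (F n)" "F n \<subseteq> carrier G" using F unfolding folner_seq_def by auto
    have "f = f'" if "f \<in> F n" "f' \<in> F n" "g \<otimes> f = g \<otimes> f'" for f f'
      using fin g that by (metis Units_eq Units_l_cancel subsetD)
    then show "inj_on ((\<otimes>) g) {f \<in> F n. g \<otimes> f \<notin> F n}"
      by (auto simp: inj_on_def)
    show "(\<otimes>) g ` {f \<in> F n. g \<otimes> f \<notin> F n} \<subseteq> sym_diff (g <# F n) (F n)"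
      by (auto simp: l_coset_def)
    have "g <# F n = (\<otimes>) g ` F n" by (auto simp: l_coset_def)
    then show "finite (sym_diff (g <# F n) (F n))" using fin by auto
  qed
  then show "\<forall>\<^sub>F n in sequentially. real (card {f \<in> F n. g \<otimes> f \<notin> F n}) / real (card (F n))
      \<le> real (card (sym_diff (g <# F n) (F n))) / real (card (F n))"
    by (intro always_eventually allI divide_right_mono) auto
qed auto

lemma (in group) folner_seqD:
  assumes "folner_seq G F"
  shows "finite (F n)" "F n \<noteq> {}" "F n \<subseteq> carrier G" "card (F n) > 0"
  using assms unfolding folner_seq_def by (auto simp: card_gt_0_iff)

text \<open>The space is required to be the whole type because \<open>dynamical_join\<close> forms preimages in the whole
  type.\<close>

locale mp_action = group G + prob_space M
  for G :: "('g, 'm) monoid_scheme" (structure) and M :: "'x measure" +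
  fixes \<phi> :: "'g \<Rightarrow> 'x \<Rightarrow> 'x"
  assumes space_M[simp]: "space M = UNIV"
    and action_measurable: "g \<in> carrier G \<Longrightarrow> \<phi> g \<in> M \<rightarrow>\<^sub>M M"
    and action_distr: "g \<in> carrier G \<Longrightarrow> distr M M (\<phi> g) = M"
    and action_mult: "g \<in> carrier G \<Longrightarrow> h \<in> carrier G \<Longrightarrow> \<phi> (g \<otimes> h) x = \<phi> g (\<phi> h x)"
    and action_one: "\<phi> \<one> x = x"
begin

lemma vimage_action_events: "g \<in> carrier G \<Longrightarrow> A \<in> events \<Longrightarrow> \<phi> g -` A \<in> events"
  using measurable_sets[OF action_measurable] by auto

lemma prob_vimage_action: "g \<in> carrier G \<Longrightarrow> A \<in> events \<Longrightarrow> prob (\<phi> g -` A) = prob A"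
  using measure_distr[OF action_measurable, of g A] action_distr[of g] by auto

text \<open>The joint value of \<open>X\<close> along the orbit pieces given by \<open>S\<close>, i.e. a random variable generating the
  join of the partitions \<open>g\<^sup>-\<^sup>1 \<alpha>\<close>, \<open>g \<in> S\<close>, if \<open>X\<close> generates \<open>\<alpha>\<close>.\<close>

definition join :: "('x \<Rightarrow> 'b) \<Rightarrow> 'g set \<Rightarrow> 'x \<Rightarrow> 'g \<Rightarrow> 'b" where
  "join X S = (\<lambda>x. restrict (\<lambda>g. X (\<phi> g x)) S)"

lemma join_eq_iff: "join X S x = join X S y \<longleftrightarrow> (\<forall>g\<in>S. X (\<phi> g x) = X (\<phi> g y))"
  unfolding join_def restrict_def fun_eq_iff by meson

lemma simple_function_action:
  "simple_function M X \<Longrightarrow> g \<in> carrier G \<Longrightarrow> simple_function M (\<lambda>x. X (\<phi> g x))"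
  unfolding simple_function_def
proof (intro conjI ballI)
  assume X: "finite (X ` space M) \<and> (\<forall>x\<in>X ` space M. X -` {x} \<inter> space M \<in> events)" and g: "g \<in> carrier G"
  show "finite ((\<lambda>x. X (\<phi> g x)) ` space M)" by (rule finite_subset[of _ "X ` space M"]) (use X in auto)
  fix v assume "v \<in> (\<lambda>x. X (\<phi> g x)) ` space M"
  then have "X -` {v} \<inter> space M \<in> events" using X by auto
  from vimage_action_events[OF g this] show "(\<lambda>x. X (\<phi> g x)) -` {v} \<inter> space M \<in> events"
    by (simp add: vimage_def)
qed

lemma simple_function_join:
  assumes X: "simple_function M X" and S: "finite S" "S \<subseteq> carrier G"
  shows "simple_function M (join X S)"
  using S
proof (induction S rule: finite_induct)
  case empty
  have "join X {} = (\<lambda>x. (\<lambda>g. undefined))" by (auto simp: join_def fun_eq_iff)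
  then show ?case by simp
next
  case (insert a S)
  have "simple_function M (\<lambda>x. (X (\<phi> a x), join X S x))"
    using insert simple_function_action[OF X, of a] by auto
  then show ?case
    by (rule rv_entropy_mono(2)) (use insert in \<open>auto simp: join_eq_iff\<close>)
qed

lemma rv_entropy_action:
  assumes X: "simple_function M X" and k: "k \<in> carrier G"
  shows "rv_entropy (\<lambda>x. X (\<phi> k x)) = rv_entropy X"
proof -
  have surj: "range (\<phi> k) = UNIV"
  proof -
    have "y = \<phi> k (\<phi> (inv k) y)" for y
      using action_mult[of k "inv k" y] k action_one by simp
    then show ?thesis by (metis surjI)
  qed
  have "(\<lambda>x. X (\<phi> k x)) ` UNIV = X ` range (\<phi> k)" by (simp only: image_image)
  then have rng: "(\<lambda>x. X (\<phi> k x)) ` UNIV = X ` UNIV" using surj by simp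
  have "prob ((\<lambda>x. X (\<phi> k x)) -` {v}) = prob (X -` {v})" for v
    using prob_vimage_action[OF k, of "X -` {v}"] simple_functionD(2)[OF X, of "{v}"]
    by (simp add: vimage_def)
  then show ?thesis
    by (simp add: rv_entropy_eq[OF X] rv_entropy_eq[OF simple_function_action[OF X k]] rng)
qed

lemma rv_entropy_join_translate:
  assumes X: "simple_function M X" and S: "finite S" "S \<subseteq> carrier G" and k: "k \<in> carrier G"
  shows "rv_entropy (join X ((\<lambda>s. s \<otimes> k) ` S)) = rv_entropy (join X S)"
proof -
  have "rv_entropy (join X ((\<lambda>s. s \<otimes> k) ` S)) = rv_entropy (\<lambda>x. join X S (\<phi> k x))"
  proof (rule rv_entropy_cong_det)
    show "simple_function M (\<lambda>x. join X S (\<phi> k x))"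
      by (intro simple_function_action simple_function_join assms)
    show "join X S (\<phi> k x) = join X S (\<phi> k y) \<longleftrightarrow>
      join X ((\<lambda>s. s \<otimes> k) ` S) x = join X ((\<lambda>s. s \<otimes> k) ` S) y" for x y
      using S k by (auto simp: join_eq_iff action_mult subset_iff)
  qed
  also have "\<dots> = rv_entropy (join X S)"
    by (intro rv_entropy_action simple_function_join assms)
  finally show ?thesis .
qed

lemma rv_entropy_join_mono:
  assumes X: "simple_function M X" and S: "finite S'" "S' \<subseteq> carrier G" "S \<subseteq> S'"
  shows "rv_entropy (join X S) \<le> rv_entropy (join X S')"
  by (rule rv_entropy_mono(1)) (use assms in \<open>auto simp: join_eq_iff intro: simple_function_join\<close>)

lemma rv_entropy_join_submodular:
  assumes X: "simple_function M X" and S: "finite S'" "S \<subseteq> S'" "insert a S' \<subseteq> carrier G"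
  shows "rv_entropy (join X (insert a S')) + rv_entropy (join X S) \<le>
    rv_entropy (join X (insert a S)) + rv_entropy (join X S')"
proof -
  have fin: "finite S" using S finite_subset by auto
  have sa: "simple_function M (\<lambda>x. X (\<phi> a x))" using X S by (intro simple_function_action) auto
  have sS: "simple_function M (join X S)" and sS': "simple_function M (join X S')"
    using X S fin by (auto intro!: simple_function_join)
  have "rv_entropy (join X (insert a S')) = rv_entropy (\<lambda>x. (X (\<phi> a x), join X S' x, join X S x))"
    by (rule rv_entropy_cong_det) (use S sa sS sS' in \<open>auto simp: join_eq_iff\<close>)
  moreover have "rv_entropy (join X (insert a S)) = rv_entropy (\<lambda>x. (X (\<phi> a x), join X S x))"
    by (rule rv_entropy_cong_det) (use S sa sS sS' in \<open>auto simp: join_eq_iff\<close>)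
  moreover have "rv_entropy (join X S') = rv_entropy (\<lambda>x. (join X S' x, join X S x))"
    by (rule rv_entropy_cong_det) (use S sa sS sS' in \<open>auto simp: join_eq_iff\<close>)
  ultimately show ?thesis using rv_entropy_submodular[OF sa sS' sS] by simp
qed

lemma rv_entropy_join_empty:
  fixes X :: "'x \<Rightarrow> 'b"
  shows "rv_entropy (join X {}) = 0"
proof -
  have "join X {} = (\<lambda>x. (\<lambda>g. undefined))" by (auto simp: join_def fun_eq_iff)
  then have s: "simple_function M (join X {})" by simp
  have "rv_entropy (join X {}) \<le> ln (real (card {\<lambda>g::'g. undefined :: 'b}))"
    by (rule rv_entropy_le_ln_card[OF s]) (auto simp: join_def fun_eq_iff)
  then show ?thesis using rv_entropy_nonneg[OF s] by simp
qed

text \<open>The infimum rule: Shearer's inequality applied to the right translates of a finite set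
  \<open>K\<close>, each of which has the same entropy as \<open>K\<close>.\<close>

lemma rv_entropy_join_shearer:
  assumes X: "simple_function M X"
    and F: "finite F" "F \<subseteq> carrier G" and K: "finite K" "K \<subseteq> carrier G"
  shows "card K * rv_entropy (join X F) \<le>
    card (\<Union>k\<in>K. (\<lambda>f. inv k \<otimes> f) ` F) * rv_entropy (join X K)"
proof -
  let ?T = "\<Union>k\<in>K. (\<lambda>f. inv k \<otimes> f) ` F"
  let ?C = "\<lambda>t. (\<lambda>k. k \<otimes> t) ` K"
  let ?h = "\<lambda>S. rv_entropy (join X S)"
  have T: "finite ?T" "?T \<subseteq> carrier G" using F K by auto
  have "card K * ?h F \<le> (\<Sum>t\<in>?T. ?h (?C t \<inter> F))"
  proof (rule shearer_submodular[where h = ?h and C = ?C and T = ?T])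
    show "?h S \<le> ?h (insert a S)" if "insert a S \<subseteq> F" for S a
      using that F by (intro rv_entropy_join_mono[OF X]) (auto intro: finite_subset)
    show "?h (insert a S') + ?h S \<le> ?h (insert a S) + ?h S'" if "S \<subseteq> S'" "insert a S' \<subseteq> F" for S S' a
      using that F by (intro rv_entropy_join_submodular[OF X]) (auto intro: finite_subset)
    fix a assume a: "a \<in> F"
    show "card K \<le> card {t \<in> ?T. a \<in> ?C t}"
    proof (rule card_inj_on_le[of "\<lambda>k. inv k \<otimes> a"])
      show "inj_on (\<lambda>k. inv k \<otimes> a) K"
      proof (rule inj_onI)
        fix k l assume kl: "k \<in> K" "l \<in> K" "inv k \<otimes> a = inv l \<otimes> a"
        then have "inv k = inv l" using K F a by (metis inv_closed right_cancel subsetD)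
        then show "k = l" using kl K by (metis inv_inv subsetD)
      qed
      have "k \<otimes> (inv k \<otimes> a) = a" if "k \<in> K" for k
        using that K F a by (simp add: m_assoc[symmetric] subset_iff)
      then have "a \<in> ?C (inv k \<otimes> a)" if "k \<in> K" for k
        using that by (metis image_eqI)
      then show "(\<lambda>k. inv k \<otimes> a) ` K \<subseteq> {t \<in> ?T. a \<in> ?C t}"
        using a by blast
      show "finite {t \<in> ?T. a \<in> ?C t}" by (rule finite_subset[OF _ T(1)]) blast
    qed
  qed (use F T rv_entropy_join_empty in auto)
  also have "\<dots> \<le> (\<Sum>t\<in>?T. ?h K)"
  proof (rule sum_mono)
    fix t assume t: "t \<in> ?T"
    have "?h (?C t \<inter> F) \<le> ?h (?C t)"
      using F K T t by (intro rv_entropy_join_mono[OF X]) (auto intro!: m_closed)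
    also have "\<dots> = ?h K" using T t by (intro rv_entropy_join_translate[OF X K]) auto
    finally show "?h (?C t \<inter> F) \<le> ?h K" .
  qed
  finally show ?thesis by simp
qed

text \<open>The limit is the infimum of \<open>rv_entropy (join X K) / card K\<close> over finite nonempty \<open>K\<close>. The lower
  bound is trivial; the upper bound is the infimum rule, because \<open>K\<^sup>-\<^sup>1 F\<close> is only slightly larger
  than a sufficiently invariant \<open>F\<close>.\<close>

lemma entropy_limit_exists:
  assumes X: "simple_function M X"
  shows "\<exists>h. \<forall>F. folner_seq G F \<longrightarrow> (\<lambda>n. rv_entropy (join X (F n)) / card (F n)) \<longlonglongrightarrow> h"
proof -
  let ?h = "\<lambda>S. rv_entropy (join X S)"
  define \<K> where "\<K> = {K. finite K \<and> K \<noteq> {} \<and> K \<subseteq> carrier G}"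
  define I where "I = (INF K\<in>\<K>. ?h K / card K)"
  have ge: "I \<le> ?h K / card K" if "K \<in> \<K>" for K
    unfolding I_def
  proof (rule cINF_lower[OF _ that])
    show "bdd_below ((\<lambda>K. ?h K / card K) ` \<K>)"
      by (rule bdd_belowI[of _ 0])
         (auto simp: \<K>_def intro!: divide_nonneg_nonneg rv_entropy_nonneg simple_function_join[OF X])
  qed
  have "\<one> \<in> carrier G" by simp
  then have ne: "\<K> \<noteq> {}" by (auto simp: \<K>_def intro!: exI[of _ "{\<one>}"])
  have "(\<lambda>n. ?h (F n) / card (F n)) \<longlonglongrightarrow> I" if F: "folner_seq G F" for F
  proof (rule order_tendstoI)
    note F' = folner_seqD[OF F]
    fix a assume "a < I"
    also have "I \<le> ?h (F n) / card (F n)" for n using F' by (intro ge) (auto simp: \<K>_def)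
    finally show "\<forall>\<^sub>F n in sequentially. a < ?h (F n) / card (F n)" by simp
  next
    note F' = folner_seqD[OF F]
    fix a assume "I < a"
    then obtain K where K: "K \<in> \<K>" "?h K / card K < a"
      using cInf_lessD[of "(\<lambda>K. ?h K / card K) ` \<K>" a] ne unfolding I_def by auto
    then have fK: "finite K" "K \<subseteq> carrier G" "card K > 0" by (auto simp: \<K>_def card_gt_0_iff)
    let ?b = "\<lambda>k n. real (card {f \<in> F n. inv k \<otimes> f \<notin> F n}) / real (card (F n))"
    have bound: "?h (F n) / card (F n) \<le> (1 + (\<Sum>k\<in>K. ?b k n)) * (?h K / card K)" for n
    proof -
      let ?T = "\<Union>k\<in>K. (\<lambda>f. inv k \<otimes> f) ` F n"
      have "card ?T \<le> card (F n \<union> (\<Union>k\<in>K. (\<lambda>f. inv k \<otimes> f) ` {f \<in> F n. inv k \<otimes> f \<notin> F n}))"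
        using F' fK by (intro card_mono) auto
      also have "\<dots> \<le> card (F n) + card (\<Union>k\<in>K. (\<lambda>f. inv k \<otimes> f) ` {f \<in> F n. inv k \<otimes> f \<notin> F n})"
        by (rule card_Un_le)
      also have "card (\<Union>k\<in>K. (\<lambda>f. inv k \<otimes> f) ` {f \<in> F n. inv k \<otimes> f \<notin> F n})
          \<le> (\<Sum>k\<in>K. card ((\<lambda>f. inv k \<otimes> f) ` {f \<in> F n. inv k \<otimes> f \<notin> F n}))"
        by (rule card_UN_le[OF fK(1)])
      also have "\<dots> \<le> (\<Sum>k\<in>K. card {f \<in> F n. inv k \<otimes> f \<notin> F n})"
        using F' by (intro sum_mono card_image_le) auto
      finally have "card ?T \<le> card (F n) + (\<Sum>k\<in>K. card {f \<in> F n. inv k \<otimes> f \<notin> F n})" by simp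
      then have "real (card ?T) \<le> real (card (F n)) + (\<Sum>k\<in>K. real (card {f \<in> F n. inv k \<otimes> f \<notin> F n}))"
        by (simp flip: of_nat_add of_nat_sum)
      moreover have "?h K \<ge> 0" using fK by (intro rv_entropy_nonneg simple_function_join X) auto
      ultimately have "real (card ?T) * ?h K \<le>
          (real (card (F n)) + (\<Sum>k\<in>K. real (card {f \<in> F n. inv k \<otimes> f \<notin> F n}))) * ?h K"
        by (rule mult_right_mono)
      then have "card K * ?h (F n) \<le>
          (real (card (F n)) + (\<Sum>k\<in>K. real (card {f \<in> F n. inv k \<otimes> f \<notin> F n}))) * ?h K"
        using rv_entropy_join_shearer[OF X F'(1)[of n] F'(3)[of n] fK(1,2)] by (rule order_trans[rotated])
      also have "\<dots> = card (F n) * (1 + (\<Sum>k\<in>K. ?b k n)) * ?h K"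
        using F'(4)[of n] by (simp add: sum_divide_distrib[symmetric] distrib_left)
      finally show ?thesis using F'(4)[of n] fK(3) by (simp add: field_simps)
    qed
    have "(\<lambda>n. (1 + (\<Sum>k\<in>K. ?b k n)) * (?h K / card K)) \<longlonglongrightarrow> (1 + (\<Sum>k\<in>K. 0)) * (?h K / card K)"
      using fK by (intro tendsto_intros folner_shift_small[OF F]) auto
    then have "\<forall>\<^sub>F n in sequentially. (1 + (\<Sum>k\<in>K. ?b k n)) * (?h K / card K) < a"
      by (rule order_tendstoD) (use K in simp)
    then show "\<forall>\<^sub>F n in sequentially. ?h (F n) / card (F n) < a"
      by eventually_elim (use bound in \<open>auto intro: le_less_trans\<close>)
  qed
  then show ?thesis by blast
qed

text \<open>The formulation with \<open>\<alpha> - {{}}\<close> covers partitions listed with a superfluous empty set, such as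
  \<open>{A, UNIV - A}\<close> for \<open>A = UNIV\<close>. Choice functions that differ on \<open>F\<close> can only give the same member of
  \<open>dynamical_join\<close> if that member is empty, and empty members do not contribute.\<close>

lemma partition_entropy_dynamical_join:
  assumes X: "simple_function M X" and F: "finite F" "F \<subseteq> carrier G"
    and \<alpha>: "\<alpha> - {{}} = (\<lambda>v. X -` {v}) ` range X"
  shows "partition_entropy M (dynamical_join \<phi> F \<alpha>) = rv_entropy (join X F)"
proof -
  let ?f = "\<lambda>A. prob A * ln (prob A)"
  have sJ: "simple_function M (join X F)" by (rule simple_function_join[OF X F])
  have eq: "dynamical_join \<phi> F \<alpha> - {{}} = (\<lambda>v. join X F -` {v}) ` range (join X F)" (is "?L = ?R")
  proof (intro equalityI subsetI)
    fix A assume "A \<in> ?L"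
    then obtain c where A: "A = (\<Inter>g\<in>F. \<phi> g -` c g)" "\<forall>g\<in>F. c g \<in> \<alpha>" "A \<noteq> {}"
      by (auto simp: dynamical_join_def)
    then obtain x where x: "x \<in> A" by auto
    have "c g = X -` {X (\<phi> g x)}" if "g \<in> F" for g
    proof -
      have 1: "\<phi> g x \<in> c g" using x A that by auto
      then have "c g \<in> \<alpha> - {{}}" using A that by auto
      then obtain v where "c g = X -` {v}" unfolding \<alpha> by auto
      then show ?thesis using 1 by auto
    qed
    then have "A = join X F -` {join X F x}"
      unfolding A(1) by (auto simp: join_eq_iff)
    then show "A \<in> ?R" by (metis image_eqI rangeI)
  next
    fix A assume "A \<in> ?R"
    then obtain x where A: "A = join X F -` {join X F x}" by auto
    have "X -` {X (\<phi> g x)} \<in> \<alpha> - {{}}" for g unfolding \<alpha> by simp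
    then have "X -` {X (\<phi> g x)} \<in> \<alpha>" for g by blast
    moreover have "A = (\<Inter>g\<in>F. \<phi> g -` (X -` {X (\<phi> g x)}))"
      unfolding A by (auto simp: join_eq_iff)
    ultimately have "A \<in> dynamical_join \<phi> F \<alpha>"
      unfolding dynamical_join_def
      by (intro CollectI exI[of _ "\<lambda>g. X -` {X (\<phi> g x)}"]) simp
    moreover have "x \<in> A" unfolding A by simp
    ultimately show "A \<in> ?L" by (metis DiffI empty_iff singletonD)
  qed
  have fin: "finite (range (join X F))" using simple_functionD(1)[OF sJ] by simp
  have "sum ?f (dynamical_join \<phi> F \<alpha>) = sum ?f (dynamical_join \<phi> F \<alpha> - {{}})"
  proof (cases "finite (dynamical_join \<phi> F \<alpha>)")
    case True
    then show ?thesis by (intro sum.mono_neutral_right) auto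
  next
    case False
    then show ?thesis by simp
  qed
  also have "\<dots> = (\<Sum>v\<in>range (join X F). ?f (join X F -` {v}))"
  proof -
    have "inj_on (\<lambda>v. join X F -` {v}) (range (join X F))"
    proof (rule inj_onI)
      fix v w assume "v \<in> range (join X F)" "join X F -` {v} = join X F -` {w}"
      then obtain x where "v = join X F x" "x \<in> join X F -` {w}" by auto
      then show "v = w" by simp
    qed
    then show ?thesis unfolding eq by (simp add: sum.reindex)
  qed
  finally show ?thesis
    unfolding partition_entropy_def rv_entropy_eq[OF sJ] by simp
qed

end

section \<open>The sigma-algebra of zero-entropy sets\<close>

text \<open>Greedy choice: each set that is not yet hit has at least \<open>N\<close> elements, so by double counting some
  element of \<open>F\<close> hits at least the proportion \<open>N / card F\<close> of them.\<close>

lemma greedy_hitting_set: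
  fixes A :: "'t \<Rightarrow> 'a set"
  assumes F: "finite F" "F \<noteq> {}" and T: "finite T"
    and A: "\<And>t. t \<in> T \<Longrightarrow> A t \<subseteq> F \<and> N \<le> card (A t)" and N: "N \<le> card F"
  shows "\<exists>R\<subseteq>F. card R \<le> K \<and>
    real (card {t \<in> T. A t \<inter> R = {}}) \<le> card T * (1 - real N / real (card F)) ^ K"
proof (induction K)
  case 0
  show ?case by (rule exI[of _ "{}"]) simp
next
  case (Suc K)
  then obtain R where R: "R \<subseteq> F" "card R \<le> K"
    "real (card {t \<in> T. A t \<inter> R = {}}) \<le> card T * (1 - real N / real (card F)) ^ K" by blast
  define U where "U = {t \<in> T. A t \<inter> R = {}}"
  have finU: "finite U" unfolding U_def using T by auto
  have cF: "real (card F) > 0" using F by (simp add: card_gt_0_iff)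
  have "\<exists>r\<in>F. real N * card U / card F \<le> card {t \<in> U. r \<in> A t}"
  proof (rule ccontr)
    assume "\<not> ?thesis"
    then have "(\<Sum>r\<in>F. real (card {t \<in> U. r \<in> A t})) < (\<Sum>r\<in>F. real N * card U / card F)"
      using F by (intro sum_strict_mono) auto
    also have "\<dots> = real N * card U" using cF by simp
    also have "real N * card U = (\<Sum>t\<in>U. real N)" by simp
    also have "\<dots> \<le> (\<Sum>t\<in>U. real (card {r \<in> F. r \<in> A t}))"
    proof (rule sum_mono)
      fix t assume "t \<in> U"
      then have "t \<in> T" by (simp add: U_def)
      then have "A t \<subseteq> F" "N \<le> card (A t)" using A by auto
      moreover from this have "{r \<in> F. r \<in> A t} = A t" by auto
      ultimately show "real N \<le> real (card {r \<in> F. r \<in> A t})" by simp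
    qed
    also have "\<dots> = (\<Sum>r\<in>F. real (card {t \<in> U. r \<in> A t}))"
      unfolding of_nat_sum[symmetric] using sum_multicount_gen[OF finU F(1), of "\<lambda>t r. r \<in> A t" "\<lambda>r. card {t \<in> U. r \<in> A t}"]
      by simp
    finally show False by simp
  qed
  then obtain r where r: "r \<in> F" "real N * card U / card F \<le> card {t \<in> U. r \<in> A t}" by blast
  have split: "{t \<in> T. A t \<inter> insert r R = {}} = U - {t \<in> U. r \<in> A t}"
    unfolding U_def by auto
  have "card (U - {t \<in> U. r \<in> A t}) = card U - card {t \<in> U. r \<in> A t}"
    by (rule card_Diff_subset) (use finU in auto)
  moreover have "card {t \<in> U. r \<in> A t} \<le> card U" by (rule card_mono) (use finU in auto)
  ultimately have "real (card {t \<in> T. A t \<inter> insert r R = {}}) = real (card U) - real (card {t \<in> U. r \<in> A t})"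
    unfolding split by (simp add: of_nat_diff)
  also have "\<dots> \<le> card U * (1 - real N / card F)" using r(2) by (simp add: algebra_simps)
  also have "\<dots> \<le> (card T * (1 - real N / real (card F)) ^ K) * (1 - real N / card F)"
    using R(3) N cF unfolding U_def by (intro mult_right_mono) auto
  finally have "real (card {t \<in> T. A t \<inter> insert r R = {}}) \<le> card T * (1 - real N / real (card F)) ^ Suc K"
    by (simp add: mult_ac)
  moreover have "card (insert r R) \<le> Suc K"
    using R(2) card_insert_le_m1[of "Suc K" R r] by simp
  ultimately show ?case using R(1) r(1) by (intro exI[of _ "insert r R"]) auto
qed

text \<open>The indices from \<open>n0\<close> on are cut into \<open>m\<close> consecutive blocks of length \<open>N\<close>, and the sets to be hit
  are the right translates by \<open>g\<close> of the images of the blocks under \<open>k\<close>. With \<open>p * card F\<close> greedy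
  choices the proportion of blocks that are missed is at most \<open>exp (- (N * p / 2))\<close>, whatever small
  density \<open>p\<close> was prescribed. The other exceptional \<open>g\<close> are those with a translate leaving \<open>F\<close>.\<close>

lemma (in group) sparse_hitting_set:
  fixes k :: "nat \<Rightarrow> 'a" and p \<eta> :: real
  assumes F: "finite F" "F \<subseteq> carrier G" "F \<noteq> {}"
    and k: "inj k" "range k \<subseteq> carrier G"
    and p: "0 < p" "2 / p \<le> card F" and N: "N \<le> card F" and \<eta>: "m * exp (- (N * p / 2)) \<le> \<eta>"
  shows "\<exists>R\<subseteq>F. card R \<le> p * card F \<and>
    card {g \<in> F. \<not> (\<exists>\<iota>. \<forall>j<m. \<iota> j \<in> {n0 + j * N..<n0 + j * N + N} \<and> k (\<iota> j) \<otimes> g \<in> R)}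
      \<le> (\<Sum>i\<in>{n0..<n0 + m * N}. real (card {g \<in> F. k i \<otimes> g \<notin> F})) + \<eta> * card F"
proof -
  define J where "J = {n0..<n0 + m * N}"
  define B where "B j = {n0 + j * N..<n0 + j * N + N}" for j
  define A where "A = (\<lambda>(j, g). (\<lambda>i. k i \<otimes> g) ` B j)"
  define T where "T = {..<m} \<times> {g \<in> F. \<forall>i\<in>J. k i \<otimes> g \<in> F}"
  define K where "K = nat \<lfloor>p * card F\<rfloor>"
  have BJ: "B j \<subseteq> J" if "j < m" for j
  proof -
    have "j * N + N \<le> m * N" using that mult_le_mono1[of "Suc j" m N] by simp
    then show ?thesis unfolding B_def J_def by auto
  qed
  have cF: "real (card F) > 0" using F by (simp add: card_gt_0_iff)
  have finT: "finite T" unfolding T_def using F by auto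
  have "\<exists>R\<subseteq>F. card R \<le> K \<and>
    real (card {t \<in> T. A t \<inter> R = {}}) \<le> card T * (1 - real N / real (card F)) ^ K"
  proof (rule greedy_hitting_set[OF F(1) F(3) finT _ N])
    fix t assume "t \<in> T"
    then obtain j g where t: "t = (j, g)" "j < m" "g \<in> F" "\<forall>i\<in>J. k i \<otimes> g \<in> F"
      by (auto simp: T_def)
    have "inj_on (\<lambda>i. k i \<otimes> g) (B j)"
      using k t F by (auto simp: inj_on_def range_subsetD subset_iff)
    then have "card (A t) = N" by (simp add: A_def t card_image B_def)
    moreover have "A t \<subseteq> F" using t BJ by (auto simp: A_def)
    ultimately show "A t \<subseteq> F \<and> N \<le> card (A t)" by simp
  qed
  then obtain R where R: "R \<subseteq> F" "card R \<le> K"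
    "real (card {t \<in> T. A t \<inter> R = {}}) \<le> card T * (1 - real N / real (card F)) ^ K" by blast
  have "p * card F \<ge> 0" using p by simp
  then have K: "K \<le> p * card F" "p * card F - 1 \<le> K" unfolding K_def by linarith+
  \<comment> \<open>rounding \<open>p * card F\<close> down to the integer \<open>K\<close> costs at most half of it\<close>
  have "p * card F \<ge> 2" using p by (simp add: field_simps)
  then have K2: "p * card F / 2 \<le> K" using K by simp
  have "(1 - real N / real (card F)) ^ K \<le> exp (- (real N / real (card F))) ^ K"
    using N cF by (intro power_mono) (auto simp: exp_ge_add_one_self[of "- x" for x] intro: order_trans[OF _ exp_ge_add_one_self])
  also have "\<dots> = exp (- (real N / real (card F) * K))"
    by (simp add: exp_of_nat_mult[symmetric] mult.commute)
  also have "\<dots> \<le> exp (- (N * p / 2))"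
  proof -
    have "N * p / 2 = real N / card F * (p * card F / 2)" using cF by simp
    also have "\<dots> \<le> real N / card F * K" using K2 by (intro mult_left_mono) auto
    finally show ?thesis by simp
  qed
  finally have "card T * (1 - real N / real (card F)) ^ K \<le> (m * card F) * exp (- (N * p / 2))"
  proof -
    assume *: "(1 - real N / real (card F)) ^ K \<le> exp (- (N * p / 2))"
    have "card T \<le> card ({..<m} \<times> F)"
      by (rule card_mono) (use F in \<open>auto simp: T_def\<close>)
    then have "real (card T) \<le> m * card F" by (simp add: card_cartesian_product flip: of_nat_mult)
    with * show ?thesis by (intro mult_mono) (use N cF in auto)
  qed
  also have "\<dots> = (m * exp (- (N * p / 2))) * card F" by simp
  also have "\<dots> \<le> \<eta> * card F" using \<eta> by (intro mult_right_mono) auto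
  finally have unhit: "real (card {t \<in> T. A t \<inter> R = {}}) \<le> \<eta> * card F" using R(3) by linarith
  let ?Bad = "{g \<in> F. \<not> (\<exists>\<iota>. \<forall>j<m. \<iota> j \<in> B j \<and> k (\<iota> j) \<otimes> g \<in> R)}"
  have "?Bad \<subseteq> (\<Union>i\<in>J. {g \<in> F. k i \<otimes> g \<notin> F}) \<union> snd ` {t \<in> T. A t \<inter> R = {}}"
  proof
    fix g assume g: "g \<in> ?Bad"
    have "\<exists>j<m. \<forall>i\<in>B j. k i \<otimes> g \<notin> R"
    proof (rule ccontr)
      assume "\<not> ?thesis"
      then have "\<forall>j\<in>{..<m}. \<exists>i. i \<in> B j \<and> k i \<otimes> g \<in> R" by auto
      then have "\<exists>\<iota>. \<forall>j\<in>{..<m}. \<iota> j \<in> B j \<and> k (\<iota> j) \<otimes> g \<in> R" by (rule bchoice)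
      then show False using g by auto
    qed
    then obtain j where j: "j < m" "\<forall>i\<in>B j. k i \<otimes> g \<notin> R" by blast
    show "g \<in> (\<Union>i\<in>J. {g \<in> F. k i \<otimes> g \<notin> F}) \<union> snd ` {t \<in> T. A t \<inter> R = {}}"
    proof (cases "\<forall>i\<in>J. k i \<otimes> g \<in> F")
      case True
      then have "(j, g) \<in> {t \<in> T. A t \<inter> R = {}}" using g j by (auto simp: T_def A_def)
      then show ?thesis by force
    next
      case False
      then show ?thesis using g by auto
    qed
  qed
  then have "card ?Bad \<le> card ((\<Union>i\<in>J. {g \<in> F. k i \<otimes> g \<notin> F}) \<union> snd ` {t \<in> T. A t \<inter> R = {}})"
    by (rule card_mono[rotated]) (use F finT in \<open>auto simp: J_def\<close>)
  also have "\<dots> \<le> card (\<Union>i\<in>J. {g \<in> F. k i \<otimes> g \<notin> F}) + card (snd ` {t \<in> T. A t \<inter> R = {}})"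
    by (rule card_Un_le)
  also have "\<dots> \<le> (\<Sum>i\<in>J. card {g \<in> F. k i \<otimes> g \<notin> F}) + card {t \<in> T. A t \<inter> R = {}}"
    by (intro add_mono card_UN_le card_image_le) (use finT in \<open>auto simp: J_def\<close>)
  finally have "real (card ?Bad) \<le> (\<Sum>i\<in>J. real (card {g \<in> F. k i \<otimes> g \<notin> F})) + card {t \<in> T. A t \<inter> R = {}}"
    by (simp flip: of_nat_add of_nat_sum)
  then have "real (card ?Bad) \<le> (\<Sum>i\<in>J. real (card {g \<in> F. k i \<otimes> g \<notin> F})) + \<eta> * card F"
    using unhit by linarith
  moreover have "card R \<le> p * card F" using R(2) K(1) by linarith
  ultimately show ?thesis using R(1) unfolding B_def J_def by blast
qed

lemma (in prob_space) rv_entropy_family: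
  assumes I: "finite I" and Y: "\<And>i. i \<in> I \<Longrightarrow> simple_function M (Y i)"
  shows "simple_function M (\<lambda>x. restrict (\<lambda>i. Y i x) I)" (is "?s I")
    and "rv_entropy (\<lambda>x. restrict (\<lambda>i. Y i x) I) \<le> (\<Sum>i\<in>I. rv_entropy (Y i))" (is "?h I \<le> _")
proof -
  have "?s I \<and> ?h I \<le> (\<Sum>i\<in>I. rv_entropy (Y i))"
    using I Y
  proof (induction I rule: finite_induct)
    case empty
    have eq: "(\<lambda>x. restrict (\<lambda>i. Y i x) {}) = (\<lambda>x. \<lambda>i. undefined)" by (auto simp: fun_eq_iff)
    have s: "?s {}" unfolding eq by simp
    have "?h {} \<le> ln (real (card {\<lambda>i::'b. undefined :: 'c}))"
      by (rule rv_entropy_le_ln_card[OF s]) (auto simp: fun_eq_iff)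
    then show ?case using s by simp
  next
    case (insert a I)
    have IH: "?s I" "?h I \<le> (\<Sum>i\<in>I. rv_entropy (Y i))" using insert by blast+
    have s: "simple_function M (\<lambda>x. (Y a x, restrict (\<lambda>i. Y i x) I))"
      by (rule simple_function_Pair[OF _ IH(1)]) (use insert.prems in blast)
    have det: "restrict (\<lambda>i. Y i x) (insert a I) = restrict (\<lambda>i. Y i y) (insert a I)"
      if "(Y a x, restrict (\<lambda>i. Y i x) I) = (Y a y, restrict (\<lambda>i. Y i y) I)" for x y
    proof
      fix i
      have "restrict (\<lambda>i. Y i x) I = restrict (\<lambda>i. Y i y) I"
        using that by (simp del: restrict_apply)
      then have "restrict (\<lambda>i. Y i x) I i = restrict (\<lambda>i. Y i y) I i" by (rule fun_cong)
      then show "restrict (\<lambda>i. Y i x) (insert a I) i = restrict (\<lambda>i. Y i y) (insert a I) i"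
        using that by (cases "i = a"; cases "i \<in> I") (simp_all del: restrict_apply add: restrict_def)
    qed
    have "?h (insert a I) \<le> rv_entropy (\<lambda>x. (Y a x, restrict (\<lambda>i. Y i x) I))"
      by (rule rv_entropy_mono(1)[OF s]) (rule det)
    also have "\<dots> \<le> rv_entropy (Y a) + ?h I"
      using insert.prems by (intro rv_entropy_Pair_le IH) auto
    also have "\<dots> \<le> (\<Sum>i\<in>insert a I. rv_entropy (Y i))" using insert.hyps IH(2) by simp
    finally show ?case using rv_entropy_mono(2)[OF s, of "\<lambda>x. restrict (\<lambda>i. Y i x) (insert a I)"] det by blast
  qed
  then show "?s I" "?h I \<le> (\<Sum>i\<in>I. rv_entropy (Y i))" by auto
qed

lemma (in prob_space) rv_entropy_mem_le: "B \<in> events \<Longrightarrow> rv_entropy (\<lambda>x. x \<in> B) \<le> 1"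
proof -
  assume B: "B \<in> events"
  have "rv_entropy (\<lambda>x. x \<in> B) \<le> ln (real (card (UNIV :: bool set)))"
    by (rule rv_entropy_le_ln_card[OF simple_function_mem[OF B]]) auto
  also have "\<dots> \<le> 1" using ln_le_minus_one[of 2] by simp
  finally show ?thesis .
qed

context mp_action
begin

lemma rv_entropy_join_le_family:
  assumes X: "simple_function M X" and F: "finite F" "F \<subseteq> carrier G"
  shows "rv_entropy (join X F) \<le> card F * rv_entropy X"
proof -
  have "rv_entropy (join X F) \<le> (\<Sum>g\<in>F. rv_entropy (\<lambda>x. X (\<phi> g x)))"
    unfolding join_def by (rule rv_entropy_family) (use assms in \<open>auto intro: simple_function_action\<close>)
  also have "\<dots> = (\<Sum>g\<in>F. rv_entropy X)"
    by (rule sum.cong) (use F in \<open>auto intro!: rv_entropy_action[OF X]\<close>)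
  finally show ?thesis by simp
qed

text \<open>If \<open>W\<close> determines all translates \<open>X \<circ> \<phi> g\<close> up to knowing whether an error \<open>err g\<close> has occurred,
  it suffices to add the binary entropies of the errors. This replaces estimates of conditional
  entropies.\<close>

lemma rv_entropy_join_le_errors:
  assumes W: "simple_function M W" and F: "finite F" "F \<subseteq> carrier G"
    and err: "\<And>g. g \<in> F \<Longrightarrow> err g \<in> events"
    and det: "\<And>x y g. g \<in> F \<Longrightarrow> W x = W y \<Longrightarrow> x \<in> err g \<longleftrightarrow> y \<in> err g \<Longrightarrow> X (\<phi> g x) = X (\<phi> g y)"
  shows "rv_entropy (join X F) \<le> rv_entropy W + (\<Sum>g\<in>F. rv_entropy (\<lambda>x. x \<in> err g))"
proof -
  let ?E = "\<lambda>x. restrict (\<lambda>g. x \<in> err g) F"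
  have E: "simple_function M ?E" "rv_entropy ?E \<le> (\<Sum>g\<in>F. rv_entropy (\<lambda>x. x \<in> err g))"
    using F err by (auto intro!: rv_entropy_family simple_function_mem)
  have "rv_entropy (join X F) \<le> rv_entropy (\<lambda>x. (W x, ?E x))"
  proof (rule rv_entropy_mono(1))
    fix x y assume "(W x, ?E x) = (W y, ?E y)"
    then have 1: "W x = W y" and 2: "?E x = ?E y" by auto
    have "x \<in> err g \<longleftrightarrow> y \<in> err g" if "g \<in> F" for g using fun_cong[OF 2, of g] that by simp
    then show "join X F x = join X F y" unfolding join_eq_iff using det 1 by blast
  qed (use W E in auto)
  also have "\<dots> \<le> rv_entropy W + rv_entropy ?E" by (rule rv_entropy_Pair_le[OF W E(1)])
  finally show ?thesis using E(2) by simp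
qed

definition zero_entropy_set :: "'x set \<Rightarrow> bool" where
  "zero_entropy_set B \<longleftrightarrow> B \<in> events \<and>
    (\<forall>F. folner_seq G F \<longrightarrow> (\<lambda>n. rv_entropy (join (\<lambda>x. x \<in> B) (F n)) / card (F n)) \<longlonglongrightarrow> 0)"

lemma zero_entropy_setD:
  assumes "zero_entropy_set B"
  shows "B \<in> events"
    and "folner_seq G F \<Longrightarrow> (\<lambda>n. rv_entropy (join (\<lambda>x. x \<in> B) (F n)) / card (F n)) \<longlonglongrightarrow> 0"
  using assms unfolding zero_entropy_set_def by auto

lemma zero_entropy_setI:
  assumes B: "B \<in> events"
    and *: "\<And>F (\<eta>::real). folner_seq G F \<Longrightarrow> \<eta> > 0 \<Longrightarrow>
      \<forall>\<^sub>F n in sequentially. rv_entropy (join (\<lambda>x. x \<in> B) (F n)) \<le> \<eta> * card (F n)"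
  shows "zero_entropy_set B"
  unfolding zero_entropy_set_def
proof (intro conjI allI impI order_tendstoI)
  fix F a assume F: "folner_seq G F"
  note F' = folner_seqD[OF F]
  have nn: "0 \<le> rv_entropy (join (\<lambda>x. x \<in> B) (F n)) / card (F n)" for n
    using F' by (intro divide_nonneg_nonneg rv_entropy_nonneg simple_function_join simple_function_mem B) auto
  { assume "a < (0::real)"
    then show "\<forall>\<^sub>F n in sequentially. a < rv_entropy (join (\<lambda>x. x \<in> B) (F n)) / card (F n)"
      using nn by (intro always_eventually allI) (rule less_le_trans) }
  { assume a: "(0::real) < a"
    have "\<forall>\<^sub>F n in sequentially. rv_entropy (join (\<lambda>x. x \<in> B) (F n)) \<le> (a/2) * card (F n)"
      by (rule *[OF F]) (use a in simp)
    then show "\<forall>\<^sub>F n in sequentially. rv_entropy (join (\<lambda>x. x \<in> B) (F n)) / card (F n) < a"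
    proof eventually_elim
      case (elim n)
      have c: "0 < real (card (F n))" using F'(4)[of n] by simp
      then have "rv_entropy (join (\<lambda>x. x \<in> B) (F n)) / card (F n) \<le> a/2"
        using elim by (simp only: pos_divide_le_eq)
      also have "a/2 < a" using a by simp
      finally show ?case .
    qed }
qed (rule B)

lemma zero_entropy_set_eventually:
  fixes \<eta> :: real
  assumes "zero_entropy_set B" "folner_seq G F" "\<eta> > 0"
  shows "\<forall>\<^sub>F n in sequentially. rv_entropy (join (\<lambda>x. x \<in> B) (F n)) \<le> \<eta> * card (F n)"
proof -
  have "\<forall>\<^sub>F n in sequentially. rv_entropy (join (\<lambda>x. x \<in> B) (F n)) / card (F n) < \<eta>"
    using zero_entropy_setD(2)[OF assms(1,2)] assms(3) by (rule order_tendstoD)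
  then show ?thesis
  proof eventually_elim
    case (elim n)
    have "0 < real (card (F n))" using folner_seqD(4)[OF assms(2), of n] by simp
    then show ?case using elim by (simp add: pos_divide_less_eq)
  qed
qed

lemma zero_entropy_set_null:
  assumes B: "B \<in> events" "prob B = 0"
  shows "zero_entropy_set B"
proof (rule zero_entropy_setI[OF B(1)])
  fix F and \<eta> :: real assume F: "folner_seq G F" and \<eta>: "\<eta> > 0"
  have "rv_entropy (join (\<lambda>x. x \<in> B) (F n)) \<le> \<eta> * card (F n)" for n
  proof -
    have "rv_entropy (join (\<lambda>x. x \<in> B) (F n)) \<le> card (F n) * rv_entropy (\<lambda>x. x \<in> B)"
      using folner_seqD[OF F] by (intro rv_entropy_join_le_family simple_function_mem B) auto
    also have "\<dots> = 0" using B by (simp add: rv_entropy_indicator)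
    also have "0 \<le> \<eta> * card (F n)" using \<eta> by simp
    finally show ?thesis .
  qed
  then show "\<forall>\<^sub>F n in sequentially. rv_entropy (join (\<lambda>x. x \<in> B) (F n)) \<le> \<eta> * card (F n)" by simp
qed

lemma zero_entropy_set_compl:
  assumes "zero_entropy_set B"
  shows "zero_entropy_set (- B)"
proof -
  have B: "B \<in> events" using assms by (rule zero_entropy_setD)
  have "rv_entropy (join (\<lambda>x. x \<in> - B) (F n)) = rv_entropy (join (\<lambda>x. x \<in> B) (F n))"
    if "folner_seq G F" for F n
    using folner_seqD[OF that]
    by (intro rv_entropy_cong_det simple_function_join simple_function_mem B) (auto simp: join_eq_iff)
  moreover have "- B \<in> events" using B sets.compl_sets[OF B] by (simp add: Compl_eq_Diff_UNIV)
  ultimately show ?thesis using assms unfolding zero_entropy_set_def by simp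
qed

text \<open>If \<open>C\<close> approximates \<open>B\<close>, the translates of \<open>B\<close> are recovered from those of \<open>C\<close> and from the errors
  \<open>\<phi> g -` sym_diff B C\<close>, each of small binary entropy. In particular zero entropy passes to limits of
  sets, which gives countable unions below.\<close>

lemma zero_entropy_set_approx:
  assumes B: "B \<in> events"
    and *: "\<And>e. e > 0 \<Longrightarrow> \<exists>C. zero_entropy_set C \<and> prob (sym_diff B C) \<le> e"
  shows "zero_entropy_set B"
proof (rule zero_entropy_setI[OF B])
  fix F and \<eta> :: real assume F: "folner_seq G F" and \<eta>: "\<eta> > 0"
  note F' = folner_seqD[OF F]
  obtain d where d: "d > 0" "\<forall>p. 0 \<le> p \<longrightarrow> p \<le> d \<longrightarrow> - (p * ln p) - (1 - p) * ln (1 - p) \<le> \<eta> / 2"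
    using binary_entropy_small[of "\<eta>/2"] \<eta> by auto
  obtain C where C: "zero_entropy_set C" "prob (sym_diff B C) \<le> d" using *[OF d(1)] by blast
  note C' = zero_entropy_setD(1)[OF C(1)]
  have D: "sym_diff B C \<in> events" using B C' by auto
  have "\<forall>\<^sub>F n in sequentially. rv_entropy (join (\<lambda>x. x \<in> C) (F n)) \<le> \<eta>/2 * card (F n)"
    by (rule zero_entropy_set_eventually[OF C(1) F]) (use \<eta> in simp)
  then show "\<forall>\<^sub>F n in sequentially. rv_entropy (join (\<lambda>x. x \<in> B) (F n)) \<le> \<eta> * card (F n)"
  proof eventually_elim
    case (elim n)
    have "rv_entropy (join (\<lambda>x. x \<in> B) (F n)) \<le> rv_entropy (join (\<lambda>x. x \<in> C) (F n))
      + (\<Sum>g\<in>F n. rv_entropy (\<lambda>x. x \<in> \<phi> g -` sym_diff B C))"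
    proof (rule rv_entropy_join_le_errors)
      show "\<phi> g -` sym_diff B C \<in> events" if "g \<in> F n" for g
        by (rule vimage_action_events[OF _ D]) (use that F'(3)[of n] in auto)
    qed (use F' in \<open>auto simp: join_eq_iff intro!: simple_function_join simple_function_mem C'\<close>)
    also have "(\<Sum>g\<in>F n. rv_entropy (\<lambda>x. x \<in> \<phi> g -` sym_diff B C)) \<le> (\<Sum>g\<in>F n. \<eta>/2)"
    proof (rule sum_mono)
      fix g assume "g \<in> F n"
      then have g: "g \<in> carrier G" using F' by auto
      show "rv_entropy (\<lambda>x. x \<in> \<phi> g -` sym_diff B C) \<le> \<eta>/2"
        unfolding rv_entropy_indicator[OF vimage_action_events[OF g D]] prob_vimage_action[OF g D]
        using d C(2) by simp
    qed
    also have "\<dots> = \<eta>/2 * card (F n)" by simp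
    finally show ?case using elim by linarith
  qed
qed

lemma zero_entropy_set_Un:
  assumes A: "zero_entropy_set A" and B: "zero_entropy_set B"
  shows "zero_entropy_set (A \<union> B)"
proof (rule zero_entropy_setI)
  note A' = zero_entropy_setD(1)[OF A] and B' = zero_entropy_setD(1)[OF B]
  show "A \<union> B \<in> events" using A' B' by auto
  fix F and \<eta> :: real assume F: "folner_seq G F" and \<eta>: "\<eta> > 0"
  note F' = folner_seqD[OF F]
  have "\<forall>\<^sub>F n in sequentially. rv_entropy (join (\<lambda>x. x \<in> A) (F n)) \<le> \<eta>/2 * card (F n)"
    "\<forall>\<^sub>F n in sequentially. rv_entropy (join (\<lambda>x. x \<in> B) (F n)) \<le> \<eta>/2 * card (F n)"
    using \<eta> by (intro zero_entropy_set_eventually A B F; simp)+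
  then show "\<forall>\<^sub>F n in sequentially. rv_entropy (join (\<lambda>x. x \<in> A \<union> B) (F n)) \<le> \<eta> * card (F n)"
  proof eventually_elim
    case (elim n)
    have s: "simple_function M (join (\<lambda>x. x \<in> A) (F n))" "simple_function M (join (\<lambda>x. x \<in> B) (F n))"
      using F' by (auto intro!: simple_function_join simple_function_mem A' B')
    have "rv_entropy (join (\<lambda>x. x \<in> A \<union> B) (F n)) \<le>
      rv_entropy (\<lambda>x. (join (\<lambda>x. x \<in> A) (F n) x, join (\<lambda>x. x \<in> B) (F n) x))"
      by (rule rv_entropy_mono(1)) (use s in \<open>auto simp: join_eq_iff\<close>)
    also have "\<dots> \<le> rv_entropy (join (\<lambda>x. x \<in> A) (F n)) + rv_entropy (join (\<lambda>x. x \<in> B) (F n))"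
      by (rule rv_entropy_Pair_le[OF s])
    finally show ?case using elim by simp
  qed
qed

lemma zero_entropy_set_UN:
  fixes A :: "nat \<Rightarrow> 'x set"
  assumes A: "\<And>i. zero_entropy_set (A i)"
  shows "zero_entropy_set (\<Union>i. A i)"
proof -
  have A': "A i \<in> events" for i using A by (rule zero_entropy_setD)
  define C where "C n = (\<Union>i\<le>n. A i)" for n
  have C: "zero_entropy_set (C n)" for n
  proof (induction n)
    case 0 then show ?case using A by (simp add: C_def)
  next
    case (Suc n)
    have "C (Suc n) = C n \<union> A (Suc n)" by (auto simp: C_def atMost_Suc)
    then show ?case using Suc A zero_entropy_set_Un by simp
  qed
  have C': "C n \<in> events" for n using C by (rule zero_entropy_setD)
  show ?thesis
  proof (rule zero_entropy_set_approx)
    show U: "(\<Union>i. A i) \<in> events" using A' by auto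
    fix e :: real assume e: "e > 0"
    have "(\<lambda>n. prob (C n)) \<longlonglongrightarrow> prob (\<Union>n. C n)"
      by (rule finite_Lim_measure_incseq) (use C' in \<open>auto simp: incseq_def C_def intro: order_trans\<close>)
    moreover have "(\<Union>n. C n) = (\<Union>i. A i)" unfolding C_def by auto
    ultimately have "\<forall>\<^sub>F n in sequentially. prob (\<Union>i. A i) - e < prob (C n)"
      using e by (intro order_tendstoD(1)) auto
    then obtain n where n: "prob (\<Union>i. A i) - e < prob (C n)" by (auto simp: eventually_sequentially)
    have sub: "C n \<subseteq> (\<Union>i. A i)" unfolding C_def by auto
    then have "sym_diff (\<Union>i. A i) (C n) = (\<Union>i. A i) - C n" by auto
    then have "prob (sym_diff (\<Union>i. A i) (C n)) = prob (\<Union>i. A i) - prob (C n)"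
      using finite_measure_Diff[OF U C' sub] by simp
    then show "\<exists>C. zero_entropy_set C \<and> prob (sym_diff (\<Union>i. A i) C) \<le> e"
      using n C by (intro exI[of _ "C n"]) auto
  qed
qed

lemma sigma_algebra_zero_entropy: "sigma_algebra UNIV {B. zero_entropy_set B}"
  unfolding sigma_algebra_iff2
proof (intro conjI ballI allI impI)
  show "{} \<in> {B. zero_entropy_set B}" using zero_entropy_set_null[of "{}"] by simp
  show "UNIV - s \<in> {B. zero_entropy_set B}" if "s \<in> {B. zero_entropy_set B}" for s
    using that zero_entropy_set_compl by (simp add: Compl_eq_Diff_UNIV[symmetric])
  show "(\<Union>i. A i) \<in> {B. zero_entropy_set B}" if "range A \<subseteq> {B. zero_entropy_set B}" for A :: "nat \<Rightarrow> 'x set"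
    using that by (auto intro!: zero_entropy_set_UN)
qed simp

text \<open>The translates of \<open>\<phi> k -` B\<close> along \<open>F\<close> are translates of \<open>B\<close> along \<open>k F\<close>, which is almost \<open>F\<close>; the
  few remaining ones count as errors of entropy at most \<open>1\<close>.\<close>

lemma zero_entropy_set_vimage:
  assumes B: "zero_entropy_set B" and k: "k \<in> carrier G"
  shows "zero_entropy_set (\<phi> k -` B)"
proof (rule zero_entropy_setI)
  note B' = zero_entropy_setD(1)[OF B]
  show "\<phi> k -` B \<in> events" by (rule vimage_action_events[OF k B'])
  fix F and \<eta> :: real assume F: "folner_seq G F" and \<eta>: "\<eta> > 0"
  note F' = folner_seqD[OF F]
  have "\<forall>\<^sub>F n in sequentially. rv_entropy (join (\<lambda>x. x \<in> B) (F n)) \<le> \<eta>/2 * card (F n)"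
    using \<eta> by (intro zero_entropy_set_eventually B F) simp
  moreover have "\<forall>\<^sub>F n in sequentially. card {f \<in> F n. k \<otimes> f \<notin> F n} / real (card (F n)) < \<eta>/2"
    using folner_shift_small[OF F k] \<eta> by (intro order_tendstoD) auto
  ultimately show "\<forall>\<^sub>F n in sequentially. rv_entropy (join (\<lambda>x. x \<in> \<phi> k -` B) (F n)) \<le> \<eta> * card (F n)"
  proof eventually_elim
    case (elim n)
    let ?D = "{f \<in> F n. k \<otimes> f \<notin> F n}"
    let ?e = "\<lambda>g. if g \<in> ?D then \<phi> (k \<otimes> g) -` B else {}"
    have e: "?e g \<in> events" if "g \<in> F n" for g
      using that F'(3)[of n] k B' by (auto intro!: vimage_action_events)
    have "rv_entropy (join (\<lambda>x. x \<in> \<phi> k -` B) (F n)) \<le> rv_entropy (join (\<lambda>x. x \<in> B) (F n))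
      + (\<Sum>g\<in>F n. rv_entropy (\<lambda>x. x \<in> ?e g))"
    proof (rule rv_entropy_join_le_errors)
      fix x y g assume g: "g \<in> F n" and W: "join (\<lambda>x. x \<in> B) (F n) x = join (\<lambda>x. x \<in> B) (F n) y"
        and E: "x \<in> ?e g \<longleftrightarrow> y \<in> ?e g"
      have *: "\<phi> k (\<phi> g z) = \<phi> (k \<otimes> g) z" for z using g F' k by (intro action_mult[symmetric]) auto
      show "(\<phi> g x \<in> \<phi> k -` B) = (\<phi> g y \<in> \<phi> k -` B)"
        using W E g * by (cases "k \<otimes> g \<in> F n") (auto simp: join_eq_iff)
    qed (use F' e in \<open>auto intro!: simple_function_join simple_function_mem B'\<close>)
    also have "(\<Sum>g\<in>F n. rv_entropy (\<lambda>x. x \<in> ?e g)) \<le> (\<Sum>g\<in>F n. if g \<in> ?D then 1 else 0)"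
    proof (rule sum_mono)
      fix g assume g: "g \<in> F n"
      have "rv_entropy (\<lambda>x. x \<in> ({} :: 'x set)) = 0" using rv_entropy_indicator[of "{}"] by simp
      then show "rv_entropy (\<lambda>x. x \<in> ?e g) \<le> (if g \<in> ?D then 1 else 0)"
        using rv_entropy_mem_le[OF e[OF g]] by auto
    qed
    also have "\<dots> = card ?D"
      using F'(1)[of n] by (simp add: sum.If_cases Int_def)
    also have "card ?D \<le> \<eta>/2 * card (F n)" using elim(2) F'(4)[of n] by (simp add: field_simps)
    finally show ?case using elim(1) by simp
  qed
qed

end

section \<open>Blum--Hanson subsequences\<close>

text \<open>Ramsey's theorem, pairs being coloured by the interval of length \<open>e\<close> that contains \<open>p i j\<close>.\<close>

lemma infinite_subset_small_oscillation:
  fixes p :: "nat \<Rightarrow> nat \<Rightarrow> real"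
  assumes Z: "infinite Z" and sym: "\<And>i j. p i j = p j i" and bd: "\<And>i j. \<bar>p i j\<bar> \<le> B" and e: "e > 0"
  shows "\<exists>Y\<subseteq>Z. infinite Y \<and>
    (\<forall>i\<in>Y. \<forall>j\<in>Y. \<forall>i'\<in>Y. \<forall>j'\<in>Y. i \<noteq> j \<longrightarrow> i' \<noteq> j' \<longrightarrow> \<bar>p i j - p i' j'\<bar> \<le> e)"
proof -
  define c where "c X = nat \<lfloor>(p (Min X) (Max X) + B) / e\<rfloor>" for X
  have c: "c {i, j} = nat \<lfloor>(p i j + B) / e\<rfloor>" if "i \<noteq> j" for i j
    using that sym by (cases "i < j") (auto simp: c_def)
  have B: "0 \<le> p i j + B" "p i j + B \<le> 2 * B" for i j using bd[of i j] by linarith+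
  have less: "\<forall>X. X \<subseteq> Z \<and> finite X \<and> card X = 2 \<longrightarrow> c X < Suc (nat \<lfloor>2 * B / e\<rfloor>)"
  proof (intro allI impI)
    fix X :: "nat set"
    have "(p (Min X) (Max X) + B) / e \<le> 2 * B / e" using B e by (intro divide_right_mono) auto
    then show "c X < Suc (nat \<lfloor>2 * B / e\<rfloor>)" unfolding c_def
      by (simp add: less_Suc_eq_le floor_mono nat_mono)
  qed
  obtain Y t where Y: "Y \<subseteq> Z" "infinite Y" "\<forall>X. X \<subseteq> Y \<and> finite X \<and> card X = 2 \<longrightarrow> c X = t"
    using Ramsey[OF Z less] by blast
  have t: "real t \<le> (p i j + B) / e \<and> (p i j + B) / e < real t + 1" if "i \<in> Y" "j \<in> Y" "i \<noteq> j" for i j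
  proof -
    have "c {i, j} = t" using Y(3)[rule_format, of "{i, j}"] that by auto
    then have "t = nat \<lfloor>(p i j + B) / e\<rfloor>" using c[OF that(3)] by simp
    moreover have "0 \<le> (p i j + B) / e" using B e by simp
    ultimately show ?thesis by linarith
  qed
  have "\<bar>p i j - p i' j'\<bar> \<le> e" if "i \<in> Y" "j \<in> Y" "i' \<in> Y" "j' \<in> Y" "i \<noteq> j" "i' \<noteq> j'" for i j i' j'
  proof -
    have "\<bar>(p i j + B) / e - (p i' j' + B) / e\<bar> \<le> 1" using t[of i j] t[of i' j'] that by linarith
    moreover have "(p i j + B) / e - (p i' j' + B) / e = (p i j - p i' j') / e"
      by (simp add: diff_divide_distrib[symmetric])
    ultimately show ?thesis using e by (simp add: abs_divide)
  qed
  then show ?thesis using Y(1,2) by (intro exI[of _ Y]) auto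
qed

text \<open>A diagonal sequence through the infinite sets of the previous lemma for \<open>e = 1 / Suc n\<close>.\<close>

lemma subsequence_small_oscillation:
  fixes p :: "nat \<Rightarrow> nat \<Rightarrow> real"
  assumes sym: "\<And>i j. p i j = p j i" and bd: "\<And>i j. \<bar>p i j\<bar> \<le> B"
  obtains t :: "nat \<Rightarrow> nat" where "strict_mono t"
    "\<And>e. e > 0 \<Longrightarrow> \<exists>n. \<forall>i\<ge>n. \<forall>j\<ge>n. \<forall>i'\<ge>n. \<forall>j'\<ge>n. i \<noteq> j \<longrightarrow> i' \<noteq> j' \<longrightarrow>
      \<bar>p (t i) (t j) - p (t i') (t j')\<bar> \<le> e"
proof -
  let ?osc = "\<lambda>Y e. \<forall>i\<in>Y. \<forall>j\<in>Y. \<forall>i'\<in>Y. \<forall>j'\<in>Y. i \<noteq> j \<longrightarrow> i' \<noteq> j' \<longrightarrow> \<bar>p i j - p i' j'\<bar> \<le> e"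
  have "\<exists>Z. \<forall>n. (infinite (Z n) \<and> ?osc (Z n) (1 / real (Suc n))) \<and> Z (Suc n) \<subseteq> Z n"
  proof (rule dependent_nat_choice)
    show "\<exists>Y. infinite Y \<and> ?osc Y (1 / real (Suc 0))"
      using infinite_subset_small_oscillation[OF infinite_UNIV_nat sym bd, of "1 / real (Suc 0)"] by auto
    show "\<exists>Y. (infinite Y \<and> ?osc Y (1 / real (Suc (Suc n)))) \<and> Y \<subseteq> Z"
      if "infinite Z \<and> ?osc Z (1 / real (Suc n))" for Z n
      using infinite_subset_small_oscillation[OF conjunct1[OF that] sym bd, of "1 / real (Suc (Suc n))"]
      by (meson divide_pos_pos of_nat_0_less_iff zero_less_Suc zero_less_one)
  qed
  then obtain Z where Z': "\<forall>n. (infinite (Z n) \<and> ?osc (Z n) (1 / real (Suc n))) \<and> Z (Suc n) \<subseteq> Z n" ..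
  note Z = conjunct1[OF conjunct1[OF spec[OF Z']]] conjunct2[OF conjunct1[OF spec[OF Z']]]
    conjunct2[OF spec[OF Z']]
  have "\<exists>t. \<forall>n. t n \<in> Z n \<and> t n < t (Suc n)"
  proof (rule dependent_nat_choice)
    show "\<exists>x. x \<in> Z 0" using infinite_imp_nonempty[OF Z(1)[of 0]] by auto
    show "\<exists>y. y \<in> Z (Suc n) \<and> x < y" for x n
      using Z(1)[of "Suc n"] unfolding infinite_nat_iff_unbounded by blast
  qed
  then obtain t where t: "\<And>n. t n \<in> Z n" "\<And>n. t n < t (Suc n)" by blast
  have Zanti: "Z m \<subseteq> Z n" if "n \<le> m" for n m
    using that by (rule lift_Suc_antimono_le[of Z, OF Z(3)])
  have mono: "strict_mono t" using t(2) by (rule strict_monoI_Suc)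
  show ?thesis
  proof (rule that[OF mono])
    fix e :: real assume "e > 0"
    then obtain n where n: "1 / real (Suc n) < e" using nat_approx_posE by blast
    have "\<bar>p (t i) (t j) - p (t i') (t j')\<bar> \<le> e"
      if "i \<ge> n" "j \<ge> n" "i' \<ge> n" "j' \<ge> n" "i \<noteq> j" "i' \<noteq> j'" for i j i' j'
    proof -
      have in_Z: "t k \<in> Z n" if "k \<ge> n" for k using t(1) Zanti that by blast
      have "t i \<noteq> t j" "t i' \<noteq> t j'" using that mono by (auto simp: strict_mono_eq)
      then have "\<bar>p (t i) (t j) - p (t i') (t j')\<bar> \<le> 1 / real (Suc n)"
        using Z(2)[of n] in_Z that by blast
      then show ?thesis using n by linarith
    qed
    then show "\<exists>n. \<forall>i\<ge>n. \<forall>j\<ge>n. \<forall>i'\<ge>n. \<forall>j'\<ge>n. i \<noteq> j \<longrightarrow> i' \<noteq> j' \<longrightarrow>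
      \<bar>p (t i) (t j) - p (t i') (t j')\<bar> \<le> e" by blast
  qed
qed

context prob_space
begin

lemma integrable_bounded:
  fixes f :: "'a \<Rightarrow> real"
  assumes "f \<in> borel_measurable M" "\<And>x. \<bar>f x\<bar> \<le> C"
  shows "integrable M f"
  by (rule integrable_const_bound[of _ C]) (use assms in auto)

lemma expectation_abs_le_sqrt:
  assumes f: "f \<in> borel_measurable M" "\<And>x. \<bar>f x\<bar> \<le> C"
    and s: "expectation (\<lambda>x. (f x)\<^sup>2) \<le> s"
  shows "expectation (\<lambda>x. \<bar>f x\<bar>) \<le> sqrt s"
proof -
  have i1: "integrable M (\<lambda>x. \<bar>f x\<bar>)"
    by (rule integrable_bounded[of _ C]) (use f in auto)
  have i2: "integrable M (\<lambda>x. \<bar>f x\<bar>\<^sup>2)"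
    by (rule integrable_bounded[of _ "C\<^sup>2"]) (use f order_trans[OF f(2) abs_ge_self] in \<open>auto simp: abs_le_square_iff[symmetric]\<close>)
  have "(expectation (\<lambda>x. \<bar>f x\<bar>))\<^sup>2 \<le> expectation (\<lambda>x. \<bar>f x\<bar>\<^sup>2)"
    using variance_positive[of "\<lambda>x. \<bar>f x\<bar>"] variance_eq[OF i1 i2] by simp
  also have "\<dots> \<le> s" using s by simp
  finally show ?thesis by (rule real_le_rsqrt)
qed

text \<open>The averages over \<^emph>\<open>all\<close> sets of \<open>m\<close> large indices approximate the same \<open>u\<close>. This uniformity is
  what allows recovering \<open>u\<close> from any sufficiently large choice of terms.\<close>

definition uniform_average_limit :: "(nat \<Rightarrow> 'a \<Rightarrow> real) \<Rightarrow> ('a \<Rightarrow> real) \<Rightarrow> bool" where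
  "uniform_average_limit f u \<longleftrightarrow>
    (\<forall>e>0. \<exists>m>0. \<exists>n. \<forall>I. finite I \<longrightarrow> I \<subseteq> {n..} \<longrightarrow> card I = m \<longrightarrow>
      integrable M (\<lambda>x. (\<Sum>i\<in>I. f i x) / m - u x) \<and>
      expectation (\<lambda>x. \<bar>(\<Sum>i\<in>I. f i x) / m - u x\<bar>) \<le> e)"

lemma uniform_average_limitD:
  assumes "uniform_average_limit f u" "e > 0"
  shows "\<exists>m>0. \<exists>n. \<forall>I. finite I \<longrightarrow> I \<subseteq> {n..} \<longrightarrow> card I = m \<longrightarrow>
    integrable M (\<lambda>x. (\<Sum>i\<in>I. f i x) / m - u x) \<and>
    expectation (\<lambda>x. \<bar>(\<Sum>i\<in>I. f i x) / m - u x\<bar>) \<le> e"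
  by (rule mp[OF spec[OF assms(1)[unfolded uniform_average_limit_def]] assms(2)])

text \<open>Along a subsequence the inner products \<open>p i j\<close> of different terms are almost constant. Then two
  averages over many large indices have almost the same inner product \<open>a\<close> with each other as with
  themselves, as the diagonal terms are negligible; so they are close in \<open>L\<^sup>2\<close>. Hence the averages are
  Cauchy in \<open>L\<^sup>1\<close>, and \<open>u\<close> is their limit.\<close>

lemma blum_hanson_subsequence:
  fixes f :: "nat \<Rightarrow> 'a \<Rightarrow> real"
  assumes f: "\<And>i. f i \<in> borel_measurable M" "\<And>i x. \<bar>f i x\<bar> \<le> C"
  obtains t :: "nat \<Rightarrow> nat" and u where "strict_mono t" "u \<in> borel_measurable M"
    "uniform_average_limit (\<lambda>i. f (t i)) u"
proof -
  have C0: "C \<ge> 0" using f(2)[of 0 undefined] abs_ge_zero[of "f 0 undefined"] by linarith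
  define p where "p i j = expectation (\<lambda>x. f i x * f j x)" for i j
  have ff: "integrable M (\<lambda>x. f i x * f j x)" for i j
    by (rule integrable_bounded[of _ "C * C"]) (use f C0 in \<open>auto simp: abs_mult intro!: mult_mono\<close>)
  have pC: "\<bar>p i j\<bar> \<le> C\<^sup>2" for i j
  proof -
    have "\<bar>p i j\<bar> \<le> expectation (\<lambda>x. \<bar>f i x * f j x\<bar>)" unfolding p_def by (rule integral_abs_bound)
    also have "\<dots> \<le> expectation (\<lambda>x. C * C)"
    proof (rule integral_mono)
      show "integrable M (\<lambda>x. \<bar>f i x * f j x\<bar>)" using ff by (rule integrable_abs)
      show "\<bar>f i x * f j x\<bar> \<le> C * C" for x
        using f C0 by (auto simp: abs_mult intro!: mult_mono)
    qed simp
    also have "\<dots> = C\<^sup>2" by (simp add: prob_space power2_eq_square)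
    finally show ?thesis .
  qed
  have psym: "p i j = p j i" for i j unfolding p_def by (simp add: mult.commute)
  obtain t :: "nat \<Rightarrow> nat" where t: "strict_mono t"
    "\<And>e. e > 0 \<Longrightarrow> \<exists>n. \<forall>i\<ge>n. \<forall>j\<ge>n. \<forall>i'\<ge>n. \<forall>j'\<ge>n. i \<noteq> j \<longrightarrow> i' \<noteq> j' \<longrightarrow>
      \<bar>p (t i) (t j) - p (t i') (t j')\<bar> \<le> e"
    using subsequence_small_oscillation[where p = p, OF psym pC] by metis
  define avg where "avg I x = (\<Sum>i\<in>I. f (t i) x) / card I" for I x
  have avg_meas: "avg I \<in> borel_measurable M" for I
    unfolding avg_def using f(1) by measurable
  have avgC: "\<bar>avg I x\<bar> \<le> C" for I x
  proof (cases "card I = 0")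
    case True then show ?thesis using C0 by (auto simp: avg_def)
  next
    case False
    have "\<bar>\<Sum>i\<in>I. f (t i) x\<bar> \<le> (\<Sum>i\<in>I. \<bar>f (t i) x\<bar>)" by (rule sum_abs)
    also have "\<dots> \<le> (\<Sum>i\<in>I. C)" by (rule sum_mono) (rule f(2))
    finally show ?thesis using False by (simp add: avg_def field_simps)
  qed
  \<comment> \<open>the at most \<open>card I'\<close> diagonal terms among \<open>card I * card I'\<close> contribute at most \<open>2 * C\<^sup>2\<close> each\<close>
  have avg_inner: "\<bar>expectation (\<lambda>x. avg I x * avg I' x) - a\<bar> \<le> e + 2 * C\<^sup>2 / card I"
    if fin: "finite I" "finite I'" "I \<subseteq> {n..}" "I' \<subseteq> {n..}" "card I > 0" "card I' > 0" and "e \<ge> 0"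
      and a: "\<And>i j. n \<le> i \<Longrightarrow> n \<le> j \<Longrightarrow> i \<noteq> j \<Longrightarrow> \<bar>p (t i) (t j) - a\<bar> \<le> e" and aC: "\<bar>a\<bar> \<le> C\<^sup>2"
    for I I' n e a
  proof -
    let ?c = "real (card I) * real (card I')"
    have "expectation (\<lambda>x. avg I x * avg I' x) =
       expectation (\<lambda>x. (\<Sum>i\<in>I. \<Sum>j\<in>I'. f (t i) x * f (t j) x) / ?c)"
      unfolding avg_def by (simp add: sum_product)
    also have "\<dots> = (\<Sum>i\<in>I. \<Sum>j\<in>I'. p (t i) (t j)) / ?c"
      unfolding p_def using ff by simp
    also have "\<dots> - a = (\<Sum>i\<in>I. \<Sum>j\<in>I'. p (t i) (t j) - a) / ?c"
      using fin by (auto simp: sum_subtractf diff_divide_distrib card_gt_0_iff)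
    finally have "\<bar>expectation (\<lambda>x. avg I x * avg I' x) - a\<bar> = \<bar>\<Sum>i\<in>I. \<Sum>j\<in>I'. p (t i) (t j) - a\<bar> / ?c"
      by (simp add: abs_mult)
    also have "\<dots> \<le> (\<Sum>i\<in>I. \<Sum>j\<in>I'. e + (if i = j then 2 * C\<^sup>2 else 0)) / ?c"
    proof (rule divide_right_mono)
      have "\<bar>\<Sum>i\<in>I. \<Sum>j\<in>I'. p (t i) (t j) - a\<bar> \<le> (\<Sum>i\<in>I. \<Sum>j\<in>I'. \<bar>p (t i) (t j) - a\<bar>)"
        by (rule order_trans[OF sum_abs]) (intro sum_mono sum_abs)
      also have "\<dots> \<le> (\<Sum>i\<in>I. \<Sum>j\<in>I'. e + (if i = j then 2 * C\<^sup>2 else 0))"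
      proof (intro sum_mono)
        fix i j assume "i \<in> I" "j \<in> I'"
        then have "n \<le> i" "n \<le> j" using fin by auto
        then show "\<bar>p (t i) (t j) - a\<bar> \<le> e + (if i = j then 2 * C\<^sup>2 else 0)"
          using a[of i j] pC[of "t i" "t j"] aC \<open>e \<ge> 0\<close> by auto
      qed
      finally show "\<bar>\<Sum>i\<in>I. \<Sum>j\<in>I'. p (t i) (t j) - a\<bar> \<le> (\<Sum>i\<in>I. \<Sum>j\<in>I'. e + (if i = j then 2 * C\<^sup>2 else 0))" .
    qed simp
    also have "(\<Sum>i\<in>I. \<Sum>j\<in>I'. e + (if i = j then 2 * C\<^sup>2 else 0)) = ?c * e + (\<Sum>j\<in>I'. if j \<in> I then 2 * C\<^sup>2 else 0)"
      unfolding sum.distrib sum.swap[of _ I' I]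
      using fin by (simp add: sum.distrib sum.delta)
    also have "\<dots> \<le> ?c * e + (\<Sum>j\<in>I'. 2 * C\<^sup>2)"
      by (intro add_left_mono sum_mono) auto
    also have "(?c * e + (\<Sum>j\<in>I'. 2 * C\<^sup>2)) / ?c = e + 2 * C\<^sup>2 / card I"
      using fin(5,6) by (simp add: add_divide_distrib del: card_gt_0_iff)
    finally show ?thesis by (simp add: divide_right_mono)
  qed
  have close: "\<exists>m>0. \<exists>n. \<forall>I I'. finite I \<and> finite I' \<and> I \<subseteq> {n..} \<and> I' \<subseteq> {n..} \<and> m \<le> card I \<and> m \<le> card I'
      \<longrightarrow> expectation (\<lambda>x. \<bar>avg I x - avg I' x\<bar>) \<le> e" if e: "e > 0" for e
  proof -
    obtain n where n: "\<forall>i\<ge>n. \<forall>j\<ge>n. \<forall>i'\<ge>n. \<forall>j'\<ge>n. i \<noteq> j \<longrightarrow> i' \<noteq> j' \<longrightarrow>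
      \<bar>p (t i) (t j) - p (t i') (t j')\<bar> \<le> e\<^sup>2 / 8"
      using t(2)[of "e\<^sup>2 / 8"] e by auto
    obtain m :: nat where m: "16 * C\<^sup>2 / e\<^sup>2 < m" using reals_Archimedean2 by blast
    have m0: "m > 0"
    proof (rule ccontr)
      assume "\<not> m > 0"
      then show False using m e by (simp add: divide_less_0_iff)
    qed
    define a where "a = p (t n) (t (Suc n))"
    have aC: "\<bar>a\<bar> \<le> C\<^sup>2" unfolding a_def by (rule pC)
    have an: "\<bar>p (t i) (t j) - a\<bar> \<le> e\<^sup>2 / 8" if "n \<le> i" "n \<le> j" "i \<noteq> j" for i j
      unfolding a_def using n that by (metis le_SucI le_refl n_not_Suc_n)
    have inner: "\<bar>expectation (\<lambda>x. avg I x * avg I' x) - a\<bar> \<le> e\<^sup>2 / 4"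
      if "finite I" "finite I'" "I \<subseteq> {n..}" "I' \<subseteq> {n..}" "m \<le> card I" "m \<le> card I'" for I I'
    proof -
      have "\<bar>expectation (\<lambda>x. avg I x * avg I' x) - a\<bar> \<le> e\<^sup>2 / 8 + 2 * C\<^sup>2 / card I"
        by (rule avg_inner[of I I' n]) (use that m0 an aC in auto)
      also have "2 * C\<^sup>2 / card I \<le> 2 * C\<^sup>2 / m" using that m0 by (intro divide_left_mono) auto
      also have "2 * C\<^sup>2 / m \<le> e\<^sup>2 / 8" using m m0 e by (simp add: field_simps)
      finally show ?thesis by simp
    qed
    have "expectation (\<lambda>x. \<bar>avg I x - avg I' x\<bar>) \<le> e"
      if I: "finite I" "finite I'" "I \<subseteq> {n..}" "I' \<subseteq> {n..}" "m \<le> card I" "m \<le> card I'" for I I'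
    proof -
      have int: "integrable M (\<lambda>x. avg J x * avg J' x)" for J J'
        by (rule integrable_bounded[of _ "C * C"]) (use avg_meas avgC C0 in \<open>auto simp: abs_mult intro!: mult_mono\<close>)
      have "expectation (\<lambda>x. (avg I x - avg I' x)\<^sup>2) =
        expectation (\<lambda>x. avg I x * avg I x + avg I' x * avg I' x - 2 * (avg I x * avg I' x))"
        by (simp add: power2_eq_square algebra_simps)
      also have "\<dots> = expectation (\<lambda>x. avg I x * avg I x) + expectation (\<lambda>x. avg I' x * avg I' x)
         - 2 * expectation (\<lambda>x. avg I x * avg I' x)"
        using int by simp
      also have "\<dots> \<le> e\<^sup>2"
        using inner[of I I] inner[of I' I'] inner[of I I'] I by linarith
      finally have "expectation (\<lambda>x. (avg I x - avg I' x)\<^sup>2) \<le> e\<^sup>2" .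
      then have "expectation (\<lambda>x. \<bar>avg I x - avg I' x\<bar>) \<le> sqrt (e\<^sup>2)"
      proof (rule expectation_abs_le_sqrt[rotated 2])
        show "(\<lambda>x. avg I x - avg I' x) \<in> borel_measurable M" using avg_meas by measurable
        show "\<bar>avg I x - avg I' x\<bar> \<le> 2 * C" for x using avgC[of I x] avgC[of I' x] by linarith
      qed
      then show ?thesis using e by simp
    qed
    then show ?thesis using m0 by blast
  qed
  define s where "s N = avg {N..<N + Suc N}" for N
  have s_meas[measurable]: "s N \<in> borel_measurable M" for N unfolding s_def by (rule avg_meas)
  have s_int: "integrable M (s N)" for N
    unfolding s_def by (rule integrable_bounded[OF avg_meas avgC])
  have Cauchy: "\<exists>N. \<forall>i\<ge>N. \<forall>j\<ge>N. LINT x|M. norm (s i x - s j x) < e" if e: "e > 0" for e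
  proof -
    obtain m n where mn: "\<forall>I I'. finite I \<and> finite I' \<and> I \<subseteq> {n..} \<and> I' \<subseteq> {n..} \<and> m \<le> card I \<and> m \<le> card I'
      \<longrightarrow> expectation (\<lambda>x. \<bar>avg I x - avg I' x\<bar>) \<le> e / 2"
      using close[of "e/2"] e by auto
    have "LINT x|M. norm (s i x - s j x) < e" if "i \<ge> max m n" "j \<ge> max m n" for i j
    proof -
      have "expectation (\<lambda>x. \<bar>s i x - s j x\<bar>) \<le> e / 2"
        unfolding s_def by (rule mn[rule_format]) (use that in auto)
      then show ?thesis using e by simp
    qed
    then show ?thesis by blast
  qed
  obtain r where r: "strict_mono r" "AE x in M. Cauchy (\<lambda>i. s (r i) x)"
    using cauchy_L1_AE_cauchy_subseq[OF s_int Cauchy] by blast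
  define u where "u x = lim (\<lambda>i. s (r i) x)" for x
  have u_meas[measurable]: "u \<in> borel_measurable M" unfolding u_def by measurable
  have lim: "AE x in M. (\<lambda>i. s (r i) x) \<longlonglongrightarrow> u x"
    using r(2) by eventually_elim (auto simp: u_def Cauchy_convergent_iff convergent_LIMSEQ_iff)
  have sC: "\<bar>s N x\<bar> \<le> C" for N x unfolding s_def by (rule avgC)
  have uC: "AE x in M. \<bar>u x\<bar> \<le> C"
    using lim
  proof eventually_elim
    case (elim x)
    then have "(\<lambda>i. \<bar>s (r i) x\<bar>) \<longlonglongrightarrow> \<bar>u x\<bar>" by (rule tendsto_rabs)
    then show ?case by (rule LIMSEQ_le_const2) (use sC in auto)
  qed
  have u_int: "integrable M u" by (rule integrable_const_bound[of _ C]) (use uC in auto)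
  have conv: "(\<lambda>i. expectation (\<lambda>x. \<bar>s (r i) x - u x\<bar>)) \<longlonglongrightarrow> expectation (\<lambda>x. 0)"
  proof (rule integral_dominated_convergence[where w="\<lambda>x. 2 * C"])
    show "AE x in M. (\<lambda>i. \<bar>s (r i) x - u x\<bar>) \<longlonglongrightarrow> 0"
      using lim by eventually_elim (auto intro!: tendsto_eq_intros)
    show "AE x in M. norm \<bar>s (r i) x - u x\<bar> \<le> 2 * C" for i
      using uC
    proof eventually_elim
      case (elim x) then show ?case using sC[of "r i" x] by auto
    qed
  qed auto
  show ?thesis
  proof (rule that[OF t(1) u_meas], unfold uniform_average_limit_def, intro allI impI)
    fix e :: real assume e: "e > 0"
    obtain m n where m0: "m > 0" and mn: "\<forall>I I'. finite I \<and> finite I' \<and> I \<subseteq> {n..} \<and> I' \<subseteq> {n..} \<and> m \<le> card I \<and> m \<le> card I'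
      \<longrightarrow> expectation (\<lambda>x. \<bar>avg I x - avg I' x\<bar>) \<le> e / 2"
      using close[of "e/2"] e by auto
    have "\<forall>\<^sub>F i in sequentially. expectation (\<lambda>x. \<bar>s (r i) x - u x\<bar>) < e / 2"
      using conv e by (intro order_tendstoD) auto
    moreover have "\<forall>\<^sub>F i in sequentially. i \<ge> max m n" by (rule eventually_ge_at_top)
    ultimately have "\<forall>\<^sub>F i in sequentially. expectation (\<lambda>x. \<bar>s (r i) x - u x\<bar>) < e / 2 \<and> i \<ge> max m n"
      by eventually_elim simp
    then obtain i where i: "expectation (\<lambda>x. \<bar>s (r i) x - u x\<bar>) < e / 2" "i \<ge> max m n"
      by (auto simp: eventually_sequentially)
    have ri: "r i \<ge> max m n" using i(2) seq_suble[OF r(1), of i] by linarith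
    have "integrable M (\<lambda>x. (\<Sum>i\<in>I. f (t i) x) / m - u x) \<and>
      expectation (\<lambda>x. \<bar>(\<Sum>i\<in>I. f (t i) x) / m - u x\<bar>) \<le> e"
      if I: "finite I" "I \<subseteq> {n..}" "card I = m" for I
    proof
      have eq: "(\<Sum>i\<in>I. f (t i) x) / m = avg I x" for x by (simp add: avg_def I)
      have aI: "integrable M (avg I)" by (rule integrable_bounded[OF avg_meas avgC])
      show "integrable M (\<lambda>x. (\<Sum>i\<in>I. f (t i) x) / m - u x)" unfolding eq using aI u_int by simp
      have "expectation (\<lambda>x. \<bar>avg I x - u x\<bar>) \<le> expectation (\<lambda>x. \<bar>avg I x - s (r i) x\<bar> + \<bar>s (r i) x - u x\<bar>)"
        by (rule integral_mono) (use aI u_int s_int in auto)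
      also have "\<dots> = expectation (\<lambda>x. \<bar>avg I x - s (r i) x\<bar>) + expectation (\<lambda>x. \<bar>s (r i) x - u x\<bar>)"
        using aI u_int s_int by simp
      also have "expectation (\<lambda>x. \<bar>avg I x - s (r i) x\<bar>) \<le> e / 2"
        unfolding s_def by (rule mn[rule_format]) (use I ri in auto)
      finally show "expectation (\<lambda>x. \<bar>(\<Sum>i\<in>I. f (t i) x) / m - u x\<bar>) \<le> e"
        unfolding eq using i by simp
    qed
    then show "\<exists>m>0. \<exists>n. \<forall>I. finite I \<longrightarrow> I \<subseteq> {n..} \<longrightarrow> card I = m \<longrightarrow>
      integrable M (\<lambda>x. (\<Sum>i\<in>I. f (t i) x) / m - u x) \<and>
      expectation (\<lambda>x. \<bar>(\<Sum>i\<in>I. f (t i) x) / m - u x\<bar>) \<le> e" using m0 by blast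
  qed
qed

end

section \<open>Level sets of weak limits have zero entropy\<close>

context mp_action
begin

abbreviation pm :: "'x set \<Rightarrow> 'x \<Rightarrow> real" where
  "pm S x \<equiv> (if x \<in> S then 1 else -1)"

lemma markov_abs:
  assumes "integrable M f" "expectation (\<lambda>x. \<bar>f x\<bar>) \<le> c" "a > 0"
  shows "prob {x. \<bar>f x\<bar> \<ge> a} \<le> c / a"
proof -
  have "prob {x \<in> space M. \<bar>f x\<bar> \<ge> a} \<le> expectation (\<lambda>x. \<bar>f x\<bar>) / a"
    by (rule integral_Markov_inequality_measure[where A="{}"]) (use assms in auto)
  also have "\<dots> \<le> c / a" using assms by (intro divide_right_mono) auto
  finally show ?thesis by simp
qed

text \<open>Fix a small density \<open>p\<close>. The level set \<open>B\<close> agrees up to small measure with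
  \<open>W I = {x. v I x > c + e}\<close> for each set \<open>I\<close> of \<open>m\<close> large indices, where \<open>v I\<close> is the average over \<open>I\<close>
  formed with a finite-valued approximation \<open>h\<close> of \<open>f\<close>. Inside a large Folner set \<open>F\<close> choose the sparse
  set \<open>R\<close> of \<open>sparse_hitting_set\<close>. For most \<open>g \<in> F\<close> there is a set \<open>I g\<close> of \<open>m\<close> indices \<open>i\<close> with
  \<open>k i \<otimes> g \<in> R\<close>, so the translate of \<open>W (I g)\<close> by \<open>g\<close> can be read off from \<open>h\<close> along \<open>R\<close> and from the
  signs along \<open>F\<close>. The former has entropy at most \<open>p * card F * L\<close>, the latter \<open>o(card F)\<close> because the
  sets \<open>S i\<close> have zero entropy.\<close>

lemma zero_entropy_level_set:
  fixes f u :: "'x \<Rightarrow> real" and k :: "nat \<Rightarrow> 'g" and c :: real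
  assumes f: "f \<in> borel_measurable M" "\<And>x. \<bar>f x\<bar> \<le> C"
    and k: "inj k" "range k \<subseteq> carrier G"
    and S: "\<And>i. zero_entropy_set (S i)"
    and u: "u \<in> borel_measurable M"
    and avg: "uniform_average_limit (\<lambda>i x. pm (S i) x * f (\<phi> (k i) x)) u"
  shows "zero_entropy_set {x. u x > c}"
proof (rule zero_entropy_setI)
  define B where "B = {x. u x > c}"
  have B: "B \<in> events" unfolding B_def using u borel_measurable_less[of "\<lambda>_. c" M u] by simp
  then show "{x. u x > c} \<in> events" by (simp add: B_def)
  have S': "S i \<in> events" for i using S by (rule zero_entropy_setD)
  have fk: "(\<lambda>x. f (\<phi> (k i) x)) \<in> borel_measurable M" for i
    by (rule measurable_compose[OF action_measurable f(1)]) (use k in auto)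
  fix F and \<eta>0 :: real assume F: "folner_seq G F" and \<eta>0: "\<eta>0 > 0"
  note F' = folner_seqD[OF F]
  define \<eta> where "\<eta> = min (\<eta>0 / 5) (1/2)"
  have \<eta>: "\<eta> > 0" "\<eta> < 1" "5 * \<eta> \<le> \<eta>0" using \<eta>0 by (auto simp: \<eta>_def)
  obtain d where d: "d > 0" "\<forall>p. 0 \<le> p \<longrightarrow> p \<le> d \<longrightarrow> - (p * ln p) - (1 - p) * ln (1 - p) \<le> \<eta>"
    using binary_entropy_small[OF \<eta>(1)] by auto
  \<comment> \<open>\<open>u\<close> rarely lies in \<open>(c, c + 2 * e]\<close>, so the threshold \<open>c + e\<close> tolerates perturbations of \<open>u\<close> below \<open>e\<close>\<close>
  obtain e where e: "e > 0" "prob {x. c < u x \<and> u x \<le> c + 2 * e} \<le> d / 2"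
  proof -
    define A where "A n = {x. c < u x \<and> u x \<le> c + 2 * (1 / real (Suc n))}" for n
    have A: "A n \<in> events" for n
    proof -
      have "{x \<in> space M. c < u x \<and> u x \<le> c + 2 * (1 / real (Suc n))} \<in> events" using u by measurable
      then show ?thesis by (simp add: A_def)
    qed
    have "(\<lambda>n. prob (A n)) \<longlonglongrightarrow> prob (\<Inter>n. A n)"
    proof (rule finite_Lim_measure_decseq)
      show "range A \<subseteq> events" using A by auto
      have "2 * (1 / real (Suc (Suc n))) \<le> 2 * (1 / real (Suc n))" for n
        by (intro mult_left_mono divide_left_mono) auto
      then show "decseq A" unfolding decseq_Suc_iff A_def by (auto intro: order_trans)
    qed
    moreover have "(\<Inter>n. A n) = {}"
    proof -
      have "x \<notin> (\<Inter>n. A n)" for x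
      proof
        assume x: "x \<in> (\<Inter>n. A n)"
        then have "0 < (u x - c) / 2" by (auto simp: A_def)
        then obtain n where n: "1 / real (Suc n) < (u x - c) / 2" using nat_approx_posE by blast
        define q where "q = 1 / real (Suc n)"
        have "q < (u x - c) / 2" using n by (simp add: q_def)
        then have "u x > c + 2 * q" by (simp add: field_simps)
        moreover have "x \<in> A n" using x by blast
        ultimately show False by (auto simp: A_def q_def)
      qed
      then show ?thesis by auto
    qed
    ultimately have "(\<lambda>n. prob (A n)) \<longlonglongrightarrow> 0" by simp
    then have "\<forall>\<^sub>F n in sequentially. prob (A n) < d / 2" by (rule order_tendstoD) (use d in simp)
    then obtain n where "prob (A n) < d / 2" by (auto simp: eventually_sequentially)
    then show ?thesis by (intro that[of "1 / real (Suc n)"]) (auto simp: A_def)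
  qed
  define \<tau> where "\<tau> = d * e / 4"
  have \<tau>: "\<tau> > 0" using d e by (simp add: \<tau>_def)
  \<comment> \<open>\<open>h\<close> takes finitely many values, so its entropy along \<open>R\<close> is at most \<open>card R * L\<close>\<close>
  define h where "h x = \<tau> * real_of_int \<lfloor>f x / \<tau>\<rfloor>" for x
  have fh: "\<bar>f x - h x\<bar> \<le> \<tau>" for x
  proof -
    have "f x - h x = \<tau> * (f x / \<tau> - \<lfloor>f x / \<tau>\<rfloor>)" using \<tau> by (simp add: h_def right_diff_distrib)
    moreover have "0 \<le> f x / \<tau> - \<lfloor>f x / \<tau>\<rfloor>" "f x / \<tau> - \<lfloor>f x / \<tau>\<rfloor> \<le> 1" by linarith+
    ultimately show ?thesis using \<tau> by (simp add: abs_mult)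
  qed
  have h_meas: "h \<in> borel_measurable M" unfolding h_def using f(1) by measurable
  have h_fin: "finite (range h)"
  proof (rule finite_subset)
    show "range h \<subseteq> (\<lambda>j. \<tau> * real_of_int j) ` {\<lfloor>- C / \<tau>\<rfloor>..\<lfloor>C / \<tau>\<rfloor>}"
    proof
      fix v assume "v \<in> range h"
      then obtain x where x: "v = \<tau> * real_of_int \<lfloor>f x / \<tau>\<rfloor>" by (auto simp: h_def)
      have "- C \<le> f x" "f x \<le> C" using f(2)[of x] by linarith+
      then have "- C / \<tau> \<le> f x / \<tau>" "f x / \<tau> \<le> C / \<tau>" using \<tau> by (intro divide_right_mono; simp)+
      then have "\<lfloor>f x / \<tau>\<rfloor> \<in> {\<lfloor>- C / \<tau>\<rfloor>..\<lfloor>C / \<tau>\<rfloor>}" by (auto intro: floor_mono)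
      then show "v \<in> (\<lambda>j. \<tau> * real_of_int j) ` {\<lfloor>- C / \<tau>\<rfloor>..\<lfloor>C / \<tau>\<rfloor>}" using x by blast
    qed
  qed simp
  have h_simple: "simple_function M h" by (rule simple_function_borel_measurable) (use h_meas h_fin in auto)
  define L where "L = ln (real (card (range h)))"
  have hL: "rv_entropy h \<le> L" unfolding L_def by (rule rv_entropy_le_ln_card[OF h_simple]) (use h_fin in auto)
  have L0: "0 \<le> L" using hL rv_entropy_nonneg[OF h_simple] by simp
  obtain m n0 where m: "m > 0" and mn: "\<forall>I. finite I \<longrightarrow> I \<subseteq> {n0..} \<longrightarrow> card I = m \<longrightarrow>
      integrable M (\<lambda>x. (\<Sum>i\<in>I. pm (S i) x * f (\<phi> (k i) x)) / m - u x) \<and>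
      expectation (\<lambda>x. \<bar>(\<Sum>i\<in>I. pm (S i) x * f (\<phi> (k i) x)) / m - u x\<bar>) \<le> \<tau>"
    using uniform_average_limitD[OF avg \<tau>] by blast
  define v where "v I x = (\<Sum>i\<in>I. pm (S i) x * h (\<phi> (k i) x)) / m" for I x
  have v_meas: "v I \<in> borel_measurable M" for I
  proof -
    have "(\<lambda>x. h (\<phi> (k i) x)) \<in> borel_measurable M" for i
      by (rule measurable_compose[OF action_measurable h_meas]) (use k in auto)
    then show ?thesis unfolding v_def using S' by measurable
  qed
  define W where "W I = {x. v I x > c + e}" for I
  have W: "W I \<in> events" for I
    unfolding W_def using v_meas borel_measurable_less[of "\<lambda>_. c + e" M "v I"] by simp
  have close: "prob (sym_diff B (W I)) \<le> d" if I: "finite I" "I \<subseteq> {n0..}" "card I = m" for I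
  proof -
    let ?a = "\<lambda>x. (\<Sum>i\<in>I. pm (S i) x * f (\<phi> (k i) x)) / m"
    have a: "integrable M (\<lambda>x. ?a x - u x)" "expectation (\<lambda>x. \<bar>?a x - u x\<bar>) \<le> \<tau>"
      using mn I by auto
    have av: "\<bar>v I x - ?a x\<bar> \<le> \<tau>" for x
    proof -
      have "\<bar>\<Sum>i\<in>I. pm (S i) x * h (\<phi> (k i) x) - pm (S i) x * f (\<phi> (k i) x)\<bar> \<le> (\<Sum>i\<in>I. \<tau>)"
      proof (rule order_trans[OF sum_abs], rule sum_mono)
        fix i show "\<bar>pm (S i) x * h (\<phi> (k i) x) - pm (S i) x * f (\<phi> (k i) x)\<bar> \<le> \<tau>"
          using fh[of "\<phi> (k i) x"] by (auto simp: abs_minus_commute)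
      qed
      also have "\<dots> = m * \<tau>" using I by simp
      finally have "\<bar>\<Sum>i\<in>I. pm (S i) x * h (\<phi> (k i) x) - pm (S i) x * f (\<phi> (k i) x)\<bar> / m \<le> \<tau>"
        using m by (simp add: pos_divide_le_eq mult.commute)
      moreover have "v I x - ?a x = (\<Sum>i\<in>I. pm (S i) x * h (\<phi> (k i) x) - pm (S i) x * f (\<phi> (k i) x)) / m"
        by (simp add: v_def sum_subtractf diff_divide_distrib)
      ultimately show ?thesis using m by (simp add: abs_divide)
    qed
    have hk: "(\<lambda>x. v I x - u x) \<in> borel_measurable M" using v_meas u by measurable
    have vint: "integrable M (\<lambda>x. v I x - u x)"
    proof (rule Bochner_Integration.integrable_bound)
      show "integrable M (\<lambda>x. \<bar>?a x - u x\<bar> + \<tau>)" using a(1) by simp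
      show "AE x in M. norm (v I x - u x) \<le> norm (\<bar>?a x - u x\<bar> + \<tau>)"
      proof (rule AE_I2)
        fix x show "norm (v I x - u x) \<le> norm (\<bar>?a x - u x\<bar> + \<tau>)" using av[of x] by simp
      qed
    qed (rule hk)
    have "expectation (\<lambda>x. \<bar>v I x - u x\<bar>) \<le> expectation (\<lambda>x. \<bar>?a x - u x\<bar> + \<tau>)"
    proof (rule integral_mono)
      show "\<bar>v I x - u x\<bar> \<le> \<bar>?a x - u x\<bar> + \<tau>" for x using av[of x] by linarith
    qed (use vint a in auto)
    also have "\<dots> \<le> 2 * \<tau>" using a prob_space by simp
    finally have "prob {x. \<bar>v I x - u x\<bar> \<ge> e} \<le> 2 * \<tau> / e" by (rule markov_abs[OF vint _ e(1)])
    also have "\<dots> = d / 2" using e(1) by (simp add: \<tau>_def)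
    finally have 1: "prob {x. \<bar>v I x - u x\<bar> \<ge> e} \<le> d / 2" .
    have "{x \<in> space M. \<bar>v I x - u x\<bar> \<ge> e} \<in> events" using hk by measurable
    then have m1: "{x. \<bar>v I x - u x\<bar> \<ge> e} \<in> events" by simp
    have "{x \<in> space M. c < u x \<and> u x \<le> c + 2 * e} \<in> events" using u by measurable
    then have m2: "{x. c < u x \<and> u x \<le> c + 2 * e} \<in> events" by simp
    have "prob (sym_diff B (W I)) \<le> prob ({x. c < u x \<and> u x \<le> c + 2 * e} \<union> {x. \<bar>v I x - u x\<bar> \<ge> e})"
    proof (rule finite_measure_mono)
      show "sym_diff B (W I) \<subseteq> {x. c < u x \<and> u x \<le> c + 2 * e} \<union> {x. \<bar>v I x - u x\<bar> \<ge> e}"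
        unfolding B_def W_def by auto
    qed (use m1 m2 in auto)
    also have "\<dots> \<le> d / 2 + d / 2"
      using measure_Un_le[OF m2 m1] e(2) 1 by linarith
    finally show ?thesis by simp
  qed
  \<comment> \<open>the density of \<open>R\<close>, small against the entropy \<open>L\<close> of a single value of \<open>h\<close>\<close>
  define p where "p = \<eta> / (L + 1)"
  have p: "p > 0" "p * L \<le> \<eta>" using \<eta> L0 by (auto simp: p_def field_simps)
  obtain N where N: "N > 0" "m * exp (- (real N * p / 2)) \<le> \<eta>" "2 / p \<le> real N"
  proof -
    have "(\<lambda>N. m * exp (- (real N * p / 2))) \<longlonglongrightarrow> 0" using p(1) by real_asymp
    then have "\<forall>\<^sub>F N in sequentially. m * exp (- (real N * p / 2)) < \<eta>" using \<eta>(1) by (rule order_tendstoD)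
    moreover have "\<forall>\<^sub>F N in sequentially. N \<ge> Suc (nat \<lceil>2 / p\<rceil>)" by (rule eventually_ge_at_top)
    ultimately have "\<forall>\<^sub>F N in sequentially. m * exp (- (real N * p / 2)) < \<eta> \<and> N \<ge> Suc (nat \<lceil>2 / p\<rceil>)"
      by eventually_elim simp
    then obtain N where N: "m * exp (- (real N * p / 2)) < \<eta>" "N \<ge> Suc (nat \<lceil>2 / p\<rceil>)"
      by (auto simp: eventually_sequentially)
    have "2 / p \<le> real N" using N(2) by linarith
    then show ?thesis using N by (intro that[of N]) auto
  qed
  define J where "J = {n0..<n0 + m * N}"
  have NJ: "N \<le> card J" using m by (simp add: J_def)
  let ?bad = "\<lambda>n. \<Sum>i\<in>J. real (card {g \<in> F n. k i \<otimes> g \<notin> F n})"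
  have kc: "k i \<in> carrier G" for i using k by auto
  have "(\<lambda>n. \<Sum>i\<in>J. real (card {g \<in> F n. k i \<otimes> g \<notin> F n}) / real (card (F n))) \<longlonglongrightarrow> (\<Sum>i\<in>J. 0)"
    by (intro tendsto_sum folner_shift_small[OF F kc])
  then have "\<forall>\<^sub>F n in sequentially. (\<Sum>i\<in>J. real (card {g \<in> F n. k i \<otimes> g \<notin> F n}) / real (card (F n))) < \<eta>"
    by (rule order_tendstoD) (use \<eta> in simp)
  then have ev_bad: "\<forall>\<^sub>F n in sequentially. ?bad n \<le> \<eta> * card (F n)"
  proof eventually_elim
    case (elim n)
    then have "?bad n / card (F n) \<le> \<eta>" by (simp add: sum_divide_distrib)
    then show ?case using F'(4)[of n] by (simp add: pos_divide_le_eq)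
  qed
  have "(\<lambda>n. \<Sum>i\<in>J. rv_entropy (join (\<lambda>x. x \<in> S i) (F n)) / card (F n)) \<longlonglongrightarrow> (\<Sum>i\<in>J. 0)"
    by (intro tendsto_sum zero_entropy_setD(2)[OF S F])
  then have "\<forall>\<^sub>F n in sequentially. (\<Sum>i\<in>J. rv_entropy (join (\<lambda>x. x \<in> S i) (F n)) / card (F n)) < \<eta>"
    by (rule order_tendstoD) (use \<eta> in simp)
  then have ev_S: "\<forall>\<^sub>F n in sequentially. (\<Sum>i\<in>J. rv_entropy (join (\<lambda>x. x \<in> S i) (F n))) \<le> \<eta> * card (F n)"
  proof eventually_elim
    case (elim n)
    then have "(\<Sum>i\<in>J. rv_entropy (join (\<lambda>x. x \<in> S i) (F n))) / card (F n) \<le> \<eta>" by (simp add: sum_divide_distrib)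
    then show ?case using F'(4)[of n] by (simp add: pos_divide_le_eq)
  qed
  have "\<forall>\<^sub>F n in sequentially. rv_entropy (join (\<lambda>x. x \<in> B) (F n)) \<le> \<eta>0 * card (F n)"
    using ev_bad ev_S
  proof eventually_elim
    case (elim n)
    have cFpos: "real (card (F n)) > 0" using F'(4)[of n] by simp
    \<comment> \<open>some \<open>g\<close> has all translates \<open>k i \<otimes> g\<close> in \<open>F n\<close>, so \<open>F n\<close> is large enough for the greedy choice\<close>
    have cardF: "card J \<le> card (F n)"
    proof -
      have "\<exists>g\<in>F n. \<forall>i\<in>J. k i \<otimes> g \<in> F n"
      proof (rule ccontr)
        assume "\<not> ?thesis"
        then have "F n \<subseteq> (\<Union>i\<in>J. {g \<in> F n. k i \<otimes> g \<notin> F n})" by auto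
        then have "card (F n) \<le> card (\<Union>i\<in>J. {g \<in> F n. k i \<otimes> g \<notin> F n})"
          by (rule card_mono[rotated]) (use F' in \<open>auto simp: J_def\<close>)
        also have "\<dots> \<le> (\<Sum>i\<in>J. card {g \<in> F n. k i \<otimes> g \<notin> F n})" by (rule card_UN_le) (simp add: J_def)
        finally have "real (card (F n)) \<le> ?bad n" by (simp flip: of_nat_sum)
        also have "\<dots> \<le> \<eta> * card (F n)" by (rule elim(1))
        also have "\<dots> < 1 * real (card (F n))" using \<eta> cFpos by (intro mult_strict_right_mono) auto
        finally show False by simp
      qed
      then obtain g where g: "g \<in> F n" "\<forall>i\<in>J. k i \<otimes> g \<in> F n" by blast
      have "inj_on (\<lambda>i. k i \<otimes> g) J"
      proof (rule inj_onI)
        fix i j assume "k i \<otimes> g = k j \<otimes> g"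
        then have "k i = k j" using kc F'(3)[of n] g(1) by (metis right_cancel subsetD)
        then show "i = j" using k(1) by (simp add: inj_eq)
      qed
      then show ?thesis by (rule card_inj_on_le) (use g F' in auto)
    qed
    have big: "2 / p \<le> card (F n)" "N \<le> card (F n)" using N NJ cardF by linarith+
    let ?good = "\<lambda>R g. \<exists>\<iota>. \<forall>j<m. \<iota> j \<in> {n0 + j * N..<n0 + j * N + N} \<and> k (\<iota> j) \<otimes> g \<in> R"
    obtain R where R: "R \<subseteq> F n" "card R \<le> p * card (F n)"
      "card {g \<in> F n. \<not> ?good R g} \<le> ?bad n + \<eta> * card (F n)"
      using sparse_hitting_set[OF F'(1)[of n] F'(3)[of n] F'(2)[of n] k p(1) big N(2), of n0]
      unfolding J_def by blast
    have R': "finite R" "R \<subseteq> carrier G" using R(1) F'(1)[of n] F'(3)[of n] by (auto intro: finite_subset)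
    define Bad where "Bad = {g \<in> F n. \<not> ?good R g}"
    have "\<forall>g\<in>F n - Bad. \<exists>\<iota>. \<forall>j<m. \<iota> j \<in> {n0 + j * N..<n0 + j * N + N} \<and> k (\<iota> j) \<otimes> g \<in> R"
      by (auto simp: Bad_def)
    then obtain \<iota> where \<iota>: "\<And>g j. g \<in> F n - Bad \<Longrightarrow> j < m \<Longrightarrow>
        \<iota> g j \<in> {n0 + j * N..<n0 + j * N + N} \<and> k (\<iota> g j) \<otimes> g \<in> R"
      by (auto dest!: bchoice)
    define I where "I g = \<iota> g ` {..<m}" for g
    have I: "finite (I g)" "I g \<subseteq> J" "card (I g) = m" "\<forall>i\<in>I g. k i \<otimes> g \<in> R" if g: "g \<in> F n - Bad" for g
    proof -
      show "finite (I g)" by (simp add: I_def)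
      show "\<forall>i\<in>I g. k i \<otimes> g \<in> R" using \<iota>[OF g] by (auto simp: I_def)
      show "I g \<subseteq> J"
      proof
        fix i assume "i \<in> I g"
        then obtain j where j: "j < m" "i = \<iota> g j" by (auto simp: I_def)
        have "j * N + N \<le> m * N" using mult_le_mono1[of "Suc j" m N] j by simp
        then show "i \<in> J" using \<iota>[OF g j(1)] j(2) by (auto simp: J_def)
      qed
      have "inj_on (\<iota> g) {..<m}"
      proof (rule linorder_inj_onI')
        fix i j assume ij: "i \<in> {..<m}" "j \<in> {..<m}" "i < j"
        have "i * N + N \<le> j * N" using mult_le_mono1[of "Suc i" j N] ij by simp
        then show "\<iota> g i \<noteq> \<iota> g j" using \<iota>[OF g, of i] \<iota>[OF g, of j] ij by auto
      qed
      then show "card (I g) = m" by (simp add: I_def card_image)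
    qed
    \<comment> \<open>for \<open>g \<in> Bad\<close> nothing is known about the translate of \<open>B\<close>, so it is recorded as it is\<close>
    define err where "err g = \<phi> g -` (if g \<in> Bad then B else sym_diff B (W (I g)))" for g
    have gc: "g \<in> carrier G" if "g \<in> F n" for g using that F' by auto
    have D: "sym_diff B (W A) \<in> events" for A using B W by auto
    have err: "err g \<in> events" if "g \<in> F n" for g
      unfolding err_def using B D[of "I g"] by (intro vimage_action_events gc[OF that]) (simp split: if_splits)
    define Wx where "Wx x = (join h R x, restrict (\<lambda>i. join (\<lambda>x. x \<in> S i) (F n) x) J)" for x
    have s1: "simple_function M (join h R)" by (rule simple_function_join[OF h_simple R'])
    have s2: "simple_function M (join (\<lambda>x. x \<in> S i) (F n))" for i
      using F' by (intro simple_function_join simple_function_mem S') auto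
    have J: "finite J" by (simp add: J_def)
    note fam = rv_entropy_family[of J "\<lambda>i. join (\<lambda>x. x \<in> S i) (F n)", OF J s2]
    have Wx: "simple_function M Wx" unfolding Wx_def by (rule simple_function_Pair[OF s1 fam(1)])
    have Wx_ent: "rv_entropy Wx \<le> \<eta> * card (F n) + \<eta> * card (F n)"
    proof -
      have "rv_entropy Wx \<le> rv_entropy (join h R) + rv_entropy (\<lambda>x. restrict (\<lambda>i. join (\<lambda>x. x \<in> S i) (F n) x) J)"
        unfolding Wx_def by (rule rv_entropy_Pair_le[OF s1 fam(1)])
      also have "rv_entropy (join h R) \<le> card R * rv_entropy h"
        by (rule rv_entropy_join_le_family[OF h_simple R'])
      also have "\<dots> \<le> (p * card (F n)) * L"
        using R(2) hL p(1) rv_entropy_nonneg[OF h_simple] by (intro mult_mono) auto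
      also have "\<dots> \<le> \<eta> * card (F n)" using mult_right_mono[OF p(2), of "card (F n)"] by (simp add: mult_ac)
      also have "rv_entropy (\<lambda>x. restrict (\<lambda>i. join (\<lambda>x. x \<in> S i) (F n) x) J) \<le> \<eta> * card (F n)"
        using fam(2) elim(2) by linarith
      finally show ?thesis by simp
    qed
    have "rv_entropy (join (\<lambda>x. x \<in> B) (F n)) \<le> rv_entropy Wx + (\<Sum>g\<in>F n. rv_entropy (\<lambda>x. x \<in> err g))"
    proof (rule rv_entropy_join_le_errors[OF Wx F'(1) F'(3) err])
      fix x y g assume g: "g \<in> F n" and Wxy: "Wx x = Wx y" and E: "x \<in> err g \<longleftrightarrow> y \<in> err g"
      show "(\<phi> g x \<in> B) = (\<phi> g y \<in> B)"
      proof (cases "g \<in> Bad")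
        case True then show ?thesis using E by (simp add: err_def)
      next
        case False
        then have gB: "g \<in> F n - Bad" using g by simp
        have 1: "h (\<phi> r x) = h (\<phi> r y)" if "r \<in> R" for r
          using Wxy that by (auto simp: Wx_def join_eq_iff)
        have 2: "\<phi> g x \<in> S i \<longleftrightarrow> \<phi> g y \<in> S i" if "i \<in> J" for i
        proof -
          have "restrict (\<lambda>i. join (\<lambda>x. x \<in> S i) (F n) x) J i = restrict (\<lambda>i. join (\<lambda>x. x \<in> S i) (F n) y) J i"
            using Wxy unfolding Wx_def prod.inject by (elim conjE) (rule fun_cong)
          then show ?thesis using that g by (auto simp: join_eq_iff)
        qed
        have "v (I g) (\<phi> g x) = v (I g) (\<phi> g y)"
          unfolding v_def
        proof (intro arg_cong[where f="\<lambda>s. s / real m"] sum.cong[OF refl])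
          fix i assume i: "i \<in> I g"
          have "\<phi> (k i) (\<phi> g z) = \<phi> (k i \<otimes> g) z" for z using gc[OF g] kc by (simp add: action_mult)
          then show "pm (S i) (\<phi> g x) * h (\<phi> (k i) (\<phi> g x)) = pm (S i) (\<phi> g y) * h (\<phi> (k i) (\<phi> g y))"
            using 1[of "k i \<otimes> g"] 2[of i] I[OF gB] i by auto
        qed
        then show ?thesis using E False by (auto simp: err_def W_def)
      qed
    qed
    also have "(\<Sum>g\<in>F n. rv_entropy (\<lambda>x. x \<in> err g)) \<le> (\<Sum>g\<in>F n. \<eta> + (if g \<in> Bad then 1 else 0))"
    proof (rule sum_mono)
      fix g assume g: "g \<in> F n"
      show "rv_entropy (\<lambda>x. x \<in> err g) \<le> \<eta> + (if g \<in> Bad then 1 else 0)"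
      proof (cases "g \<in> Bad")
        case True then show ?thesis using rv_entropy_mem_le[OF err[OF g]] \<eta> by simp
      next
        case False
        then have gB: "g \<in> F n - Bad" using g by simp
        have "I g \<subseteq> {n0..}" using I(2)[OF gB] by (auto simp: J_def)
        then have "prob (sym_diff B (W (I g))) \<le> d" using close I[OF gB] by blast
        then have "prob (err g) \<le> d"
          using prob_vimage_action[OF gc[OF g] D, of "I g"] False by (simp add: err_def)
        then show ?thesis using rv_entropy_indicator[OF err[OF g]] d(2) False by simp
      qed
    qed
    also have "\<dots> = \<eta> * card (F n) + card Bad"
    proof -
      have "{g \<in> F n. g \<in> Bad} = Bad" by (auto simp: Bad_def)
      then have "(\<Sum>g\<in>F n. if g \<in> Bad then 1 else (0::real)) = card Bad"
        using F'(1)[of n] by (simp add: sum.If_cases Int_def)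
      then show ?thesis by (simp add: sum.distrib)
    qed
    also have "real (card Bad) \<le> \<eta> * card (F n) + \<eta> * card (F n)" using R(3) elim(1) unfolding Bad_def by linarith
    finally have "rv_entropy (join (\<lambda>x. x \<in> B) (F n)) \<le> 5 * \<eta> * card (F n)" using Wx_ent by simp
    also have "\<dots> \<le> \<eta>0 * card (F n)" using \<eta>(3) by (intro mult_right_mono) auto
    finally show ?case .
  qed
  then show "\<forall>\<^sub>F n in sequentially. rv_entropy (join (\<lambda>x. x \<in> {x. u x > c}) (F n)) \<le> \<eta>0 * card (F n)"
    by (simp add: B_def)
qed

end

section \<open>Relative mixing over the Pinsker algebra\<close>

context mp_action
begin

definition pinsker :: "'x measure" where
  "pinsker = sigma UNIV {B. zero_entropy_set B}"

lemma space_pinsker[simp]: "space pinsker = UNIV"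
  unfolding pinsker_def by (simp add: space_measure_of_conv)

lemma sets_pinsker: "sets pinsker = {B. zero_entropy_set B}"
  unfolding pinsker_def by (rule sigma_algebra.sets_measure_of_eq[OF sigma_algebra_zero_entropy])

lemma pinsker_subalgebra: "finite_measure_subalgebra M pinsker"
proof
  show "subalgebra M pinsker"
    unfolding subalgebra_def sets_pinsker using zero_entropy_setD(1) by auto
qed

lemma pinsker_subset: "A \<in> sets pinsker \<Longrightarrow> A \<in> events"
  unfolding sets_pinsker using zero_entropy_setD(1) by auto

lemma measurable_pinsker_imp: "f \<in> borel_measurable pinsker \<Longrightarrow> f \<in> borel_measurable M"
  by (rule measurable_from_subalg[of M pinsker])
     (use pinsker_subset in \<open>auto simp: subalgebra_def\<close>)

lemma action_measurable_pinsker: "g \<in> carrier G \<Longrightarrow> \<phi> g \<in> pinsker \<rightarrow>\<^sub>M pinsker"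
  by (rule measurableI) (auto simp: sets_pinsker intro: zero_entropy_set_vimage)

abbreviation condE :: "('x \<Rightarrow> real) \<Rightarrow> 'x \<Rightarrow> real" where
  "condE f \<equiv> real_cond_exp M pinsker f"

lemma condE_measurable: "condE f \<in> borel_measurable pinsker" "condE f \<in> borel_measurable M"
  using borel_measurable_cond_exp[of M pinsker f] borel_measurable_cond_exp2[of M pinsker f] by auto

lemma action_AE:
  assumes "g \<in> carrier G" "AE x in M. P x"
  shows "AE x in M. P (\<phi> g x)"
proof -
  have "AE x in distr M M (\<phi> g). P x" unfolding action_distr[OF assms(1)] by (rule assms(2))
  then show ?thesis by (rule AE_distrD[OF action_measurable[OF assms(1)]])
qed

lemma action_integrable:
  fixes f :: "'x \<Rightarrow> real"
  assumes "g \<in> carrier G" "integrable M f"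
  shows "integrable M (\<lambda>x. f (\<phi> g x))"
  by (rule integrable_distr[of _ _ M]) (use assms action_measurable action_distr in auto)

lemma action_integral:
  fixes f :: "'x \<Rightarrow> real"
  assumes "g \<in> carrier G" "f \<in> borel_measurable M"
  shows "expectation (\<lambda>x. f (\<phi> g x)) = expectation f"
  using integral_distr[OF action_measurable[OF assms(1)] assms(2)] action_distr[OF assms(1)] by simp

lemma action_inv:
  assumes "g \<in> carrier G"
  shows "\<phi> (inv g) (\<phi> g x) = x" "\<phi> g (\<phi> (inv g) x) = x"
  using action_mult[of "inv g" g x] action_mult[of g "inv g" x] assms action_one by auto

text \<open>The Pinsker algebra is invariant, so conditioning commutes with the action.\<close>

lemma condE_action:
  assumes k: "k \<in> carrier G" and f: "integrable M f"
  shows "AE x in M. condE (\<lambda>x. f (\<phi> k x)) x = condE f (\<phi> k x)"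
proof -
  interpret E: finite_measure_subalgebra M pinsker by (rule pinsker_subalgebra)
  have Ef: "integrable M (condE f)" by (rule E.real_cond_exp_int(1)[OF f])
  show ?thesis
  proof (rule E.real_cond_exp_charact)
    show "integrable M (\<lambda>x. f (\<phi> k x))" "integrable M (\<lambda>x. condE f (\<phi> k x))"
      using action_integrable[OF k] f Ef by auto
    show "(\<lambda>x. condE f (\<phi> k x)) \<in> borel_measurable pinsker"
      by (rule measurable_compose[OF action_measurable_pinsker[OF k] condE_measurable(1)])
    fix A assume A: "A \<in> sets pinsker"
    define A' where "A' = \<phi> (inv k) -` A"
    have A'p: "A' \<in> sets pinsker"
      using A zero_entropy_set_vimage[of A "inv k"] k by (simp add: A'_def sets_pinsker)
    then have A': "A' \<in> events" by (rule pinsker_subset)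
    have ind: "indicator A x = (indicator A' (\<phi> k x) :: real)" for x
      using action_inv[OF k] by (simp add: A'_def indicator_def)
    have tr: "(LINT x:A|M. q (\<phi> k x)) = (LINT x:A'|M. q x)" if "q \<in> borel_measurable M" for q :: "'x \<Rightarrow> real"
      unfolding set_lebesgue_integral_def ind
      by (rule action_integral[OF k, of "\<lambda>x. indicator A' x *\<^sub>R q x"]) (use that A' in measurable)
    have "(LINT x:A|M. f (\<phi> k x)) = (LINT x:A'|M. f x)" by (rule tr) (use f in auto)
    also have "\<dots> = (LINT x:A'|M. condE f x)" by (rule E.real_cond_exp_intA[OF f A'p])
    also have "\<dots> = (LINT x:A|M. condE f (\<phi> k x))" by (rule tr[symmetric]) (rule condE_measurable)
    finally show "(LINT x:A|M. f (\<phi> k x)) = (LINT x:A|M. condE f (\<phi> k x))" .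
  qed
qed

lemma condE_bounded:
  assumes f: "f \<in> borel_measurable M" "\<And>x. \<bar>f x\<bar> \<le> C"
  shows "AE x in M. \<bar>condE f x\<bar> \<le> C"
proof -
  interpret E: finite_measure_subalgebra M pinsker by (rule pinsker_subalgebra)
  have i: "integrable M f" by (rule integrable_bounded[OF f])
  have 0: "AE x in M. f x \<ge> - C" "AE x in M. f x \<le> C"
    using f(2) abs_le_D1 abs_le_D2 by (auto intro!: AE_I2) (smt (verit) abs_le_D2)
  show ?thesis
    using E.real_cond_exp_ge_c[OF i 0(1)] E.real_cond_exp_le_c[OF i 0(2)]
    by eventually_elim auto
qed

text \<open>Otherwise there are distinct \<open>k i\<close> for which the conditional expectations \<open>c i\<close> of
  \<open>(f \<circ> \<phi> (k i)) * h0\<close>, \<open>h0 = h - condE h\<close>, have \<open>L\<^sup>1\<close> norm above \<open>\<epsilon>\<close>. Multiplying with the sign of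
  \<open>c i\<close>, which is Pinsker measurable, turns these norms into inner products of \<open>h0\<close> with the functions
  \<open>q i = pm (S i) * (f \<circ> \<phi> (k i))\<close>. A limit \<open>u\<close> of averages of the \<open>q i\<close> would still have inner product
  at least \<open>\<epsilon>\<close> with \<open>h0\<close>. But \<open>u\<close> is Pinsker measurable and hence orthogonal to \<open>h0\<close>.\<close>

lemma relative_mixing:
  fixes f h :: "'x \<Rightarrow> real"
  assumes f: "f \<in> borel_measurable M" "\<And>x. \<bar>f x\<bar> \<le> C"
    and h: "h \<in> borel_measurable M" "\<And>x. \<bar>h x\<bar> \<le> D"
    and \<epsilon>: "\<epsilon> > 0"
  shows "finite {k \<in> carrier G.
    expectation (\<lambda>x. \<bar>condE (\<lambda>x. f (\<phi> k x) * h x) x - condE f (\<phi> k x) * condE h x\<bar>) > \<epsilon>}" (is "finite ?K")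
proof (rule ccontr)
  assume "infinite ?K"
  then obtain k :: "nat \<Rightarrow> 'g" where k: "inj k" "range k \<subseteq> ?K"
    using infinite_countable_subset by blast
  interpret E: finite_measure_subalgebra M pinsker by (rule pinsker_subalgebra)
  have kc: "k i \<in> carrier G" for i using k(2) by auto
  have C0: "C \<ge> 0" and D0: "D \<ge> 0"
    using order_trans[OF abs_ge_zero f(2)] order_trans[OF abs_ge_zero h(2)] by auto
  have fi: "integrable M f" and hi: "integrable M h"
    using integrable_bounded[OF f] integrable_bounded[OF h] by auto
  define h0 where "h0 x = h x - condE h x" for x
  have h0_meas: "h0 \<in> borel_measurable M" unfolding h0_def using h(1) condE_measurable by measurable
  have EhD: "AE x in M. \<bar>condE h x\<bar> \<le> D" by (rule condE_bounded[OF h])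
  then have h0D: "AE x in M. \<bar>h0 x\<bar> \<le> 2 * D"
  proof eventually_elim
    case (elim x) then show ?case using h(2)[of x] by (simp add: h0_def)
  qed
  let ?fk = "\<lambda>i x. f (\<phi> (k i) x)"
  have fk_meas: "?fk i \<in> borel_measurable M" for i by (rule measurable_compose[OF action_measurable[OF kc] f(1)])
  define c where "c i = condE (\<lambda>x. ?fk i x * h0 x)" for i
  have fkh0: "integrable M (\<lambda>x. ?fk i x * h0 x)" for i
  proof (rule integrable_const_bound[of _ "C * (2 * D)"])
    show "AE x in M. norm (?fk i x * h0 x) \<le> C * (2 * D)"
      using h0D by eventually_elim (use f(2) C0 in \<open>auto simp: abs_mult intro!: mult_mono\<close>)
  qed (use fk_meas h0_meas in measurable)
  have fkh: "integrable M (\<lambda>x. ?fk i x * h x)" for i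
    by (rule integrable_bounded[of _ "C * D"]) (use fk_meas h f(2) C0 D0 in \<open>auto simp: abs_mult intro!: mult_mono\<close>)
  have fkEh: "integrable M (\<lambda>x. condE h x * ?fk i x)" for i
  proof (rule integrable_const_bound[of _ "D * C"])
    show "AE x in M. norm (condE h x * ?fk i x) \<le> D * C"
      using EhD by eventually_elim (use f(2) D0 in \<open>auto simp: abs_mult intro!: mult_mono\<close>)
  qed (use fk_meas condE_measurable in measurable)
  have c_eq: "AE x in M. c i x = condE (\<lambda>x. ?fk i x * h x) x - condE f (\<phi> (k i) x) * condE h x" for i
  proof -
    have fki: "integrable M (?fk i)" by (rule action_integrable[OF kc fi])
    have eq: "(\<lambda>x. ?fk i x * h0 x) = (\<lambda>x. ?fk i x * h x - condE h x * ?fk i x)"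
      by (auto simp: h0_def algebra_simps)
    have "AE x in M. c i x = condE (\<lambda>x. ?fk i x * h x) x - condE (\<lambda>x. condE h x * ?fk i x) x"
      unfolding c_def eq by (rule E.real_cond_exp_diff[OF fkh fkEh])
    moreover have "AE x in M. condE (\<lambda>x. condE h x * ?fk i x) x = condE h x * condE (?fk i) x"
      by (rule E.real_cond_exp_mult[OF condE_measurable(1) fk_meas fkEh])
    moreover have "AE x in M. condE (?fk i) x = condE f (\<phi> (k i) x)" by (rule condE_action[OF kc fi])
    ultimately show ?thesis by eventually_elim simp
  qed
  have c_meas: "c i \<in> borel_measurable pinsker" for i unfolding c_def by (rule condE_measurable)
  have c_big: "expectation (\<lambda>x. \<bar>c i x\<bar>) > \<epsilon>" for i
  proof -
    have "expectation (\<lambda>x. \<bar>c i x\<bar>) = expectation (\<lambda>x. \<bar>condE (\<lambda>x. ?fk i x * h x) x - condE f (\<phi> (k i) x) * condE h x\<bar>)"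
    proof (rule integral_cong_AE)
      show "AE x in M. \<bar>c i x\<bar> = \<bar>condE (\<lambda>x. ?fk i x * h x) x - condE f (\<phi> (k i) x) * condE h x\<bar>"
        using c_eq[of i] by eventually_elim simp
      show "(\<lambda>x. \<bar>c i x\<bar>) \<in> borel_measurable M" using measurable_pinsker_imp[OF c_meas] by measurable
      show "(\<lambda>x. \<bar>condE (\<lambda>x. ?fk i x * h x) x - condE f (\<phi> (k i) x) * condE h x\<bar>) \<in> borel_measurable M"
        using condE_measurable(2) measurable_compose[OF action_measurable[OF kc] condE_measurable(2)] by measurable
    qed
    then show ?thesis using k(2) by auto
  qed
  define S where "S i = {x. c i x > 0}" for i
  have Sp: "S i \<in> sets pinsker" for i
    using borel_measurable_less[of "\<lambda>_. 0" pinsker "c i"] c_meas by (simp add: S_def)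
  then have S: "zero_entropy_set (S i)" for i by (simp add: sets_pinsker)
  have pm_meas: "pm (S i) \<in> borel_measurable pinsker" for i
    by (rule measurable_If_set) (use Sp in auto)
  have corr: "expectation (\<lambda>x. (pm (S i) x * ?fk i x) * h0 x) > \<epsilon>" for i
  proof -
    have int: "integrable M (\<lambda>x. pm (S i) x * (?fk i x * h0 x))"
    proof (rule Bochner_Integration.integrable_bound[OF fkh0[of i]])
      show "(\<lambda>x. pm (S i) x * (?fk i x * h0 x)) \<in> borel_measurable M"
        using measurable_pinsker_imp[OF pm_meas] fk_meas h0_meas by measurable
    qed (auto simp: abs_mult)
    have "\<bar>c i x\<bar> = pm (S i) x * c i x" for x by (auto simp: S_def)
    then have "expectation (\<lambda>x. \<bar>c i x\<bar>) = expectation (\<lambda>x. pm (S i) x * c i x)" by simp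
    also have "\<dots> = expectation (\<lambda>x. pm (S i) x * (?fk i x * h0 x))"
      unfolding c_def by (rule E.real_cond_exp_intg(2)[OF int pm_meas]) (use fk_meas h0_meas in measurable)
    finally show ?thesis using c_big[of i] by (simp add: mult.assoc)
  qed
  define q where "q i x = pm (S i) x * ?fk i x" for i x
  have q_meas: "q i \<in> borel_measurable M" for i
    unfolding q_def using measurable_pinsker_imp[OF pm_meas] fk_meas by measurable
  have qC: "\<bar>q i x\<bar> \<le> C" for i x using f(2) by (simp add: q_def abs_mult)
  obtain t :: "nat \<Rightarrow> nat" and u where t: "strict_mono t" and u: "u \<in> borel_measurable M"
    and avg: "uniform_average_limit (\<lambda>i. q (t i)) u"
    by (rule blum_hanson_subsequence[of q, OF q_meas qC])
  have "zero_entropy_set {x. u x > a}" for a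
  proof (rule zero_entropy_level_set[OF f, of "\<lambda>i. k (t i)" "\<lambda>i. S (t i)"])
    show "inj (\<lambda>i. k (t i))" using k(1) strict_mono_eq[OF t] by (auto simp: inj_def)
    show "range (\<lambda>i. k (t i)) \<subseteq> carrier G" using kc by auto
    show "uniform_average_limit (\<lambda>i x. pm (S (t i)) x * f (\<phi> (k (t i)) x)) u"
      using avg unfolding q_def .
  qed (use S u in auto)
  then have up: "u \<in> borel_measurable pinsker"
    unfolding borel_measurable_iff_greater by (simp add: sets_pinsker)
  have \<epsilon>D: "\<epsilon> / (4 * D + 1) > 0" using \<epsilon> D0 by simp
  obtain m n where m: "m > 0" and mn: "\<forall>I. finite I \<longrightarrow> I \<subseteq> {n..} \<longrightarrow> card I = m \<longrightarrow>
      integrable M (\<lambda>x. (\<Sum>i\<in>I. q (t i) x) / m - u x) \<and>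
      expectation (\<lambda>x. \<bar>(\<Sum>i\<in>I. q (t i) x) / m - u x\<bar>) \<le> \<epsilon> / (4 * D + 1)"
    using uniform_average_limitD[OF avg \<epsilon>D] by blast
  define I where "I = {n..<n + m}"
  let ?a = "\<lambda>x. (\<Sum>i\<in>I. q (t i) x) / m"
  have au: "integrable M (\<lambda>x. ?a x - u x)" "expectation (\<lambda>x. \<bar>?a x - u x\<bar>) \<le> \<epsilon> / (4 * D + 1)"
  proof -
    have "finite I" "I \<subseteq> {n..}" "card I = m" by (auto simp: I_def)
    with mn show "integrable M (\<lambda>x. ?a x - u x)" "expectation (\<lambda>x. \<bar>?a x - u x\<bar>) \<le> \<epsilon> / (4 * D + 1)"
      by blast+
  qed
  have qi: "integrable M (q i)" for i by (rule integrable_bounded[OF q_meas qC])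
  have ai: "integrable M ?a" using qi by simp
  have ui: "integrable M u" using Bochner_Integration.integrable_diff[OF ai au(1)] by simp
  have mult_h0: "integrable M (\<lambda>x. w x * h0 x)" "\<bar>expectation (\<lambda>x. w x * h0 x)\<bar> \<le> 2 * D * expectation (\<lambda>x. \<bar>w x\<bar>)"
    if w: "integrable M w" for w
  proof -
    have wb: "AE x in M. \<bar>w x * h0 x\<bar> \<le> 2 * D * \<bar>w x\<bar>"
      using h0D
    proof eventually_elim
      case (elim x)
      then show ?case using mult_right_mono[of "\<bar>h0 x\<bar>" "2 * D" "\<bar>w x\<bar>"] by (simp add: abs_mult mult.commute)
    qed
    show i: "integrable M (\<lambda>x. w x * h0 x)"
    proof (rule Bochner_Integration.integrable_bound)
      show "integrable M (\<lambda>x. 2 * D * \<bar>w x\<bar>)" using w by simp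
      show "AE x in M. norm (w x * h0 x) \<le> norm (2 * D * \<bar>w x\<bar>)"
        using wb by eventually_elim (use D0 in auto)
    qed (use w h0_meas in measurable)
    have "\<bar>expectation (\<lambda>x. w x * h0 x)\<bar> \<le> expectation (\<lambda>x. \<bar>w x * h0 x\<bar>)" by (rule integral_abs_bound)
    also have "\<dots> \<le> expectation (\<lambda>x. 2 * D * \<bar>w x\<bar>)"
    proof (rule integral_mono_AE[OF _ _ wb])
      show "integrable M (\<lambda>x. \<bar>w x * h0 x\<bar>)" using i by (rule integrable_abs)
    qed (use w in simp)
    finally show "\<bar>expectation (\<lambda>x. w x * h0 x)\<bar> \<le> 2 * D * expectation (\<lambda>x. \<bar>w x\<bar>)" by simp
  qed
  have uh: "integrable M (\<lambda>x. u x * h x)"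
  proof (rule Bochner_Integration.integrable_bound)
    show "integrable M (\<lambda>x. D * u x)" using ui by simp
    show "AE x in M. norm (u x * h x) \<le> norm (D * u x)"
    proof (rule AE_I2)
      fix x show "norm (u x * h x) \<le> norm (D * u x)"
        using mult_right_mono[OF h(2)[of x] abs_ge_zero, of "u x"] D0 by (simp add: abs_mult mult.commute)
    qed
  qed (use u h in measurable)
  have u_orth: "expectation (\<lambda>x. u x * h0 x) = 0"
  proof -
    have "expectation (\<lambda>x. u x * h0 x) = expectation (\<lambda>x. u x * h x - u x * condE h x)"
      by (simp add: h0_def right_diff_distrib)
    also have "\<dots> = expectation (\<lambda>x. u x * h x) - expectation (\<lambda>x. u x * condE h x)"
      by (rule Bochner_Integration.integral_diff[OF uh E.real_cond_exp_intg(1)[OF uh up h(1)]])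
    finally show ?thesis using E.real_cond_exp_intg(2)[OF uh up h(1)] by simp
  qed
  have "m * \<epsilon> < (\<Sum>i\<in>I. expectation (\<lambda>x. q (t i) x * h0 x))"
  proof -
    have "(\<Sum>i\<in>I. \<epsilon>) < (\<Sum>i\<in>I. expectation (\<lambda>x. q (t i) x * h0 x))"
      by (rule sum_strict_mono) (use corr m in \<open>auto simp: I_def q_def\<close>)
    then show ?thesis by (simp add: I_def)
  qed
  also have "\<dots> = expectation (\<lambda>x. \<Sum>i\<in>I. q (t i) x * h0 x)"
    by (rule Bochner_Integration.integral_sum[symmetric]) (rule mult_h0(1)[OF qi])
  also have "\<dots> = m * expectation (\<lambda>x. ?a x * h0 x)"
    using m by (simp add: sum_distrib_right)
  finally have "\<epsilon> < expectation (\<lambda>x. ?a x * h0 x)" using m by (simp add: pos_less_divide_eq mult.commute)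
  also have "\<dots> = expectation (\<lambda>x. (?a x - u x) * h0 x)"
    using mult_h0(1)[OF ai] mult_h0(1)[OF ui] u_orth by (simp add: left_diff_distrib)
  also have "\<dots> \<le> 2 * D * (\<epsilon> / (4 * D + 1))"
    using mult_h0(2)[OF au(1)] mult_left_mono[OF au(2), of "2 * D"] D0 by linarith
  also have "\<dots> \<le> \<epsilon>"
  proof -
    have "2 * D * \<epsilon> \<le> (4 * D + 1) * \<epsilon>" using D0 \<epsilon> by (intro mult_right_mono) auto
    then show ?thesis using D0 by (simp add: pos_divide_le_eq mult.commute)
  qed
  finally show False by simp
qed

end

section \<open>A Mycielski theorem for sequences of open dense relations\<close>

text \<open>The type is only a metric space, so a countable base has to be built from finite covers of \<open>S\<close> by
  balls. The base consists of sets that meet \<open>S\<close>, as needed for constructions inside \<open>S\<close>.\<close>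

lemma compact_countable_pseudobase:
  fixes S :: "'x::metric_space set"
  assumes S: "compact S" "S \<noteq> {}"
  obtains V :: "nat \<Rightarrow> 'x set" where "\<And>i. open (V i)" "\<And>i. V i \<inter> S \<noteq> {}"
    "\<And>U. open U \<Longrightarrow> U \<inter> S \<noteq> {} \<Longrightarrow> \<exists>i. V i \<subseteq> U"
    "\<And>U x. open U \<Longrightarrow> x \<in> U \<Longrightarrow> x \<in> S \<Longrightarrow> \<exists>i. x \<in> V i \<and> V i \<subseteq> U"
proof -
  have "\<exists>k\<subseteq>S. finite k \<and> S \<subseteq> (\<Union>x\<in>k. ball x (1 / real (Suc n)))" for n
  proof (rule compactE_image[OF S(1), of S "\<lambda>x. ball x (1 / real (Suc n))"])
    show "S \<subseteq> (\<Union>x\<in>S. ball x (1 / real (Suc n)))" by force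
  qed auto
  then obtain k where k: "\<And>n. k n \<subseteq> S" "\<And>n. finite (k n)" "\<And>n. S \<subseteq> (\<Union>x\<in>k n. ball x (1 / real (Suc n)))"
    by metis
  define \<V> where "\<V> = (\<Union>n. (\<lambda>x. ball x (1 / real (Suc n))) ` k n)"
  have cV: "countable \<V>" unfolding \<V>_def using k(2) by (intro countable_UN countable_image) (auto intro: countable_finite)
  have "k 0 \<noteq> {}" using k(3)[of 0] S(2) by auto
  then have ne: "\<V> \<noteq> {}" unfolding \<V>_def by auto
  have rng: "range (from_nat_into \<V>) = \<V>" by (rule range_from_nat_into[OF ne cV])
  have base: "\<exists>A\<in>\<V>. x \<in> A \<and> A \<subseteq> U" if U: "open U" "x \<in> U" "x \<in> S" for U x
  proof -
    obtain e where e: "e > 0" "ball x e \<subseteq> U" using U by (meson open_contains_ball)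
    obtain n where n: "1 / real (Suc n) < e / 2" using e nat_approx_posE[of "e/2"] by auto
    obtain y where y: "y \<in> k n" "dist y x < 1 / real (Suc n)" using k(3)[of n] U by auto
    have "ball y (1 / real (Suc n)) \<subseteq> ball x e"
    proof
      fix z assume "z \<in> ball y (1 / real (Suc n))"
      then have "dist y z < 1 / real (Suc n)" by simp
      moreover have "dist x z \<le> dist y x + dist y z" by (metis dist_commute dist_triangle)
      ultimately have "dist x z < e" using y n by linarith
      then show "z \<in> ball x e" by simp
    qed
    then show ?thesis using y e unfolding \<V>_def by (intro bexI[of _ "ball y (1 / real (Suc n))"]) auto
  qed
  have mem: "from_nat_into \<V> i \<in> \<V>" for i using rng by auto
  show ?thesis
  proof (rule that)
    show "open (from_nat_into \<V> i)" for i using mem[of i] unfolding \<V>_def by auto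
    show "from_nat_into \<V> i \<inter> S \<noteq> {}" for i
    proof -
      obtain n x where "x \<in> k n" "from_nat_into \<V> i = ball x (1 / real (Suc n))"
        using mem[of i] unfolding \<V>_def by auto
      then have "x \<in> from_nat_into \<V> i \<inter> S" using k(1)[of n] by auto
      then show ?thesis by blast
    qed
    show *: "\<exists>i. x \<in> from_nat_into \<V> i \<and> from_nat_into \<V> i \<subseteq> U" if "open U" "x \<in> U" "x \<in> S" for U x
      using base[OF that] rng by (metis imageE)
    show "\<exists>i. from_nat_into \<V> i \<subseteq> U" if "open U" "U \<inter> S \<noteq> {}" for U
      using that * by (metis disjoint_iff)
  qed
qed

lemma refine_pairs:
  fixes S :: "'x::metric_space set" and O' :: "('x \<times> 'x) set"
  assumes P: "finite P" "\<And>p. p \<in> P \<Longrightarrow> fst p \<noteq> snd p"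
    and W: "\<And>j. j \<in> J \<Longrightarrow> open (W j) \<and> W j \<inter> S \<noteq> {}" and PJ: "P \<subseteq> J \<times> J"
    and O: "open O'"
    and dense: "\<And>U V. open U \<Longrightarrow> open V \<Longrightarrow> U \<inter> S \<noteq> {} \<Longrightarrow> V \<inter> S \<noteq> {} \<Longrightarrow> \<exists>y\<in>U \<inter> S. \<exists>z\<in>V \<inter> S. (y, z) \<in> O'"
  shows "\<exists>W'. (\<forall>j\<in>J. open (W' j) \<and> W' j \<inter> S \<noteq> {} \<and> W' j \<subseteq> W j) \<and> (\<forall>(a, b)\<in>P. W' a \<times> W' b \<subseteq> O')"
  using P PJ
proof (induction P rule: finite_induct)
  case empty
  show ?case using W by (intro exI[of _ W]) auto
next
  case (insert p P)
  obtain a b where p: "p = (a, b)" by (cases p)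
  have ab: "a \<noteq> b" "a \<in> J" "b \<in> J" using insert.prems(1)[of p] insert.prems(2) p by auto
  obtain W' where W': "\<forall>j\<in>J. open (W' j) \<and> W' j \<inter> S \<noteq> {} \<and> W' j \<subseteq> W j" "\<forall>(a, b)\<in>P. W' a \<times> W' b \<subseteq> O'"
    using insert.IH insert.prems by auto
  obtain y z where yz: "y \<in> W' a \<inter> S" "z \<in> W' b \<inter> S" "(y, z) \<in> O'"
    using dense[of "W' a" "W' b"] W'(1) ab by blast
  obtain A B where AB: "open A" "open B" "(y, z) \<in> A \<times> B" "A \<times> B \<subseteq> O'"
    using open_prod_elim[OF O yz(3)] by blast
  define W'' where "W'' = W'(a := W' a \<inter> A, b := W' b \<inter> B)"
  have sub: "W'' j \<subseteq> W' j" for j by (auto simp: W''_def)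
  have 1: "\<forall>j\<in>J. open (W'' j) \<and> W'' j \<inter> S \<noteq> {} \<and> W'' j \<subseteq> W j"
  proof
    fix j assume j: "j \<in> J"
    have "open (W'' j)" using W'(1) j AB by (auto simp: W''_def)
    moreover have "W'' j \<inter> S \<noteq> {}"
    proof -
      consider "j = a" | "j = b" | "j \<noteq> a" "j \<noteq> b" by blast
      then show ?thesis
      proof cases
        case 1 then show ?thesis using yz AB ab by (auto simp: W''_def)
      next
        case 2 then show ?thesis using yz AB ab by (auto simp: W''_def)
      next
        case 3 then show ?thesis using W'(1) j by (simp add: W''_def)
      qed
    qed
    moreover have "W'' j \<subseteq> W j" using sub[of j] W'(1) j by blast
    ultimately show "open (W'' j) \<and> W'' j \<inter> S \<noteq> {} \<and> W'' j \<subseteq> W j" by blast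
  qed
  have "W'' a \<times> W'' b \<subseteq> O'" using AB(4) ab by (auto simp: W''_def)
  moreover have "W'' c \<times> W'' d \<subseteq> O'" if "(c, d) \<in> P" for c d
    using W'(2) that sub[of c] sub[of d] by (blast dest: bspec)
  ultimately have "case q of (c, d) \<Rightarrow> W'' c \<times> W'' d \<subseteq> O'" if "q \<in> insert p P" for q
    using that p by (cases q) (metis case_prod_conv insertE prod.inject)
  then have "\<forall>(c, d)\<in>insert p P. W'' c \<times> W'' d \<subseteq> O'" by blast
  with 1 show ?case by blast
qed

lemma refine_open_family:
  fixes S :: "'x::metric_space set" and O' :: "('x \<times> 'x) set"
  assumes J: "finite J" and W: "\<And>j. j \<in> J \<Longrightarrow> open (W j) \<and> W j \<inter> S \<noteq> {}"
    and O: "open O'"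
    and dense: "\<And>U V. open U \<Longrightarrow> open V \<Longrightarrow> U \<inter> S \<noteq> {} \<Longrightarrow> V \<inter> S \<noteq> {} \<Longrightarrow> \<exists>y\<in>U \<inter> S. \<exists>z\<in>V \<inter> S. (y, z) \<in> O'"
    and e: "e > 0"
  obtains W' where "\<And>j. j \<in> J \<Longrightarrow> open (W' j)" "\<And>j. j \<in> J \<Longrightarrow> W' j \<inter> S \<noteq> {}"
    "\<And>j. j \<in> J \<Longrightarrow> closure (W' j) \<subseteq> W j" "\<And>j y z. j \<in> J \<Longrightarrow> y \<in> W' j \<Longrightarrow> z \<in> W' j \<Longrightarrow> dist y z \<le> e"
    "\<And>i j. i \<in> J \<Longrightarrow> j \<in> J \<Longrightarrow> i \<noteq> j \<Longrightarrow> W' i \<times> W' j \<subseteq> O'"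
proof -
  let ?P = "{p \<in> J \<times> J. fst p \<noteq> snd p}"
  have "\<exists>W'. (\<forall>j\<in>J. open (W' j) \<and> W' j \<inter> S \<noteq> {} \<and> W' j \<subseteq> W j) \<and> (\<forall>(a, b)\<in>?P. W' a \<times> W' b \<subseteq> O')"
    by (rule refine_pairs) (use J W O dense in auto)
  then obtain W1 where W1: "\<And>j. j \<in> J \<Longrightarrow> open (W1 j)" "\<And>j. j \<in> J \<Longrightarrow> W1 j \<inter> S \<noteq> {}"
    "\<And>j. j \<in> J \<Longrightarrow> W1 j \<subseteq> W j" and W1p: "\<And>a b. a \<in> J \<Longrightarrow> b \<in> J \<Longrightarrow> a \<noteq> b \<Longrightarrow> W1 a \<times> W1 b \<subseteq> O'"
    by fastforce
  have "\<exists>B. open B \<and> B \<inter> S \<noteq> {} \<and> closure B \<subseteq> W1 j \<and> (\<forall>y\<in>B. \<forall>z\<in>B. dist y z \<le> e)" if j: "j \<in> J" for j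
  proof -
    obtain y where y: "y \<in> W1 j" "y \<in> S" using W1(2)[OF j] by auto
    obtain r where r: "r > 0" "cball y r \<subseteq> W1 j" using W1(1)[OF j] y by (meson open_contains_cball)
    define q where "q = min r (e / 2)"
    have q: "q > 0" using r e by (simp add: q_def)
    have "closure (ball y q) \<subseteq> cball y q" by (rule closure_minimal) auto
    also have "\<dots> \<subseteq> cball y r" by (auto simp: q_def)
    finally have "closure (ball y q) \<subseteq> W1 j" using r by blast
    moreover have "dist a b \<le> e" if "a \<in> ball y q" "b \<in> ball y q" for a b
    proof -
      have "dist a b \<le> dist y a + dist y b" by (metis dist_commute dist_triangle)
      then show ?thesis using that by (auto simp: q_def)
    qed
    moreover have "y \<in> ball y q \<inter> S" using q y by simp
    ultimately show ?thesis by (intro exI[of _ "ball y q"]) blast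
  qed
  then obtain W' where W': "\<And>j. j \<in> J \<Longrightarrow> open (W' j) \<and> W' j \<inter> S \<noteq> {} \<and> closure (W' j) \<subseteq> W1 j \<and> (\<forall>y\<in>W' j. \<forall>z\<in>W' j. dist y z \<le> e)"
    by metis
  show ?thesis
  proof (rule that[of W'])
    show "W' i \<times> W' j \<subseteq> O'" if "i \<in> J" "j \<in> J" "i \<noteq> j" for i j
    proof -
      have "W' i \<subseteq> W1 i" "W' j \<subseteq> W1 j" using W'[OF that(1)] W'[OF that(2)] closure_subset by blast+
      then show ?thesis using W1p[OF that] by blast
    qed
    show "closure (W' j) \<subseteq> W j" if "j \<in> J" for j using W'[OF that] W1(3)[OF that] by blast
  qed (use W' in blast)+
qed

lemma compact_Cantor_space: "compact (UNIV :: (nat \<Rightarrow> bool) set)"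
proof -
  have "compact_space (euclidean :: bool topology)"
    by (simp add: compact_space_def finite_imp_compact)
  then have "compact_space (product_topology (\<lambda>i::nat. euclidean :: bool topology) UNIV)"
    by (simp add: compact_space_product_topology)
  then show ?thesis by (simp add: euclidean_product_topology compact_space_def)
qed

text \<open>A Cantor scheme for countably many Cantor sets at once. At stage \<open>n\<close> there is an open set
  \<open>W n (i, s)\<close> for each \<open>i \<le> n\<close> and each word \<open>s\<close> of length \<open>n - i\<close>; the words with first component \<open>i\<close>
  produce the \<open>i\<close>-th Cantor set, which starts at stage \<open>i\<close> inside the \<open>i\<close>-th member \<open>V i\<close> of the base, so
  that the union is dense. When passing from stage \<open>n\<close> to \<open>n + 1\<close>, each set is split in two and all
  products of different new sets are made subsets of \<open>Q n\<close>. Points with different addresses \<open>(i, a)\<close>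
  are therefore in relation \<open>Q n\<close> for all large \<open>n\<close>; since infinitely many \<open>Q n\<close> avoid the diagonal,
  they are also different.\<close>

theorem mycielski_independent_set:
  fixes S :: "'x::metric_space set" and Q :: "nat \<Rightarrow> ('x \<times> 'x) set"
  assumes S: "compact S" "S \<noteq> {}"
    and open_Q: "\<And>n. open (Q n)"
    and dense: "\<And>n U V. open U \<Longrightarrow> open V \<Longrightarrow> U \<inter> S \<noteq> {} \<Longrightarrow> V \<inter> S \<noteq> {} \<Longrightarrow> \<exists>y\<in>U \<inter> S. \<exists>z\<in>V \<inter> S. (y, z) \<in> Q n"
    and irrefl: "\<And>N. \<exists>n\<ge>N. \<forall>x. (x, x) \<notin> Q n"
  obtains K where "K \<subseteq> S" "S \<subseteq> closure K" "mycielski_set K"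
    "\<And>y z. y \<in> K \<Longrightarrow> z \<in> K \<Longrightarrow> y \<noteq> z \<Longrightarrow> \<forall>\<^sub>F n in sequentially. (y, z) \<in> Q n" "\<exists>y\<in>K. \<exists>z\<in>K. y \<noteq> z"
proof -
  obtain V :: "nat \<Rightarrow> 'x set" where V: "\<And>i. open (V i)" "\<And>i. V i \<inter> S \<noteq> {}"
    "\<And>U. open U \<Longrightarrow> U \<inter> S \<noteq> {} \<Longrightarrow> \<exists>i. V i \<subseteq> U"
    using compact_countable_pseudobase[OF S] by metis
  define I :: "nat \<Rightarrow> (nat \<times> bool list) set" where "I n = {(i, s). i \<le> n \<and> length s = n - i}" for n
  have finI: "finite (I n)" for n
  proof -
    have "I n \<subseteq> {..n} \<times> {s. set s \<subseteq> UNIV \<and> length s \<le> n}" by (auto simp: I_def)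
    moreover have "finite ({..n} \<times> {s :: bool list. set s \<subseteq> UNIV \<and> length s \<le> n})"
      by (intro finite_cartesian_product finite_lists_length_le) auto
    ultimately show ?thesis by (rule finite_subset)
  qed
  \<comment> \<open>where a new set has to be placed: in its predecessor, or in \<open>V (Suc n)\<close> for the Cantor set that starts now\<close>
  define pre where "pre n W = (\<lambda>(i, s). if i = Suc n then V (Suc n) else W (i, butlast s))"
    for n and W :: "nat \<times> bool list \<Rightarrow> 'x set"
  define stage where "stage n W \<longleftrightarrow>
      (\<forall>j\<in>I n. open (W j) \<and> W j \<inter> S \<noteq> {}) \<and> (n = 0 \<longrightarrow> W (0, []) \<subseteq> V 0)"
    for n and W :: "nat \<times> bool list \<Rightarrow> 'x set"
  define refines where "refines n W W' \<longleftrightarrow>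
     (\<forall>j\<in>I (Suc n). closure (W' j) \<subseteq> pre n W j) \<and>
     (\<forall>j\<in>I (Suc n). \<forall>y\<in>W' j. \<forall>z\<in>W' j. dist y z \<le> 1 / real (Suc n)) \<and>
     (\<forall>i\<in>I (Suc n). \<forall>j\<in>I (Suc n). i \<noteq> j \<longrightarrow> W' i \<times> W' j \<subseteq> Q n)"
    for n and W W' :: "nat \<times> bool list \<Rightarrow> 'x set"
  have "\<exists>W. \<forall>n. stage n (W n) \<and> refines n (W n) (W (Suc n))"
  proof (rule dependent_nat_choice)
    show "\<exists>W. stage 0 W" using V unfolding stage_def by (intro exI[of _ "\<lambda>_. V 0"]) auto
    fix W n assume "stage n W"
    then have W: "\<forall>j\<in>I n. open (W j) \<and> W j \<inter> S \<noteq> {}" unfolding stage_def by blast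
    have pre: "open (pre n W j) \<and> pre n W j \<inter> S \<noteq> {}" if "j \<in> I (Suc n)" for j
    proof -
      obtain i s where j: "j = (i, s)" "i \<le> Suc n" "length s = Suc n - i" using \<open>j \<in> I (Suc n)\<close> by (auto simp: I_def)
      show ?thesis
      proof (cases "i = Suc n")
        case True then show ?thesis using V j by (simp add: pre_def)
      next
        case False
        then have "(i, butlast s) \<in> I n" using j by (auto simp: I_def)
        then show ?thesis using W j False by (auto simp: pre_def)
      qed
    qed
    have e0: "1 / real (Suc n) > 0" by simp
    show "\<exists>W'. stage (Suc n) W' \<and> refines n W W'"
    proof (rule refine_open_family[OF finI[of "Suc n"] pre open_Q[of n] dense[where n = n] e0])
      fix W' assume W': "\<And>j. j \<in> I (Suc n) \<Longrightarrow> open (W' j)" "\<And>j. j \<in> I (Suc n) \<Longrightarrow> W' j \<inter> S \<noteq> {}"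
        "\<And>j. j \<in> I (Suc n) \<Longrightarrow> closure (W' j) \<subseteq> pre n W j"
        "\<And>j y z. j \<in> I (Suc n) \<Longrightarrow> y \<in> W' j \<Longrightarrow> z \<in> W' j \<Longrightarrow> dist y z \<le> 1 / real (Suc n)"
        "\<And>i j. i \<in> I (Suc n) \<Longrightarrow> j \<in> I (Suc n) \<Longrightarrow> i \<noteq> j \<Longrightarrow> W' i \<times> W' j \<subseteq> Q n"
      show ?thesis
        unfolding stage_def refines_def
        by (rule exI[of _ W'], intro conjI ballI impI) ((rule W'; assumption) | simp)+
    qed
  qed
  then obtain W where W_all: "\<And>n. stage n (W n)" "\<And>n. refines n (W n) (W (Suc n))" by blast
  note W = W_all(1)[unfolded stage_def] W_all(2)[unfolded refines_def]
  have W0: "W 0 (0, []) \<subseteq> V 0" using W(1)[of 0] by blast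
  have W_ne: "W n j \<inter> S \<noteq> {}" if "j \<in> I n" for n j using W(1)[of n] that by blast
  have W_cl: "closure (W (Suc n) j) \<subseteq> pre n (W n) j" if "j \<in> I (Suc n)" for n j
    using conjunct1[OF W(2)[of n]] that by (rule bspec)
  have W_small: "dist y z \<le> 1 / real (Suc n)" if "j \<in> I (Suc n)" "y \<in> W (Suc n) j" "z \<in> W (Suc n) j" for n j y z
    using conjunct1[OF conjunct2[OF W(2)[of n]]] that by metis
  have W_Q: "W (Suc n) i \<times> W (Suc n) j \<subseteq> Q n" if "i \<in> I (Suc n)" "j \<in> I (Suc n)" "i \<noteq> j" for n i j
    using conjunct2[OF conjunct2[OF W(2)[of n]]] that by metis
  \<comment> \<open>the index at stage \<open>n\<close> of the point with address \<open>(i, a)\<close>\<close>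
  define ix :: "nat \<Rightarrow> (nat \<Rightarrow> bool) \<Rightarrow> nat \<Rightarrow> nat \<times> bool list" where "ix i a n = (i, map a [0..<n - i])" for i a n
  have ixI: "ix i a n \<in> I n" if "i \<le> n" for i a n using that by (simp add: ix_def I_def)
  have cylinder_step: "closure (W (Suc n) (ix i a (Suc n))) \<subseteq> W n (ix i a n)" if "i \<le> n" for i a n
  proof -
    have "pre n (W n) (ix i a (Suc n)) = W n (ix i a n)"
      using that by (simp add: pre_def ix_def Suc_diff_le)
    then show ?thesis using W_cl[OF ixI, of i n a] that by simp
  qed
  have mono: "W m (ix i a m) \<subseteq> W n (ix i a n)" if "i \<le> n" "n \<le> m" for i a n m
    using that(2)
  proof (induction m rule: dec_induct)
    case (step m)
    then show ?case using \<open>i \<le> n\<close> closure_subset cylinder_step[of i m a] by fastforce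
  qed simp
  have "\<exists>x. x \<in> S \<and> (\<forall>n\<ge>i. x \<in> W n (ix i a n))" for i a
  proof -
    let ?C = "\<lambda>n. closure (W (i + n) (ix i a (i + n)))"
    have "S \<inter> (\<Inter>n. ?C n) \<noteq> {}"
    proof (rule compact_imp_fip_image[OF S(1)])
      fix N :: "nat set" assume N: "finite N"
      obtain m where m: "\<forall>n\<in>N. n \<le> m" using N finite_nat_set_iff_bounded_le by auto
      obtain x where "x \<in> W (i + m) (ix i a (i + m)) \<inter> S" using W_ne[OF ixI, of i "i + m" a] by auto
      moreover have "W (i + m) (ix i a (i + m)) \<subseteq> ?C n" if "n \<in> N" for n
        using mono[of i "i + n" "i + m" a] m that closure_subset by fastforce
      ultimately show "S \<inter> (\<Inter>n\<in>N. ?C n) \<noteq> {}" by blast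
    qed auto
    then obtain x where x: "x \<in> S" "\<And>n. x \<in> ?C n" by blast
    have "x \<in> W n (ix i a n)" if "n \<ge> i" for n
      using x(2)[of "Suc n - i"] cylinder_step[of i n a] that by auto
    then show ?thesis using x(1) by blast
  qed
  then obtain p where p: "\<And>i a. p i a \<in> S" "\<And>i a n. n \<ge> i \<Longrightarrow> p i a \<in> W n (ix i a n)"
    by metis
  have in_Q: "\<forall>\<^sub>F n in sequentially. (p i a, p j b) \<in> Q n" if ne: "(i, a) \<noteq> (j, b)" for i j a b
  proof -
    have "\<exists>N. \<forall>n\<ge>N. ix i a n \<noteq> ix j b n"
    proof (cases "i = j")
      case True
      then have "a \<noteq> b" using ne by simp
      then obtain k where k: "a k \<noteq> b k" by (auto simp: fun_eq_iff)
      have "ix i a n \<noteq> ix j b n" if "n \<ge> i + Suc k" for n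
      proof
        assume "ix i a n = ix j b n"
        then have "\<forall>l\<in>{0..<n - i}. a l = b l" using True by (simp add: ix_def)
        then show False using k that by simp
      qed
      then show ?thesis by blast
    next
      case False
      then show ?thesis by (auto simp: ix_def)
    qed
    then obtain N where N: "\<And>n. n \<ge> N \<Longrightarrow> ix i a n \<noteq> ix j b n" by blast
    have "(p i a, p j b) \<in> Q n" if n: "n \<ge> max N (max i j)" for n
    proof -
      have "W (Suc n) (ix i a (Suc n)) \<times> W (Suc n) (ix j b (Suc n)) \<subseteq> Q n"
        by (intro W_Q ixI N) (use n in auto)
      moreover have "p i a \<in> W (Suc n) (ix i a (Suc n))" "p j b \<in> W (Suc n) (ix j b (Suc n))"
        using n by (auto intro!: p(2))
      ultimately show ?thesis by blast
    qed
    then show ?thesis unfolding eventually_sequentially by blast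
  qed
  have p_inj: "p i a \<noteq> p j b" if ne: "(i, a) \<noteq> (j, b)" for i j a b
  proof
    assume eq: "p i a = p j b"
    obtain N where N: "\<And>n. n \<ge> N \<Longrightarrow> (p i a, p j b) \<in> Q n" using in_Q[OF ne] by (auto simp: eventually_sequentially)
    obtain n where "n \<ge> N" "\<forall>x. (x, x) \<notin> Q n" using irrefl by blast
    then show False using N eq by metis
  qed
  have p_cont: "continuous_on UNIV (p i)" for i
    unfolding continuous_on_def
  proof (intro ballI tendstoI)
    fix a and e :: real assume e: "e > 0"
    obtain n where n: "1 / real (Suc n) < e" using e nat_approx_posE by blast
    define m where "m = max n i"
    have m: "1 / real (Suc m) \<le> 1 / real (Suc n)" by (intro divide_left_mono) (auto simp: m_def)
    define T where "T = (\<Inter>k<Suc m - i. (\<lambda>b::nat \<Rightarrow> bool. b k) -` {a k})"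
    have T: "open T" unfolding T_def
    proof (intro open_INT ballI)
      fix k show "open ((\<lambda>b::nat \<Rightarrow> bool. b k) -` {a k})"
        by (rule open_vimage[OF discrete_topology_class.open_discrete continuous_on_product_coordinates])
    qed auto
    have "dist (p i b) (p i a) < e" if "b \<in> T" for b
    proof -
      have "ix i b (Suc m) = ix i a (Suc m)" using that by (auto simp: ix_def T_def)
      then have "dist (p i b) (p i a) \<le> 1 / real (Suc m)"
        using p(2)[of i "Suc m" a] p(2)[of i "Suc m" b] by (intro W_small[of "ix i a (Suc m)"] ixI) (auto simp: m_def)
      then show ?thesis using n m by linarith
    qed
    moreover have "a \<in> T" by (auto simp: T_def)
    ultimately show "\<forall>\<^sub>F b in at a within UNIV. dist (p i b) (p i a) < e"
      unfolding eventually_at_topological using T by blast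
  qed
  have cantor: "cantor_set (range (p i))" for i
  proof -
    have "inj (p i)" using p_inj by (auto simp: inj_def)
    then obtain g where "homeomorphism UNIV (range (p i)) (p i) g"
      using homeomorphism_compact[OF compact_Cantor_space p_cont[of i] refl] by blast
    then have "(UNIV :: (nat \<Rightarrow> bool) set) homeomorphic range (p i)" unfolding homeomorphic_def by blast
    then show ?thesis unfolding cantor_set_def by (rule homeomorphic_sym[THEN iffD1])
  qed
  have pV: "p i a \<in> V i" for i a
  proof -
    show ?thesis
    proof (cases i)
      case 0
      then show ?thesis using p(2)[of 0 0 a] W0 by (auto simp: ix_def I_def)
    next
      case (Suc k)
      have "W (Suc k) (ix i a i) \<subseteq> pre k (W k) (ix i a i)"
        using W_cl[OF ixI, of i k a] Suc closure_subset by fastforce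
      then show ?thesis using p(2)[of i i a] Suc by (auto simp: pre_def ix_def)
    qed
  qed
  define K where "K = (\<Union>i. range (p i))"
  show ?thesis
  proof (rule that[of K])
    show "K \<subseteq> S" using p(1) by (auto simp: K_def)
    show "S \<subseteq> closure K"
    proof
      fix x assume x: "x \<in> S"
      show "x \<in> closure K"
        unfolding closure_approachable
      proof (intro allI impI)
        fix e :: real assume "e > 0"
        then have "ball x e \<inter> S \<noteq> {}" using x by (metis centre_in_ball disjoint_iff)
        then obtain i where "V i \<subseteq> ball x e" using V(3)[of "ball x e"] by auto
        then have "p i (\<lambda>_. True) \<in> ball x e" using pV by blast
        then show "\<exists>y\<in>K. dist y x < e" by (auto simp: K_def dist_commute)
      qed
    qed
    show "mycielski_set K"
      unfolding mycielski_set_def K_def using cantor by (intro exI[of _ "range (\<lambda>i. range (p i))"]) auto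
    show "\<forall>\<^sub>F n in sequentially. (y, z) \<in> Q n" if yz: "y \<in> K" "z \<in> K" "y \<noteq> z" for y z
    proof -
      obtain i a j b where "y = p i a" "z = p j b" using yz by (auto simp: K_def)
      then show ?thesis using in_Q[of i a j b] yz by auto
    qed
    show "\<exists>y\<in>K. \<exists>z\<in>K. y \<noteq> z"
      using p_inj[of 0 "\<lambda>_. True" 1 "\<lambda>_. True"] by (auto simp: K_def)
  qed
qed

section \<open>The Pinsker algebra of a topological dynamical system\<close>

context mp_action
begin

text \<open>A Folner sequence must exist for the description of the limit to be unique.\<close>

lemma entropy_wrt_eqI:
  assumes X: "simple_function M X" and \<alpha>: "\<alpha> - {{}} = (\<lambda>v. X -` {v}) ` range X"
    and ex: "\<exists>F. folner_seq G F"
    and lim: "\<And>F. folner_seq G F \<Longrightarrow> (\<lambda>n. rv_entropy (join X (F n)) / card (F n)) \<longlonglongrightarrow> h"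
  shows "entropy_wrt G \<phi> M \<alpha> = h"
proof -
  have eq: "partition_entropy M (dynamical_join \<phi> (F n) \<alpha>) = rv_entropy (join X (F n))"
    if "folner_seq G F" for F n
    using folner_seqD[OF that] by (intro partition_entropy_dynamical_join[OF X _ _ \<alpha>])
  show ?thesis
    unfolding entropy_wrt_def
  proof (rule the_equality)
    show *: "\<forall>F. folner_seq G F \<longrightarrow>
        (\<lambda>n. partition_entropy M (dynamical_join \<phi> (F n) \<alpha>) / real (card (F n))) \<longlonglongrightarrow> h"
      using lim eq by simp
    fix h' assume h': "\<forall>F. folner_seq G F \<longrightarrow>
        (\<lambda>n. partition_entropy M (dynamical_join \<phi> (F n) \<alpha>) / real (card (F n))) \<longlonglongrightarrow> h'"
    obtain F where F: "folner_seq G F" using ex by blast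
    show "h' = h" by (rule LIMSEQ_unique[OF h'[rule_format, OF F] *[rule_format, OF F]])
  qed
qed

lemma zero_entropy_set_iff_entropy_wrt:
  assumes ex: "\<exists>F. folner_seq G F" and A: "A \<in> events"
  shows "zero_entropy_set A \<longleftrightarrow> entropy_wrt G \<phi> M {A, UNIV - A} = 0"
proof -
  let ?X = "\<lambda>x. x \<in> A"
  note X = simple_function_mem[OF A]
  have T: "?X -` {True} = A" and F: "?X -` {False} = UNIV - A" by auto
  have \<alpha>: "{A, UNIV - A} - {{}} = (\<lambda>v. ?X -` {v}) ` range ?X" (is "?L = ?R")
  proof (intro equalityI subsetI)
    fix B assume B: "B \<in> ?L"
    then obtain x where x: "x \<in> B" by auto
    have "B = ?X -` {?X x}" using B x by (cases "x \<in> A") auto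
    then show "B \<in> ?R" by (rule image_eqI) simp
  next
    fix B assume "B \<in> ?R"
    then obtain x where x: "B = ?X -` {?X x}" by auto
    then have "x \<in> B" by simp
    moreover have "B = A \<or> B = UNIV - A" unfolding x by (cases "x \<in> A") auto
    ultimately show "B \<in> ?L" by auto
  qed
  obtain h where h: "\<And>F. folner_seq G F \<Longrightarrow> (\<lambda>n. rv_entropy (join ?X (F n)) / card (F n)) \<longlonglongrightarrow> h"
    using entropy_limit_exists[OF X] by blast
  have eq: "entropy_wrt G \<phi> M {A, UNIV - A} = h" by (rule entropy_wrt_eqI[OF X \<alpha> ex h])
  show ?thesis
  proof
    assume A0: "zero_entropy_set A"
    obtain F where F: "folner_seq G F" using ex by blast
    have "h = 0" by (rule LIMSEQ_unique[OF h[OF F] zero_entropy_setD(2)[OF A0 F]])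
    then show "entropy_wrt G \<phi> M {A, UNIV - A} = 0" using eq by simp
  next
    assume "entropy_wrt G \<phi> M {A, UNIV - A} = 0"
    then show "zero_entropy_set A" using A h eq unfolding zero_entropy_set_def by auto
  qed
qed

lemma entropy_wrt_zero_if_zero_entropy_sets:
  assumes ex: "\<exists>F. folner_seq G F" and \<alpha>: "finite \<alpha>" "partition_on UNIV \<alpha>"
    and zero: "\<And>A. A \<in> \<alpha> \<Longrightarrow> zero_entropy_set A"
  shows "entropy_wrt G \<phi> M \<alpha> = 0"
proof -
  have ex1: "\<exists>A\<in>\<alpha>. x \<in> A" for x using \<alpha>(2) by (auto simp: partition_on_def)
  have disj: "A = B" if "A \<in> \<alpha>" "B \<in> \<alpha>" "x \<in> A" "x \<in> B" for A B x
    using \<alpha>(2) that by (auto simp: partition_on_def disjoint_def)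
  define X where "X x = (THE A. A \<in> \<alpha> \<and> x \<in> A)" for x
  have X_eq: "X x = A" if "A \<in> \<alpha>" "x \<in> A" for x A
    unfolding X_def by (rule the_equality) (use that disj in auto)
  have X_in: "X x \<in> \<alpha>" "x \<in> X x" for x using ex1[of x] X_eq by auto
  have fib: "X -` {A} = A" if "A \<in> \<alpha>" for A using X_eq[OF that] X_in by auto
  have ev: "A \<in> events" if "A \<in> \<alpha>" for A using zero[OF that] by (rule zero_entropy_setD)
  have rng: "range X \<subseteq> \<alpha>" using X_in by auto
  have Xs: "simple_function M X"
    unfolding simple_function_def
    using finite_subset[OF rng \<alpha>(1)] fib ev X_in(1) by auto
  have "\<alpha> \<subseteq> range X"
  proof
    fix A assume A: "A \<in> \<alpha>"
    then have "A \<noteq> {}" using \<alpha>(2) by (auto simp: partition_on_def)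
    then obtain x where "x \<in> A" by auto
    then show "A \<in> range X" using X_eq[OF A] by auto
  qed
  then have rng: "range X = \<alpha>" using rng by auto
  have \<alpha>_eq: "\<alpha> - {{}} = (\<lambda>v. X -` {v}) ` range X"
    unfolding rng using fib \<alpha>(2) by (auto simp: partition_on_def image_iff)
  show ?thesis
  proof (rule entropy_wrt_eqI[OF Xs \<alpha>_eq ex])
    fix F assume F: "folner_seq G F"
    note F' = folner_seqD[OF F]
    show "(\<lambda>n. rv_entropy (join X (F n)) / card (F n)) \<longlonglongrightarrow> 0"
    proof (rule tendsto_sandwich[OF _ _ tendsto_const])
      have "(\<lambda>n. \<Sum>A\<in>\<alpha>. rv_entropy (join (\<lambda>x. x \<in> A) (F n)) / card (F n)) \<longlonglongrightarrow> (\<Sum>A\<in>\<alpha>. 0)"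
        by (intro tendsto_sum zero_entropy_setD(2)[OF zero F])
      then show "(\<lambda>n. \<Sum>A\<in>\<alpha>. rv_entropy (join (\<lambda>x. x \<in> A) (F n)) / card (F n)) \<longlonglongrightarrow> 0" by simp
      have nn: "0 \<le> rv_entropy (join X (F n)) / card (F n)" for n
        using F' by (intro divide_nonneg_nonneg rv_entropy_nonneg simple_function_join Xs) auto
      then show "\<forall>\<^sub>F n in sequentially. 0 \<le> rv_entropy (join X (F n)) / card (F n)" by simp
      have "rv_entropy (join X (F n)) \<le> (\<Sum>A\<in>\<alpha>. rv_entropy (join (\<lambda>x. x \<in> A) (F n)))" for n
      proof -
        have s: "simple_function M (join (\<lambda>x. x \<in> A) (F n))" if "A \<in> \<alpha>" for A
          using F' ev[OF that] by (intro simple_function_join simple_function_mem) auto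
        let ?W = "\<lambda>x. restrict (\<lambda>A. join (\<lambda>x. x \<in> A) (F n) x) \<alpha>"
        note fam = rv_entropy_family[of \<alpha> "\<lambda>A. join (\<lambda>x. x \<in> A) (F n)", OF \<alpha>(1) s]
        have "rv_entropy (join X (F n)) \<le> rv_entropy ?W"
        proof (rule rv_entropy_mono(1)[OF fam(1)])
          fix x y assume W: "?W x = ?W y"
          show "join X (F n) x = join X (F n) y"
            unfolding join_eq_iff
          proof
            fix g assume g: "g \<in> F n"
            define A where "A = X (\<phi> g x)"
            have A: "A \<in> \<alpha>" "\<phi> g x \<in> A" using X_in by (auto simp: A_def)
            have "?W x A = ?W y A" using W by (rule fun_cong)
            then have "\<phi> g y \<in> A" using A g by (auto simp: join_eq_iff)
            then show "X (\<phi> g x) = X (\<phi> g y)" using X_eq[OF A(1)] by (simp add: A_def)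
          qed
        qed
        then show ?thesis using fam(2) by linarith
      qed
      then have "rv_entropy (join X (F n)) / card (F n) \<le> (\<Sum>A\<in>\<alpha>. rv_entropy (join (\<lambda>x. x \<in> A) (F n)) / card (F n))" for n
        unfolding sum_divide_distrib[symmetric] by (intro divide_right_mono) auto
      then show "\<forall>\<^sub>F n in sequentially. rv_entropy (join X (F n)) / card (F n)
          \<le> (\<Sum>A\<in>\<alpha>. rv_entropy (join (\<lambda>x. x \<in> A) (F n)) / card (F n))" by simp
    qed
  qed
qed

end

text \<open>Preimages of null sets under a Borel map that preserves \<open>\<mu>\<close> are null sets, so the map is measurable
  for the completed Borel sets.\<close>

lemma mp_action_completion:
  fixes \<mu> :: "'x::metric_space measure"
  assumes tds: "G_tds G \<phi>" and inv: "invariant_measure G \<phi> \<mu>"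
  shows "mp_action G (completion \<mu>) \<phi>"
proof -
  interpret G_tds G \<phi> by (rule tds)
  have grp: "group G" using group_hom by (simp add: group_hom_def)
  have sets: "sets \<mu> = sets borel" and ps: "prob_space \<mu>" and dis: "\<And>g. g \<in> carrier G \<Longrightarrow> distr \<mu> borel (\<phi> g) = \<mu>"
    using inv by (auto simp: invariant_measure_def)
  have space: "space \<mu> = UNIV" using sets_eq_imp_space_eq[OF sets] by simp
  interpret \<mu>: prob_space \<mu> by (rule ps)
  have psc: "prob_space (completion \<mu>)"
    by (rule prob_spaceI) (simp add: \<mu>.emeasure_space_1)
  have meas: "\<phi> g \<in> \<mu> \<rightarrow>\<^sub>M \<mu>" if "g \<in> carrier G" for g
    using borel_measurable_continuous_onI[OF continuous_action[OF that]] sets by (simp cong: measurable_cong_sets)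
  have dis': "distr \<mu> \<mu> (\<phi> g) = \<mu>" if "g \<in> carrier G" for g
    using dis[OF that] distr_cong[of \<mu> \<mu> \<mu> borel "\<phi> g" "\<phi> g"] sets by simp
  have dc: "distr (completion \<mu>) \<mu> (\<phi> g) = \<mu>" if "g \<in> carrier G" for g
    using distr_completion[OF meas[OF that]] dis'[OF that] by simp

  have m1: "\<phi> g \<in> completion \<mu> \<rightarrow>\<^sub>M \<mu>" if "g \<in> carrier G" for g
    by (rule measurable_completion[OF meas[OF that]])
  show ?thesis
  proof (intro mp_action.intro mp_action_axioms.intro grp psc)
    show "space (completion \<mu>) = UNIV" using space by simp
    fix g assume g: "g \<in> carrier G"
    show "\<phi> g \<in> completion \<mu> \<rightarrow>\<^sub>M completion \<mu>"
      by (rule completion.measurable_completion2[OF m1[OF g]]) (simp add: dc[OF g])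
    show "distr (completion \<mu>) (completion \<mu>) (\<phi> g) = completion \<mu>"
      using completion.completion_distr_eq[OF m1[OF g]] by (simp add: dc[OF g])
    show "\<phi> (g \<otimes>\<^bsub>G\<^esub> h) x = \<phi> g (\<phi> h x)" if "h \<in> carrier G" for h x
      using composition_rule[of x g h] g that by simp
  next
    show "\<phi> \<one>\<^bsub>G\<^esub> x = x" for x using fun_cong[OF id_eq_one, of x] by simp
  qed
qed

section \<open>Conditional variances are positive almost everywhere\<close>

lemma (in prob_space) AE_ex: "(AE x in M. P x) \<Longrightarrow> \<exists>x\<in>space M. P x"
proof (rule ccontr)
  assume ae: "AE x in M. P x" and no: "\<not> (\<exists>x\<in>space M. P x)"
  from ae AE_space have "AE x in M. False" by eventually_elim (use no in blast)
  then show False by simp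
qed

lemma (in prob_space) AE_eq_expectation_if_variance_le_0:
  fixes f :: "'a \<Rightarrow> real"
  assumes f: "f \<in> borel_measurable M" "\<And>x. \<bar>f x\<bar> \<le> C"
    and v: "expectation (\<lambda>x. (f x)\<^sup>2) - (expectation f)\<^sup>2 \<le> 0"
  shows "AE x in M. f x = expectation f"
proof -
  have i1: "integrable M f" by (rule integrable_bounded[OF f])
  have i2: "integrable M (\<lambda>x. (f x)\<^sup>2)"
    by (rule integrable_bounded[of _ "C\<^sup>2"])
       (use f order_trans[OF f(2) abs_ge_self] in \<open>auto simp: abs_le_square_iff[symmetric]\<close>)
  have i3: "integrable M (\<lambda>x. (f x - expectation f)\<^sup>2)"
  proof -
    have "(\<lambda>x. (f x - expectation f)\<^sup>2) = (\<lambda>x. (f x)\<^sup>2 - 2 * expectation f * f x + (expectation f)\<^sup>2)"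
      by (auto simp: power2_diff)
    then show ?thesis using i1 i2 by simp
  qed
  have "variance f \<le> 0" using v variance_eq[OF i1 i2] by simp
  moreover have "variance f \<ge> 0" by (rule variance_positive)
  ultimately have "variance f = 0" by simp
  then have "AE x in M. (f x - expectation f)\<^sup>2 = 0"
    using integral_nonneg_eq_0_iff_AE[OF i3] by simp
  then show ?thesis by eventually_elim simp
qed

text \<open>Each sequence has an almost everywhere convergent subsequence, and a diagonal sequence serves all
  of them.\<close>

lemma L1_null_sequences_common_AE_subseq:
  fixes w :: "nat \<Rightarrow> nat \<Rightarrow> 'a \<Rightarrow> real"
  assumes int: "\<And>k n. integrable M (w k n)"
    and lim: "\<And>k. (\<lambda>n. \<integral>x. \<bar>w k n x\<bar> \<partial>M) \<longlonglongrightarrow> 0"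
  obtains r :: "nat \<Rightarrow> nat" where "strict_mono r" "AE x in M. \<forall>k. (\<lambda>n. w k (r n) x) \<longlonglongrightarrow> 0"
proof -
  define P where "P k s \<longleftrightarrow> (AE x in M. (\<lambda>n. w k (s n) x) \<longlonglongrightarrow> 0)" for k and s :: "nat \<Rightarrow> nat"
  interpret subseqs P
  proof
    fix k and s :: "nat \<Rightarrow> nat" assume s: "strict_mono s"
    have "(\<lambda>n. \<integral>x. norm (w k (s n) x) \<partial>M) \<longlonglongrightarrow> 0"
      using LIMSEQ_subseq_LIMSEQ[OF lim[of k] s] by (simp add: o_def)
    from tendsto_L1_AE_subseq[of M "\<lambda>n. w k (s n)", OF int this]
    show "\<exists>r. strict_mono r \<and> P k (s \<circ> r)" unfolding P_def by (simp add: o_def)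
  qed
  have "P k (diagseq \<circ> ((+) (Suc k)))" for k
  proof (rule diagseq_holds)
    fix r s :: "nat \<Rightarrow> nat" and n assume "strict_mono r" "P n s"
    then show "P n (s \<circ> r)"
      unfolding P_def by (auto elim!: eventually_mono dest: LIMSEQ_subseq_LIMSEQ[of _ _ r] simp: o_def)
  qed
  then have "AE x in M. \<forall>k. (\<lambda>n. w k (diagseq (Suc k + n)) x) \<longlonglongrightarrow> 0"
    unfolding P_def AE_all_countable by (simp add: o_def)
  then have "AE x in M. \<forall>k. (\<lambda>n. w k (diagseq n) x) \<longlonglongrightarrow> 0"
  proof eventually_elim
    case (elim x)
    show ?case
    proof
      fix k
      have "(\<lambda>n. w k (diagseq (n + Suc k)) x) \<longlonglongrightarrow> 0" using elim[rule_format, of k] by (simp add: add.commute)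
      then show "(\<lambda>n. w k (diagseq n) x) \<longlonglongrightarrow> 0" by (rule LIMSEQ_offset)
    qed
  qed
  then show ?thesis using that subseq_diagseq by blast
qed

text \<open>All but finitely many terms are below \<open>e\<close>, and the exceptional ones have vanishing weight as the
  cardinalities grow.\<close>

lemma cesaro_vanishing_off_finite:
  fixes d :: "'g \<Rightarrow> real"
  assumes d: "\<And>g. g \<in> S \<Longrightarrow> 0 \<le> d g" "\<And>g. g \<in> S \<Longrightarrow> d g \<le> B"
    and fin: "\<And>e. e > 0 \<Longrightarrow> finite {g \<in> S. d g > e}"
    and H: "\<And>n. finite (H n)" "\<And>n. H n \<noteq> {}" "\<And>n. H n \<subseteq> S" "filterlim (\<lambda>n. card (H n)) at_top sequentially"
  shows "(\<lambda>n. (\<Sum>g\<in>H n. d g) / card (H n)) \<longlonglongrightarrow> 0"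
proof (rule order_tendstoI)
  fix a :: real assume "a < 0"
  moreover have "0 \<le> (\<Sum>g\<in>H n. d g) / card (H n)" for n
    using H(3)[of n] d(1) by (intro divide_nonneg_nonneg sum_nonneg) auto
  ultimately show "\<forall>\<^sub>F n in sequentially. a < (\<Sum>g\<in>H n. d g) / card (H n)"
    by (intro always_eventually allI) (rule less_le_trans)
next
  fix a :: real assume a: "0 < a"
  define K where "K = {g \<in> S. d g > a / 2}"
  have K: "finite K" unfolding K_def using a by (intro fin) simp
  have "filterlim (\<lambda>n. real (card (H n))) at_top sequentially"
    by (rule filterlim_compose[OF filterlim_real_sequentially H(4)])
  then have "\<forall>\<^sub>F n in sequentially. real (card (H n)) > 2 * card K * \<bar>B\<bar> / a"
    by (simp add: filterlim_at_top_dense)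
  then show "\<forall>\<^sub>F n in sequentially. (\<Sum>g\<in>H n. d g) / card (H n) < a"
  proof eventually_elim
    case (elim n)
    have c: "real (card (H n)) > 0" using H by (simp add: card_gt_0_iff)
    have "(\<Sum>g\<in>H n. d g) \<le> (\<Sum>g\<in>H n. a / 2 + (if g \<in> K then \<bar>B\<bar> else 0))"
    proof (rule sum_mono)
      fix g assume "g \<in> H n"
      then have "g \<in> S" using H by auto
      then show "d g \<le> a / 2 + (if g \<in> K then \<bar>B\<bar> else 0)"
        using d(2)[of g] a by (auto simp: K_def)
    qed
    also have "\<dots> = a / 2 * card (H n) + card (H n \<inter> K) * \<bar>B\<bar>"
      using H by (simp add: sum.distrib sum.If_cases)
    also have "card (H n \<inter> K) * \<bar>B\<bar> \<le> card K * \<bar>B\<bar>"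
      using K by (intro mult_right_mono) (auto intro: card_mono)
    also have "card K * \<bar>B\<bar> < a / 2 * card (H n)" using elim a by (simp add: field_simps)
    finally have "(\<Sum>g\<in>H n. d g) < a * card (H n)" by simp
    then show ?case using c by (simp add: pos_divide_less_eq)
  qed
qed

text \<open>The situation of the theorem, with the Pinsker algebra already identified as \<open>pinsker\<close> and the
  disintegration only recorded for bounded Borel functions.\<close>

locale pinsker_disintegration = mp_action G "completion \<mu>" \<phi>
  for G :: "('g, 'm) monoid_scheme" (structure) and \<mu> :: "'x::metric_space measure" and \<phi> +
  fixes \<kappa> :: "'x \<Rightarrow> 'x measure"
  assumes sets_mu: "sets \<mu> = sets borel"
    and compact_UNIV: "compact (UNIV :: 'x set)"
    and continuous_action: "g \<in> carrier G \<Longrightarrow> continuous_on UNIV (\<phi> g)"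
    and countable_carrier: "countable (carrier G)"
    and ergodic: "A \<in> sets borel \<Longrightarrow> measure \<mu> (\<Union>g\<in>carrier G. \<phi> g ` A) \<in> {0, 1}"
    and kernel_prob: "\<And>y. prob_space (\<kappa> y)"
    and kernel_sets: "\<And>y. sets (\<kappa> y) = sets borel"
    and disintegrate: "\<And>(f::'x \<Rightarrow> real) C. f \<in> borel_measurable borel \<Longrightarrow> (\<And>x. \<bar>f x\<bar> \<le> C) \<Longrightarrow>
      AE y in completion \<mu>. condE f y = (\<integral>x. f x \<partial>\<kappa> y)"
    and positive_entropy: "\<exists>A\<in>sets borel. \<not> zero_entropy_set A"
begin

lemma space_mu[simp]: "space \<mu> = UNIV"
  using sets_eq_imp_space_eq[OF sets_mu] by simp

lemma borel_events: "A \<in> sets borel \<Longrightarrow> A \<in> events"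
  using sets_mu by auto

lemma borel_measurable_M: "(f :: 'x \<Rightarrow> real) \<in> borel_measurable borel \<Longrightarrow> f \<in> borel_measurable (completion \<mu>)"
  by (rule measurable_completion) (use sets_mu in \<open>simp cong: measurable_cong_sets\<close>)

lemma borel_measurable_kernel: "(f :: 'x \<Rightarrow> real) \<in> borel_measurable borel \<Longrightarrow> f \<in> borel_measurable (\<kappa> y)"
  using kernel_sets[of y] by (simp cong: measurable_cong_sets)

lemma space_kernel[simp]: "space (\<kappa> y) = UNIV"
  using sets_eq_imp_space_eq[OF kernel_sets[of y]] by simp

definition center :: "nat \<Rightarrow> 'x" where
  "center = (SOME c. \<forall>U. open U \<longrightarrow> U \<noteq> {} \<longrightarrow> (\<exists>j. c j \<in> U))"

lemma center_dense: "open U \<Longrightarrow> U \<noteq> {} \<Longrightarrow> \<exists>j. center j \<in> U"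
proof -
  obtain V :: "nat \<Rightarrow> 'x set" where V: "\<And>i. open (V i)" "\<And>i. V i \<inter> UNIV \<noteq> {}"
    "\<And>U. open U \<Longrightarrow> U \<inter> UNIV \<noteq> {} \<Longrightarrow> \<exists>i. V i \<subseteq> U"
    using compact_countable_pseudobase[OF compact_UNIV UNIV_not_empty] by metis
  have "\<forall>i. \<exists>x. x \<in> V i" using V(2) by auto
  then obtain c where c: "\<And>i. c i \<in> V i" by metis
  have "\<exists>j. c j \<in> U" if U: "open U" "U \<noteq> {}" for U
  proof -
    obtain i where "V i \<subseteq> U" using V(3)[of U] U by auto
    then show ?thesis using c by blast
  qed
  then have "\<forall>U. open U \<longrightarrow> U \<noteq> {} \<longrightarrow> (\<exists>j. center j \<in> U)"
    unfolding center_def by (intro someI[of "\<lambda>c. \<forall>U. open U \<longrightarrow> U \<noteq> {} \<longrightarrow> (\<exists>j. c j \<in> U)" c]) blast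
  then show "open U \<Longrightarrow> U \<noteq> {} \<Longrightarrow> \<exists>j. center j \<in> U" by blast
qed

abbreviation dfun :: "nat \<Rightarrow> 'x \<Rightarrow> real" where "dfun j \<equiv> dist (center j)"

definition diam :: real where "diam = (SOME C. C > 0 \<and> (\<forall>x y :: 'x. dist x y \<le> C))"

lemma diam: "diam > 0" "dist (x :: 'x) y \<le> diam"
proof -
  have "bounded (UNIV :: 'x set)" by (rule compact_imp_bounded[OF compact_UNIV])
  then obtain e where e: "\<forall>y. dist (undefined :: 'x) y \<le> e"
    using bounded_any_center[of UNIV "undefined :: 'x"] by auto
  have "dist x y \<le> 2 * \<bar>e\<bar> + 1" for x y :: 'x
    using dist_triangle2[of x y undefined] e[rule_format, of x] e[rule_format, of y]
    by (simp add: dist_commute)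
  then have "(2 * \<bar>e\<bar> + 1) > 0 \<and> (\<forall>x y :: 'x. dist x y \<le> 2 * \<bar>e\<bar> + 1)" by auto
  then have "diam > 0 \<and> (\<forall>x y :: 'x. dist x y \<le> diam)" unfolding diam_def by (rule someI)
  then show "diam > 0" "dist (x :: 'x) y \<le> diam" by auto
qed

lemma dfun_continuous: "continuous_on UNIV (dfun j)"
  by (intro continuous_intros)

lemma dfun_borel: "dfun j \<in> borel_measurable borel"
  by (rule borel_measurable_continuous_onI[OF dfun_continuous])

lemma dfun_action_borel: "g \<in> carrier G \<Longrightarrow> (\<lambda>x. dfun j (\<phi> g x)) \<in> borel_measurable borel"
  by (intro borel_measurable_continuous_onI continuous_intros continuous_action)

lemma dfun_bound: "\<bar>dfun j x\<bar> \<le> diam" using diam by simp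

lemma dfun2_bound: "\<bar>(dfun j x)\<^sup>2\<bar> \<le> diam\<^sup>2"
  using diam(2)[of "center j" x] by (simp add: power_mono)

text \<open>The variance of \<open>dfun j\<close> with respect to \<open>\<kappa> x\<close>, up to null sets, written with conditional
  expectations because only these are known to be Pinsker measurable.\<close>

definition cvar :: "nat \<Rightarrow> 'x \<Rightarrow> real" where
  "cvar j x = condE (\<lambda>x. (dfun j x)\<^sup>2) x - (condE (dfun j) x)\<^sup>2"

lemma cvar_measurable: "cvar j \<in> borel_measurable pinsker"
  unfolding cvar_def using condE_measurable(1) by measurable

lemma AE_kernel_dfun:
  "AE x in completion \<mu>. \<forall>j. condE (dfun j) x = (\<integral>y. dfun j y \<partial>\<kappa> x) \<and>
    condE (\<lambda>x. (dfun j x)\<^sup>2) x = (\<integral>y. (dfun j y)\<^sup>2 \<partial>\<kappa> x)"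
  unfolding AE_all_countable
proof
  fix j
  have "(\<lambda>x. (dfun j x)\<^sup>2) \<in> borel_measurable borel" using dfun_borel by measurable
  from disintegrate[OF dfun_borel dfun_bound, of j] disintegrate[OF this dfun2_bound]
  show "AE x in completion \<mu>. condE (dfun j) x = (\<integral>y. dfun j y \<partial>\<kappa> x) \<and>
    condE (\<lambda>x. (dfun j x)\<^sup>2) x = (\<integral>y. (dfun j y)\<^sup>2 \<partial>\<kappa> x)"
    by eventually_elim simp
qed

lemma AE_kernel_dfun_action:
  assumes g: "g \<in> carrier G"
  shows "AE x in completion \<mu>. \<forall>j. condE (dfun j) (\<phi> g x) = (\<integral>y. dfun j (\<phi> g y) \<partial>\<kappa> x) \<and>
    condE (\<lambda>x. (dfun j x)\<^sup>2) (\<phi> g x) = (\<integral>y. (dfun j (\<phi> g y))\<^sup>2 \<partial>\<kappa> x)"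
  unfolding AE_all_countable
proof
  fix j
  have m2: "(\<lambda>x. (dfun j x)\<^sup>2) \<in> borel_measurable borel" using dfun_borel by measurable
  have i1: "integrable (completion \<mu>) (dfun j)"
    by (rule integrable_bounded[OF borel_measurable_M[OF dfun_borel] dfun_bound])
  have i2: "integrable (completion \<mu>) (\<lambda>x. (dfun j x)\<^sup>2)"
    by (rule integrable_bounded[OF borel_measurable_M[OF m2] dfun2_bound])
  have m3: "(\<lambda>x. (dfun j (\<phi> g x))\<^sup>2) \<in> borel_measurable borel" using dfun_action_borel[OF g] by measurable
  from condE_action[OF g i1] condE_action[OF g i2]
    disintegrate[OF dfun_action_borel[OF g] dfun_bound, of j] disintegrate[OF m3 dfun2_bound]
  show "AE x in completion \<mu>. condE (dfun j) (\<phi> g x) = (\<integral>y. dfun j (\<phi> g y) \<partial>\<kappa> x) \<and>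
    condE (\<lambda>x. (dfun j x)\<^sup>2) (\<phi> g x) = (\<integral>y. (dfun j (\<phi> g y))\<^sup>2 \<partial>\<kappa> x)"
    by eventually_elim simp
qed

text \<open>Vanishing variance makes all distances to the dense sequence almost surely constant, and these
  distances determine a point.\<close>

lemma kernel_Dirac:
  assumes v: "\<And>j. (\<integral>y. (dfun j y)\<^sup>2 \<partial>\<kappa> x) - (\<integral>y. dfun j y \<partial>\<kappa> x)\<^sup>2 \<le> 0"
  shows "\<exists>y0. AE y in \<kappa> x. y = y0"
proof -
  interpret k: prob_space "\<kappa> x" by (rule kernel_prob)
  have "AE y in \<kappa> x. \<forall>j. dfun j y = (\<integral>y. dfun j y \<partial>\<kappa> x)"
    unfolding AE_all_countable
    using k.AE_eq_expectation_if_variance_le_0[OF borel_measurable_kernel[OF dfun_borel] dfun_bound v] by blast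
  then have ae: "AE y in \<kappa> x. \<forall>j. dfun j y = (\<integral>y. dfun j y \<partial>\<kappa> x)" .
  obtain y0 where y0: "\<forall>j. dfun j y0 = (\<integral>y. dfun j y \<partial>\<kappa> x)" using k.AE_ex[OF ae] by blast
  have "AE y in \<kappa> x. y = y0"
    using ae
  proof eventually_elim
    case (elim y)
    show ?case
    proof (rule ccontr)
      assume "y \<noteq> y0"
      then have d: "dist y y0 / 2 > 0" by simp
      then obtain j where "center j \<in> ball y (dist y y0 / 2)" using center_dense[of "ball y (dist y y0 / 2)"] by auto
      then have "dist (center j) y < dist y y0 / 2" by (simp add: dist_commute)
      moreover have "dist (center j) y0 = dist (center j) y" using elim y0 by metis
      moreover have "dist y y0 \<le> dist (center j) y + dist (center j) y0" by (metis dist_commute dist_triangle)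
      ultimately show False by simp
    qed
  qed
  then show ?thesis by blast
qed

lemma kernel_integral_Dirac:
  fixes f :: "'x \<Rightarrow> real"
  assumes "AE y in \<kappa> x. y = y0" "f \<in> borel_measurable borel"
  shows "(\<integral>y. f y \<partial>\<kappa> x) = f y0"
proof -
  interpret k: prob_space "\<kappa> x" by (rule kernel_prob)
  have "(\<integral>y. f y \<partial>\<kappa> x) = (\<integral>y. f y0 \<partial>\<kappa> x)"
  proof (rule integral_cong_AE)
    show "AE y in \<kappa> x. f y = f y0" using assms(1) by eventually_elim simp
  qed (use borel_measurable_kernel[OF assms(2)] in auto)
  then show ?thesis using k.prob_space by simp
qed

lemma AE_cvar_nonneg: "AE x in completion \<mu>. \<forall>j. cvar j x \<ge> 0"
  using AE_kernel_dfun
proof eventually_elim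
  case (elim x)
  interpret k: prob_space "\<kappa> x" by (rule kernel_prob)
  show ?case
  proof
    fix j
    have i1: "integrable (\<kappa> x) (dfun j)"
      by (rule k.integrable_bounded[OF borel_measurable_kernel[OF dfun_borel] dfun_bound])
    have m2: "(\<lambda>x. (dfun j x)\<^sup>2) \<in> borel_measurable borel" using dfun_borel by measurable
    have i2: "integrable (\<kappa> x) (\<lambda>x. (dfun j x)\<^sup>2)"
      by (rule k.integrable_bounded[OF borel_measurable_kernel[OF m2] dfun2_bound])
    show "cvar j x \<ge> 0"
      using k.variance_positive[of "dfun j"] k.variance_eq[OF i1 i2] elim by (simp add: cvar_def)
  qed
qed

definition degenerate :: "'x set" where "degenerate = {x. \<forall>j. cvar j x \<le> 0}"

lemma degenerate_events: "degenerate \<in> events"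
proof -
  have "{x \<in> space (completion \<mu>). \<forall>j. cvar j x \<le> 0} \<in> events"
    using measurable_pinsker_imp[OF cvar_measurable] by measurable
  then show ?thesis unfolding degenerate_def by simp
qed

text \<open>At a degenerate point the fibre is a Dirac measure, so the functions \<open>dfun j \<circ> \<phi> g\<close> have variance
  \<open>0\<close> there as well. By invariance of the Pinsker algebra this is \<open>cvar j (\<phi> g x)\<close>.\<close>

lemma degenerate_invariant:
  assumes g: "g \<in> carrier G"
  shows "AE x in completion \<mu>. x \<in> degenerate \<longrightarrow> \<phi> g x \<in> degenerate"
  using AE_kernel_dfun AE_kernel_dfun_action[OF g]
proof eventually_elim
  case (elim x)
  show ?case
  proof
    assume "x \<in> degenerate"
    then have "(\<integral>y. (dfun j y)\<^sup>2 \<partial>\<kappa> x) - (\<integral>y. dfun j y \<partial>\<kappa> x)\<^sup>2 \<le> 0" for j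
      using elim(1) by (auto simp: degenerate_def cvar_def)
    then obtain y0 where y0: "AE y in \<kappa> x. y = y0" using kernel_Dirac by blast
    have "cvar j (\<phi> g x) = 0" for j
    proof -
      have m: "(\<lambda>x. (dfun j (\<phi> g x))\<^sup>2) \<in> borel_measurable borel" using dfun_action_borel[OF g] by measurable
      show ?thesis
        using elim(2) kernel_integral_Dirac[OF y0 m] kernel_integral_Dirac[OF y0 dfun_action_borel[OF g], of j]
        by (simp add: cvar_def)
    qed
    then show "\<phi> g x \<in> degenerate" by (simp add: degenerate_def)
  qed
qed

text \<open>Ergodicity refers to the saturation of a Borel set. The saturation of a Borel set \<open>S\<close> that agrees
  with the degenerate points up to a null set is again this set up to a null set.\<close>

lemma degenerate_0_1: "prob degenerate \<in> {0, 1}"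
proof -
  obtain S N N' where SN: "degenerate = S \<union> N" "N \<subseteq> N'" "N' \<in> null_sets \<mu>" "S \<in> sets \<mu>"
    using degenerate_events by (auto elim: sets_completionE)
  have S: "S \<in> sets borel" using SN sets_mu by simp
  have N0: "AE x in completion \<mu>. x \<notin> N'"
    by (rule AE_completion) (rule AE_not_in[OF SN(3)])
  define U where "U = (\<Union>g\<in>carrier G. \<phi> g ` S)"
  have img: "\<phi> g ` S = \<phi> (inv g) -` S" if g: "g \<in> carrier G" for g
  proof (intro equalityI subsetI)
    fix x assume "x \<in> \<phi> g ` S" then show "x \<in> \<phi> (inv g) -` S" using action_inv[OF g] by auto
  next
    fix x assume "x \<in> \<phi> (inv g) -` S"
    then show "x \<in> \<phi> g ` S" using action_inv(2)[OF g, of x] by (metis imageI vimageE)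
  qed
  have "\<phi> g ` S \<in> sets borel" if g: "g \<in> carrier G" for g
  proof -
    have "\<phi> (inv g) \<in> borel \<rightarrow>\<^sub>M borel"
      by (intro borel_measurable_continuous_onI continuous_action) (use g in simp)
    from measurable_sets[OF this S] show ?thesis using img[OF g] by simp
  qed
  then have U: "U \<in> sets borel" unfolding U_def using countable_carrier by (intro sets.countable_UN') auto
  have U01: "prob U \<in> {0, 1}"
    using ergodic[OF S] U sets_mu unfolding U_def[symmetric] by simp
  have "AE x in completion \<mu>. \<forall>g\<in>carrier G. x \<in> \<phi> (inv g) -` S \<longrightarrow> x \<in> degenerate"
    unfolding AE_ball_countable[OF countable_carrier]
  proof
    fix g assume g: "g \<in> carrier G"
    have "AE x in completion \<mu>. \<phi> (inv g) x \<in> degenerate \<longrightarrow> \<phi> g (\<phi> (inv g) x) \<in> degenerate"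
      by (rule action_AE[OF _ degenerate_invariant[OF g]]) (use g in simp)
    then show "AE x in completion \<mu>. x \<in> \<phi> (inv g) -` S \<longrightarrow> x \<in> degenerate"
      by eventually_elim (use SN(1) action_inv(2)[OF g] in auto)
  qed
  then have le: "AE x in completion \<mu>. x \<in> U \<longrightarrow> x \<in> degenerate"
    by eventually_elim (auto simp: U_def img)
  have SU: "S \<subseteq> U"
  proof
    fix x assume "x \<in> S"
    then have "x \<in> \<phi> \<one> ` S" using action_one by (metis imageI)
    then show "x \<in> U" unfolding U_def using one_closed by blast
  qed
  have ge: "AE x in completion \<mu>. x \<in> degenerate \<longrightarrow> x \<in> U"
    using N0 by eventually_elim (use SN SU in auto)
  have "prob degenerate = prob U"
    by (rule finite_measure_eq_AE[OF _ degenerate_events borel_events[OF U]])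
       (use le ge in \<open>eventually_elim, auto\<close>)
  then show ?thesis using U01 by simp
qed

text \<open>If almost all fibres are Dirac measures, the conditional expectation of the indicator of a Borel
  set \<open>A\<close> takes only the values \<open>0\<close> and \<open>1\<close>, so \<open>A\<close> agrees up to a null set with a set of zero
  entropy. This contradicts positive entropy.\<close>

lemma not_all_degenerate: "prob degenerate \<noteq> 1"
proof
  assume "prob degenerate = 1"
  then have ae: "AE x in completion \<mu>. x \<in> degenerate"
    using prob_eq_1[OF degenerate_events] by simp
  interpret E: finite_measure_subalgebra "completion \<mu>" pinsker by (rule pinsker_subalgebra)
  obtain A where A: "A \<in> sets borel" "\<not> zero_entropy_set A" using positive_entropy by blast
  let ?i = "indicator A :: 'x \<Rightarrow> real"
  have i_meas: "?i \<in> borel_measurable borel" using A by simp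
  have i_int: "integrable (completion \<mu>) ?i"
    by (rule integrable_bounded[OF borel_measurable_M[OF i_meas], of 1]) (auto simp: indicator_def)
  define P where "P = {x. condE ?i x > 1 / 2}"
  have P: "P \<in> sets pinsker"
    using borel_measurable_less[of "\<lambda>_. 1/2" pinsker "condE ?i"] condE_measurable(1) by (simp add: P_def)
  have P': "P \<in> events" by (rule pinsker_subset[OF P])
  have A': "A \<in> events" by (rule borel_events[OF A(1)])
  have "AE x in completion \<mu>. condE ?i x = (\<integral>y. ?i y \<partial>\<kappa> x)"
    by (rule disintegrate[OF i_meas, of 1]) (auto simp: indicator_def)
  with ae AE_kernel_dfun have eq: "AE x in completion \<mu>. condE ?i x = indicator P x"
  proof eventually_elim
    case (elim x)
    then have "(\<integral>y. (dfun j y)\<^sup>2 \<partial>\<kappa> x) - (\<integral>y. dfun j y \<partial>\<kappa> x)\<^sup>2 \<le> 0" for j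
      by (auto simp: degenerate_def cvar_def)
    then obtain y0 where y0: "AE y in \<kappa> x. y = y0" using kernel_Dirac by blast
    have "condE ?i x = ?i y0" using kernel_integral_Dirac[OF y0 i_meas] elim by simp
    then show ?case by (auto simp: P_def indicator_def)
  qed
  have tr: "prob (A \<inter> B) = prob (P \<inter> B)" if B: "B \<in> sets pinsker" for B
  proof -
    have B': "B \<in> events" by (rule pinsker_subset[OF B])
    have "prob (A \<inter> B) = (\<integral>x. indicator B x * ?i x \<partial>completion \<mu>)"
      using A' B' by (simp add: indicator_inter_arith[symmetric] Int_commute)
    also have "\<dots> = (\<integral>x. indicator B x * condE ?i x \<partial>completion \<mu>)"
      using E.real_cond_exp_intA[OF i_int B] by (simp add: set_lebesgue_integral_def)
    also have "\<dots> = (\<integral>x. indicator B x * indicator P x \<partial>completion \<mu>)"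
    proof (rule integral_cong_AE)
      show "AE x in completion \<mu>. indicator B x * condE ?i x = indicator B x * indicator P x"
        using eq by eventually_elim simp
    qed (use B' P' condE_measurable(2) in measurable)
    also have "\<dots> = prob (P \<inter> B)"
      using P' B' by (simp add: indicator_inter_arith[symmetric] Int_commute)
    finally show ?thesis .
  qed
  have cP: "UNIV - P \<in> sets pinsker" using sets.compl_sets[OF P] by simp
  have "A \<inter> (UNIV - P) = A - P" "P \<inter> (UNIV - P) = {}" by auto
  then have 1: "prob (A - P) = 0" using tr[OF cP] by simp
  have "prob (P - A) = prob P - prob (A \<inter> P)"
    using finite_measure_Diff'[OF P' A'] by (simp add: Int_commute)
  then have 2: "prob (P - A) = 0" using tr[OF P] by simp
  have "prob (sym_diff A P) \<le> 0"
    using measure_Un_le[of "A - P" "completion \<mu>" "P - A"] 1 2 A' P' by simp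
  then have "zero_entropy_set A"
    using P by (intro zero_entropy_set_approx[OF A']) (auto simp: sets_pinsker intro!: exI[of _ P])
  then show False using A by simp
qed

end

section \<open>Averages of conditional spreads\<close>

context pinsker_disintegration
begin

text \<open>Up to null sets this is \<open>\<kappa> x V\<close> times the integral of \<open>(dfun j \<circ> \<phi> g)\<^sup>2\<close> over \<open>V\<close>, minus the square
  of the integral of \<open>dfun j \<circ> \<phi> g\<close> over \<open>V\<close>; half the double integral of squared differences.\<close>

definition spread :: "nat \<Rightarrow> 'x set \<Rightarrow> 'g \<Rightarrow> 'x \<Rightarrow> real" where
  "spread j V g x = condE (indicator V) x * condE (\<lambda>x. (dfun j (\<phi> g x))\<^sup>2 * indicator V x) x -
     (condE (\<lambda>x. dfun j (\<phi> g x) * indicator V x) x)\<^sup>2"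

definition defect :: "nat \<Rightarrow> 'x set \<Rightarrow> 'g \<Rightarrow> 'x \<Rightarrow> real" where
  "defect j V g x = spread j V g x - (condE (indicator V) x)\<^sup>2 * cvar j (\<phi> g x)"

lemma defect_measurable: "g \<in> carrier G \<Longrightarrow> defect j V g \<in> borel_measurable (completion \<mu>)"
proof -
  assume g: "g \<in> carrier G"
  have "(\<lambda>x. cvar j (\<phi> g x)) \<in> borel_measurable (completion \<mu>)"
    by (rule measurable_compose[OF action_measurable[OF g] measurable_pinsker_imp[OF cvar_measurable]])
  then show ?thesis unfolding defect_def spread_def using condE_measurable(2) by measurable
qed

text \<open>With \<open>A1\<close> and \<open>A2\<close> the errors in \<open>relative_mixing\<close> for \<open>dfun j\<close> and its square, the defect equals
  \<open>p * A2 - A1 * (q1 + s1 * p)\<close>, so it is small in \<open>L\<^sup>1\<close> for all but finitely many \<open>g\<close>.\<close>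

lemma defect_L1:
  assumes V: "V \<in> sets borel"
  shows "g \<in> carrier G \<Longrightarrow> integrable (completion \<mu>) (defect j V g)"
    and "g \<in> carrier G \<Longrightarrow> expectation (\<lambda>x. \<bar>defect j V g x\<bar>) \<le> 6 * diam\<^sup>2"
    and "\<epsilon> > 0 \<Longrightarrow> finite {g \<in> carrier G. expectation (\<lambda>x. \<bar>defect j V g x\<bar>) > \<epsilon>}"
proof -
  let ?p = "condE (indicator V)" and ?s1 = "condE (dfun j)" and ?s2 = "condE (\<lambda>x. (dfun j x)\<^sup>2)"
  let ?q1 = "\<lambda>g. condE (\<lambda>x. dfun j (\<phi> g x) * indicator V x)"
  let ?q2 = "\<lambda>g. condE (\<lambda>x. (dfun j (\<phi> g x))\<^sup>2 * indicator V x)"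
  let ?A1 = "\<lambda>g x. ?q1 g x - ?s1 (\<phi> g x) * ?p x"
  let ?A2 = "\<lambda>g x. ?q2 g x - ?s2 (\<phi> g x) * ?p x"
  have d0: "diam > 0" by (rule diam)
  have mV: "indicator V \<in> borel_measurable (completion \<mu>)" "\<And>x. \<bar>indicator V x :: real\<bar> \<le> 1"
    using borel_events[OF V] by (auto simp: indicator_def)
  have m1: "dfun j \<in> borel_measurable (completion \<mu>)" by (rule borel_measurable_M[OF dfun_borel])
  have m2: "(\<lambda>x. (dfun j x)\<^sup>2) \<in> borel_measurable (completion \<mu>)" using m1 by measurable
  have p1: "AE x in completion \<mu>. \<bar>?p x\<bar> \<le> 1" by (rule condE_bounded[OF mV])
  have bnd: "AE x in completion \<mu>. \<bar>?p x\<bar> \<le> 1 \<and> \<bar>?q1 g x\<bar> \<le> diam \<and> \<bar>?q2 g x\<bar> \<le> diam\<^sup>2 \<and>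
      \<bar>?s1 (\<phi> g x)\<bar> \<le> diam \<and> \<bar>?s2 (\<phi> g x)\<bar> \<le> diam\<^sup>2"
    and Ameas: "?A1 g \<in> borel_measurable (completion \<mu>)" "?A2 g \<in> borel_measurable (completion \<mu>)"
    if g: "g \<in> carrier G" for g
  proof -
    have mg: "(\<lambda>x. dfun j (\<phi> g x)) \<in> borel_measurable (completion \<mu>)"
      by (rule measurable_compose[OF action_measurable[OF g] m1])
    have "AE x in completion \<mu>. \<bar>?q1 g x\<bar> \<le> diam"
    proof (rule condE_bounded)
      show "(\<lambda>x. dfun j (\<phi> g x) * indicator V x) \<in> borel_measurable (completion \<mu>)" using mg mV(1) by measurable
      show "\<bar>dfun j (\<phi> g x) * indicator V x\<bar> \<le> diam" for x
        using dfun_bound[of j "\<phi> g x"] d0 by (auto simp: indicator_def)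
    qed
    moreover have "AE x in completion \<mu>. \<bar>?q2 g x\<bar> \<le> diam\<^sup>2"
    proof (rule condE_bounded)
      show "(\<lambda>x. (dfun j (\<phi> g x))\<^sup>2 * indicator V x) \<in> borel_measurable (completion \<mu>)" using mg mV(1) by measurable
      show "\<bar>(dfun j (\<phi> g x))\<^sup>2 * indicator V x\<bar> \<le> diam\<^sup>2" for x
        using dfun2_bound[of j "\<phi> g x"] d0 by (auto simp: indicator_def)
    qed
    moreover have "AE x in completion \<mu>. \<bar>?s1 (\<phi> g x)\<bar> \<le> diam"
      by (rule action_AE[OF g condE_bounded[OF m1 dfun_bound]])
    moreover have "AE x in completion \<mu>. \<bar>?s2 (\<phi> g x)\<bar> \<le> diam\<^sup>2"
      by (rule action_AE[OF g condE_bounded[OF m2 dfun2_bound]])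
    ultimately show "AE x in completion \<mu>. \<bar>?p x\<bar> \<le> 1 \<and> \<bar>?q1 g x\<bar> \<le> diam \<and> \<bar>?q2 g x\<bar> \<le> diam\<^sup>2 \<and>
      \<bar>?s1 (\<phi> g x)\<bar> \<le> diam \<and> \<bar>?s2 (\<phi> g x)\<bar> \<le> diam\<^sup>2"
      using p1 by eventually_elim blast
    have "(\<lambda>x. ?s1 (\<phi> g x)) \<in> borel_measurable (completion \<mu>)" "(\<lambda>x. ?s2 (\<phi> g x)) \<in> borel_measurable (completion \<mu>)"
      by (rule measurable_compose[OF action_measurable[OF g] condE_measurable(2)])+
    then show "?A1 g \<in> borel_measurable (completion \<mu>)" "?A2 g \<in> borel_measurable (completion \<mu>)"
      using condE_measurable(2) by measurable
  qed
  have Ab: "AE x in completion \<mu>. \<bar>?A1 g x\<bar> \<le> 2 * diam \<and> \<bar>?A2 g x\<bar> \<le> 2 * diam\<^sup>2 \<and>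
      \<bar>defect j V g x\<bar> \<le> \<bar>?A2 g x\<bar> + 2 * diam * \<bar>?A1 g x\<bar>" if g: "g \<in> carrier G" for g
    using bnd[OF g]
  proof eventually_elim
    case (elim x)
    define p q1 q2 s1 s2 where "p = ?p x" "q1 = ?q1 g x" "q2 = ?q2 g x" "s1 = ?s1 (\<phi> g x)" "s2 = ?s2 (\<phi> g x)"
    note d = p_q1_q2_s1_s2_def
    have b: "\<bar>p\<bar> \<le> 1" "\<bar>q1\<bar> \<le> diam" "\<bar>q2\<bar> \<le> diam\<^sup>2" "\<bar>s1\<bar> \<le> diam" "\<bar>s2\<bar> \<le> diam\<^sup>2" using elim by (auto simp: d)
    have s1p: "\<bar>s1 * p\<bar> \<le> diam" using mult_mono[OF b(4) b(1)] d0 by (simp add: abs_mult)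
    have s2p: "\<bar>s2 * p\<bar> \<le> diam\<^sup>2" using mult_mono[OF b(5) b(1)] d0 by (simp add: abs_mult)
    have "defect j V g x = p * (q2 - s2 * p) - (q1 - s1 * p) * (q1 + s1 * p)"
      unfolding defect_def spread_def cvar_def d by (simp add: power2_eq_square algebra_simps)
    then have "\<bar>defect j V g x\<bar> \<le> \<bar>p\<bar> * \<bar>q2 - s2 * p\<bar> + \<bar>q1 - s1 * p\<bar> * \<bar>q1 + s1 * p\<bar>"
      using abs_triangle_ineq4[of "p * (q2 - s2 * p)" "(q1 - s1 * p) * (q1 + s1 * p)"] by (simp add: abs_mult)
    also have "\<bar>p\<bar> * \<bar>q2 - s2 * p\<bar> \<le> \<bar>q2 - s2 * p\<bar>" using mult_right_mono[OF b(1), of "\<bar>q2 - s2 * p\<bar>"] by simp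
    also have "\<bar>q1 - s1 * p\<bar> * \<bar>q1 + s1 * p\<bar> \<le> \<bar>q1 - s1 * p\<bar> * (2 * diam)"
      using b(2) s1p by (intro mult_left_mono) auto
    finally have "\<bar>defect j V g x\<bar> \<le> \<bar>q2 - s2 * p\<bar> + 2 * diam * \<bar>q1 - s1 * p\<bar>" by (simp add: mult.commute)
    moreover have "\<bar>q1 - s1 * p\<bar> \<le> 2 * diam" using b(2) s1p by linarith
    moreover have "\<bar>q2 - s2 * p\<bar> \<le> 2 * diam\<^sup>2" using b(3) s2p by linarith
    ultimately show ?case unfolding d by blast
  qed
  have iA1: "integrable (completion \<mu>) (?A1 g)" if g: "g \<in> carrier G" for g
    by (rule integrable_const_bound[of _ "2 * diam"]) (use Ab[OF g] Ameas[OF g] in auto)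
  have iA2: "integrable (completion \<mu>) (?A2 g)" if g: "g \<in> carrier G" for g
    by (rule integrable_const_bound[of _ "2 * diam\<^sup>2"]) (use Ab[OF g] Ameas[OF g] in auto)
  have iD: "integrable (completion \<mu>) (defect j V g)" if g: "g \<in> carrier G" for g
  proof (rule Bochner_Integration.integrable_bound[OF _ defect_measurable[OF g]])
    show "integrable (completion \<mu>) (\<lambda>x. \<bar>?A2 g x\<bar> + 2 * diam * \<bar>?A1 g x\<bar>)" using iA1[OF g] iA2[OF g] by simp
    show "AE x in completion \<mu>. norm (defect j V g x) \<le> norm (\<bar>?A2 g x\<bar> + 2 * diam * \<bar>?A1 g x\<bar>)"
      using Ab[OF g] by eventually_elim auto
  qed
  then show "g \<in> carrier G \<Longrightarrow> integrable (completion \<mu>) (defect j V g)" .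
  have le: "expectation (\<lambda>x. \<bar>defect j V g x\<bar>) \<le> expectation (\<lambda>x. \<bar>?A2 g x\<bar>) + 2 * diam * expectation (\<lambda>x. \<bar>?A1 g x\<bar>)"
    if g: "g \<in> carrier G" for g
  proof -
    have "expectation (\<lambda>x. \<bar>defect j V g x\<bar>) \<le> expectation (\<lambda>x. \<bar>?A2 g x\<bar> + 2 * diam * \<bar>?A1 g x\<bar>)"
    proof (rule integral_mono_AE)
      show "AE x in completion \<mu>. \<bar>defect j V g x\<bar> \<le> \<bar>?A2 g x\<bar> + 2 * diam * \<bar>?A1 g x\<bar>"
        using Ab[OF g] by eventually_elim simp
    qed (use iD[OF g] iA1[OF g] iA2[OF g] in auto)
    then show ?thesis using iA1[OF g] iA2[OF g] by simp
  qed
  show "expectation (\<lambda>x. \<bar>defect j V g x\<bar>) \<le> 6 * diam\<^sup>2" if g: "g \<in> carrier G"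
  proof -
    have "expectation (\<lambda>x. \<bar>?A2 g x\<bar>) \<le> expectation (\<lambda>x. 2 * diam\<^sup>2)"
      by (rule integral_mono_AE) (use Ab[OF g] iA2[OF g] in auto)
    then have 1: "expectation (\<lambda>x. \<bar>?A2 g x\<bar>) \<le> 2 * diam\<^sup>2" using prob_space by simp
    have "expectation (\<lambda>x. \<bar>?A1 g x\<bar>) \<le> expectation (\<lambda>x. 2 * diam)"
      by (rule integral_mono_AE) (use Ab[OF g] iA1[OF g] in auto)
    then have "2 * diam * expectation (\<lambda>x. \<bar>?A1 g x\<bar>) \<le> 2 * diam * (2 * diam)"
      using prob_space d0 by (intro mult_left_mono) auto
    then show ?thesis using le[OF g] 1 by (simp add: power2_eq_square)
  qed
  show "finite {g \<in> carrier G. expectation (\<lambda>x. \<bar>defect j V g x\<bar>) > \<epsilon>}" if \<epsilon>: "\<epsilon> > 0"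
  proof (rule finite_subset)
    show "{g \<in> carrier G. expectation (\<lambda>x. \<bar>defect j V g x\<bar>) > \<epsilon>} \<subseteq>
      {g \<in> carrier G. expectation (\<lambda>x. \<bar>?A1 g x\<bar>) > \<epsilon> / (4 * diam)} \<union>
      {g \<in> carrier G. expectation (\<lambda>x. \<bar>?A2 g x\<bar>) > \<epsilon> / 2}"
    proof
      fix g assume "g \<in> {g \<in> carrier G. expectation (\<lambda>x. \<bar>defect j V g x\<bar>) > \<epsilon>}"
      then have g: "g \<in> carrier G" "expectation (\<lambda>x. \<bar>defect j V g x\<bar>) > \<epsilon>" by auto
      show "g \<in> {g \<in> carrier G. expectation (\<lambda>x. \<bar>?A1 g x\<bar>) > \<epsilon> / (4 * diam)} \<union>
        {g \<in> carrier G. expectation (\<lambda>x. \<bar>?A2 g x\<bar>) > \<epsilon> / 2}"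
      proof (rule ccontr)
        assume "\<not> ?thesis"
        then have 1: "expectation (\<lambda>x. \<bar>?A1 g x\<bar>) \<le> \<epsilon> / (4 * diam)" and 2: "expectation (\<lambda>x. \<bar>?A2 g x\<bar>) \<le> \<epsilon> / 2"
          using g by auto
        have "2 * diam * expectation (\<lambda>x. \<bar>?A1 g x\<bar>) \<le> 2 * diam * (\<epsilon> / (4 * diam))"
          using 1 d0 by (intro mult_left_mono) auto
        also have "\<dots> = \<epsilon> / 2" using d0 by simp
        finally show False using le[OF g(1)] g(2) 2 by linarith
      qed
    qed
    show "finite ({g \<in> carrier G. expectation (\<lambda>x. \<bar>?A1 g x\<bar>) > \<epsilon> / (4 * diam)} \<union>
      {g \<in> carrier G. expectation (\<lambda>x. \<bar>?A2 g x\<bar>) > \<epsilon> / 2})"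
    proof (rule finite_UnI)
      show "finite {g \<in> carrier G. expectation (\<lambda>x. \<bar>?A1 g x\<bar>) > \<epsilon> / (4 * diam)}"
        by (rule relative_mixing[OF m1 dfun_bound mV]) (use \<epsilon> d0 in simp)
      show "finite {g \<in> carrier G. expectation (\<lambda>x. \<bar>?A2 g x\<bar>) > \<epsilon> / 2}"
        by (rule relative_mixing[OF m2 dfun2_bound mV]) (use \<epsilon> in simp)
    qed
  qed
qed

lemma defect_cesaro_subsequence:
  fixes V :: "nat \<Rightarrow> 'x set" and H :: "nat \<Rightarrow> 'g set"
  assumes V: "\<And>i. V i \<in> sets borel"
    and H: "\<And>n. finite (H n)" "\<And>n. H n \<noteq> {}" "\<And>n. H n \<subseteq> carrier G" "filterlim (\<lambda>n. card (H n)) at_top sequentially"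
  obtains r :: "nat \<Rightarrow> nat" where "strict_mono r"
    "AE x in completion \<mu>. \<forall>i j. (\<lambda>n. (\<Sum>g\<in>H (r n). defect j (V i) g x) / card (H (r n))) \<longlonglongrightarrow> 0"
proof -
  define w where "w k n x = (\<Sum>g\<in>H n. defect (snd (prod_decode k)) (V (fst (prod_decode k))) g x) / card (H n)" for k n x
  have int: "integrable (completion \<mu>) (w k n)" for k n
  proof -
    have "integrable (completion \<mu>) (defect (snd (prod_decode k)) (V (fst (prod_decode k))) g)" if "g \<in> H n" for g
      using defect_L1(1)[OF V] H(3)[of n] that by blast
    then show ?thesis unfolding w_def by simp
  qed
  have lim: "(\<lambda>n. expectation (\<lambda>x. \<bar>w k n x\<bar>)) \<longlonglongrightarrow> 0" for k
  proof (rule tendsto_sandwich[OF _ _ tendsto_const])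
    let ?d = "\<lambda>g. expectation (\<lambda>x. \<bar>defect (snd (prod_decode k)) (V (fst (prod_decode k))) g x\<bar>)"
    show "(\<lambda>n. (\<Sum>g\<in>H n. ?d g) / card (H n)) \<longlonglongrightarrow> 0"
      by (rule cesaro_vanishing_off_finite[of "carrier G" _ "6 * diam\<^sup>2"])
         (use H defect_L1(2,3)[OF V] in \<open>auto intro!: integral_nonneg_AE\<close>)
    have "expectation (\<lambda>x. \<bar>w k n x\<bar>) \<le> (\<Sum>g\<in>H n. ?d g) / card (H n)" for n
    proof -
      have i: "integrable (completion \<mu>) (defect (snd (prod_decode k)) (V (fst (prod_decode k))) g)" if "g \<in> H n" for g
        using defect_L1(1)[OF V] H(3)[of n] that by auto
      have "expectation (\<lambda>x. \<bar>w k n x\<bar>) \<le> expectation (\<lambda>x. (\<Sum>g\<in>H n. \<bar>defect (snd (prod_decode k)) (V (fst (prod_decode k))) g x\<bar>) / card (H n))"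
      proof (rule integral_mono)
        show "\<bar>w k n x\<bar> \<le> (\<Sum>g\<in>H n. \<bar>defect (snd (prod_decode k)) (V (fst (prod_decode k))) g x\<bar>) / card (H n)" for x
          unfolding w_def by (simp add: divide_right_mono sum_abs)
      qed (use int i in auto)
      also have "\<dots> = (\<Sum>g\<in>H n. ?d g) / card (H n)"
        using i by simp
      finally show ?thesis .
    qed
    then show "\<forall>\<^sub>F n in sequentially. expectation (\<lambda>x. \<bar>w k n x\<bar>) \<le> (\<Sum>g\<in>H n. ?d g) / card (H n)" by simp
  qed (auto intro!: always_eventually integral_nonneg_AE)
  obtain r :: "nat \<Rightarrow> nat" where r: "strict_mono r" "AE x in completion \<mu>. \<forall>k. (\<lambda>n. w k (r n) x) \<longlonglongrightarrow> 0"
    using L1_null_sequences_common_AE_subseq[of "completion \<mu>" w, OF int lim] by blast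
  show ?thesis
  proof (rule that[OF r(1)])
    show "AE x in completion \<mu>. \<forall>i j. (\<lambda>n. (\<Sum>g\<in>H (r n). defect j (V i) g x) / card (H (r n))) \<longlonglongrightarrow> 0"
      using r(2)
    proof eventually_elim
      case (elim x)
      show ?case
      proof (intro allI)
        fix i j
        show "(\<lambda>n. (\<Sum>g\<in>H (r n). defect j (V i) g x) / card (H (r n))) \<longlonglongrightarrow> 0"
          using elim[rule_format, of "prod_encode (i, j)"] by (simp add: w_def)
      qed
    qed
  qed
qed

text \<open>Let \<open>B J\<close> be the set where the first \<open>J\<close> conditional variances have a sum of at most \<open>1 / Suc J\<close>; its
  measure tends to that of the degenerate points, which is \<open>0\<close>. By Markov's inequality the points whose
  orbit pieces spend at least half of the time in \<open>B J\<close>, for all large \<open>n\<close>, form a set \<open>N J\<close> of measure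
  at most \<open>2 * prob (B J)\<close>. Outside \<open>N J\<close> the sum of the first \<open>J\<close> variances has large averages
  infinitely often, and so has one of them by the pigeonhole principle.\<close>

lemma AE_frequent_variance:
  fixes H :: "nat \<Rightarrow> 'g set"
  assumes H: "\<And>n. finite (H n)" "\<And>n. H n \<noteq> {}" "\<And>n. H n \<subseteq> carrier G"
  shows "AE x in completion \<mu>. \<exists>j. \<exists>\<eta>>0. \<exists>\<^sub>F n in sequentially. \<eta> \<le> (\<Sum>g\<in>H n. cvar j (\<phi> g x)) / card (H n)"
proof -
  \<comment> \<open>\<open>cvar j\<close> is nonnegative only almost everywhere; after truncation the sets \<open>B J\<close> decrease\<close>
  define cv where "cv j x = max 0 (cvar j x)" for j x
  have cv_meas: "cv j \<in> borel_measurable (completion \<mu>)" for j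
    unfolding cv_def using measurable_pinsker_imp[OF cvar_measurable] by measurable
  define B where "B J = {x. (\<Sum>j<J. cv j x) \<le> 1 / real (Suc J)}" for J
  have B: "B J \<in> events" for J
  proof -
    have "{x \<in> space (completion \<mu>). (\<Sum>j<J. cv j x) \<le> 1 / real (Suc J)} \<in> events"
      using cv_meas by measurable
    then show ?thesis by (simp add: B_def)
  qed
  have Blim: "(\<lambda>J. prob (B J)) \<longlonglongrightarrow> 0"
  proof -
    have "(\<lambda>J. prob (B J)) \<longlonglongrightarrow> prob (\<Inter>J. B J)"
    proof (rule finite_Lim_measure_decseq)
      show "range B \<subseteq> events" using B by auto
      show "decseq B"
        unfolding decseq_Suc_iff
      proof (intro allI subsetI)
        fix J x assume "x \<in> B (Suc J)"
        then have "(\<Sum>j<Suc J. cv j x) \<le> 1 / real (Suc (Suc J))" unfolding B_def by blast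
        moreover have "(\<Sum>j<J. cv j x) \<le> (\<Sum>j<Suc J. cv j x)" by (simp add: cv_def)
        moreover have "1 / real (Suc (Suc J)) \<le> 1 / real (Suc J)" by (intro divide_left_mono) auto
        ultimately have "(\<Sum>j<J. cv j x) \<le> 1 / real (Suc J)" by linarith
        then show "x \<in> B J" unfolding B_def by blast
      qed
    qed
    moreover have "(\<Inter>J. B J) \<subseteq> degenerate"
    proof
      fix x assume x: "x \<in> (\<Inter>J. B J)"
      show "x \<in> degenerate"
        unfolding degenerate_def
      proof (intro CollectI allI)
        fix j
        show "cvar j x \<le> 0"
        proof (rule ccontr)
          assume "\<not> ?thesis"
          then have pos: "cvar j x > 0" by simp
          then obtain n where n: "1 / real (Suc n) < cvar j x" using nat_approx_posE by blast
          define J where "J = Suc (max n j)"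
          have "cvar j x \<le> cv j x" by (simp add: cv_def)
          also have "cv j x \<le> (\<Sum>j<J. cv j x)"
            by (rule member_le_sum) (auto simp: J_def cv_def)
          also have "\<dots> \<le> 1 / real (Suc J)" using x unfolding B_def by blast
          also have "\<dots> \<le> 1 / real (Suc n)" by (intro divide_left_mono) (auto simp: J_def)
          finally show False using n by simp
        qed
      qed
    qed
    then have "prob (\<Inter>J. B J) \<le> prob degenerate" by (rule finite_measure_mono[OF _ degenerate_events])
    moreover have "prob degenerate = 0" using degenerate_0_1 not_all_degenerate by auto
    ultimately show ?thesis using measure_nonneg[of "completion \<mu>" "\<Inter>J. B J"]
      by (metis order_antisym)
  qed
  define D where "D J n = {x. real (card (H n)) \<le> 2 * (\<Sum>g\<in>H n. indicator (B J) (\<phi> g x))}" for J n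
  have ind_meas: "(\<lambda>x. indicator (B J) (\<phi> g x) :: real) \<in> borel_measurable (completion \<mu>)" if "g \<in> carrier G" for J g
    by (rule measurable_compose[OF action_measurable[OF that]]) (use B in measurable)
  have sum_meas: "(\<lambda>x. \<Sum>g\<in>H n. indicator (B J) (\<phi> g x) :: real) \<in> borel_measurable (completion \<mu>)" for J n
  proof (rule borel_measurable_sum)
    fix g assume "g \<in> H n"
    then show "(\<lambda>x. indicator (B J) (\<phi> g x) :: real) \<in> borel_measurable (completion \<mu>)"
      using H(3)[of n] by (intro ind_meas) auto
  qed
  have D: "D J n \<in> events" for J n
  proof -
    have "{x \<in> space (completion \<mu>). real (card (H n)) \<le> 2 * (\<Sum>g\<in>H n. indicator (B J) (\<phi> g x))} \<in> events"
      using sum_meas by measurable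
    then show ?thesis by (simp add: D_def)
  qed
  have Dle: "prob (D J n) \<le> 2 * prob (B J)" for J n
  proof -
    have c: "real (card (H n)) > 0" using H by (simp add: card_gt_0_iff)
    let ?s = "\<lambda>x. \<Sum>g\<in>H n. indicator (B J) (\<phi> g x) :: real"
    have ii: "integrable (completion \<mu>) (\<lambda>x. indicator (B J) (\<phi> g x) :: real)" if "g \<in> H n" for g
      by (rule integrable_bounded[OF ind_meas, of _ _ 1]) (use that H in \<open>auto simp: indicator_def\<close>)
    then have si: "integrable (completion \<mu>) ?s" by auto
    have "expectation ?s = (\<Sum>g\<in>H n. expectation (\<lambda>x. indicator (B J) (\<phi> g x)))"
      by (rule Bochner_Integration.integral_sum) (rule ii)
    also have "\<dots> = (\<Sum>g\<in>H n. prob (B J))"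
    proof (rule sum.cong[OF refl])
      fix g assume "g \<in> H n"
      then have g: "g \<in> carrier G" using H by auto
      show "expectation (\<lambda>x. indicator (B J) (\<phi> g x)) = prob (B J)"
        using action_integral[OF g, of "indicator (B J)"] B by simp
    qed
    finally have e: "expectation ?s = card (H n) * prob (B J)" by simp
    have "prob {x. \<bar>?s x\<bar> \<ge> card (H n) / 2} \<le> (card (H n) * prob (B J)) / (card (H n) / 2)"
    proof (rule markov_abs[OF si])
      have "\<bar>?s x\<bar> = ?s x" for x by (simp add: sum_nonneg)
      then show "expectation (\<lambda>x. \<bar>?s x\<bar>) \<le> card (H n) * prob (B J)" using e by simp
    qed (use c in simp)
    also have "\<dots> = 2 * prob (B J)" using c by simp
    also have "{x. \<bar>?s x\<bar> \<ge> card (H n) / 2} = D J n"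
    proof -
      have "\<bar>?s x\<bar> = ?s x" for x by (simp add: sum_nonneg)
      then show ?thesis by (auto simp: D_def)
    qed
    finally show ?thesis .
  qed
  define N where "N J = (\<Union>m. \<Inter>n\<in>{m..}. D J n)" for J
  have N: "N J \<in> events" for J unfolding N_def using D by (intro sets.countable_UN' sets.countable_INT') auto
  have Nle: "prob (N J) \<le> 2 * prob (B J)" for J
  proof -
    let ?E = "\<lambda>m. \<Inter>n\<in>{m..}. D J n"
    have E: "?E m \<in> events" for m using D by (intro sets.countable_INT') auto
    have "(\<lambda>m. prob (?E m)) \<longlonglongrightarrow> prob (\<Union>m. ?E m)"
      by (rule finite_Lim_measure_incseq) (use E in \<open>auto simp: incseq_def\<close>)
    then show ?thesis
      unfolding N_def
    proof (rule LIMSEQ_le_const2)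
      have "prob (?E m) \<le> prob (D J m)" for m by (rule finite_measure_mono[OF _ D]) auto
      then show "\<exists>M. \<forall>n\<ge>M. prob (?E n) \<le> 2 * prob (B J)" using Dle order_trans by blast
    qed
  qed
  have NI: "(\<Inter>J. N J) \<in> events" using N by auto
  have "prob (\<Inter>J. N J) \<le> 2 * prob (B J)" for J
    using finite_measure_mono[of "\<Inter>J. N J" "N J", OF _ N] Nle[of J] by (meson INT_lower UNIV_I order_trans)
  moreover have "(\<lambda>J. 2 * prob (B J)) \<longlonglongrightarrow> 2 * 0" by (intro tendsto_intros Blim)
  ultimately have "prob (\<Inter>J. N J) \<le> 0" by (intro LIMSEQ_le_const[where X = "\<lambda>J. 2 * prob (B J)"]) auto
  then have "prob (\<Inter>J. N J) = 0" by (rule order_antisym[OF _ measure_nonneg])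
  then have ae1: "AE x in completion \<mu>. x \<notin> (\<Inter>J. N J)" using prob_eq_0[OF NI] by simp
  have ae2: "AE x in completion \<mu>. \<forall>g\<in>carrier G. \<forall>j. cvar j (\<phi> g x) \<ge> 0"
    unfolding AE_ball_countable[OF countable_carrier] using action_AE[OF _ AE_cvar_nonneg] by blast
  from ae1 ae2 show ?thesis
  proof eventually_elim
    case (elim x)
    then obtain J where J: "x \<notin> N J" by auto
    have cvx: "cv j (\<phi> g x) = cvar j (\<phi> g x)" if "g \<in> H n" for g n j
      using elim(2) H(3)[of n] that by (auto simp: cv_def)
    have fr: "\<exists>\<^sub>F n in sequentially. x \<notin> D J n"
      using J unfolding N_def frequently_sequentially by auto
    define \<eta> where "\<eta> = 1 / (2 * real (Suc J) * real (Suc J))"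
    have \<eta>: "\<eta> > 0" by (simp add: \<eta>_def)
    have step: "\<exists>j\<in>{..<J}. \<eta> \<le> (\<Sum>g\<in>H n. cvar j (\<phi> g x)) / card (H n)" if n: "x \<notin> D J n" for n
    proof (rule ccontr)
      assume "\<not> ?thesis"
      then have small: "(\<Sum>g\<in>H n. cvar j (\<phi> g x)) / card (H n) < \<eta>" if "j < J" for j
        using that by (metis lessThan_iff not_le)
      have c: "real (card (H n)) > 0" using H by (simp add: card_gt_0_iff)
      have ge: "(1 - indicator (B J) (\<phi> g x)) / real (Suc J) \<le> (\<Sum>j<J. cvar j (\<phi> g x))" if "g \<in> H n" for g
      proof (cases "\<phi> g x \<in> B J")
        case True
        have "0 \<le> (\<Sum>j<J. cvar j (\<phi> g x))" by (intro sum_nonneg) (use elim(2) H(3)[of n] that in auto)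
        then show ?thesis using True by simp
      next
        case False
        then show ?thesis using cvx[OF that] by (simp add: B_def)
      qed
      have "card (H n) / 2 < (\<Sum>g\<in>H n. 1 - indicator (B J) (\<phi> g x))"
        using n by (simp add: D_def sum_subtractf)
      then have "card (H n) / 2 / real (Suc J) < (\<Sum>g\<in>H n. 1 - indicator (B J) (\<phi> g x)) / real (Suc J)"
        by (rule divide_strict_right_mono) simp
      also have "\<dots> = (\<Sum>g\<in>H n. (1 - indicator (B J) (\<phi> g x)) / real (Suc J))" by (simp add: sum_divide_distrib)
      also have "\<dots> \<le> (\<Sum>g\<in>H n. \<Sum>j<J. cvar j (\<phi> g x))" by (rule sum_mono) (rule ge)
      also have "\<dots> = (\<Sum>j<J. \<Sum>g\<in>H n. cvar j (\<phi> g x))" by (rule sum.swap)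
      also have "\<dots> \<le> (\<Sum>j<J. \<eta> * card (H n))"
      proof (rule sum_mono)
        fix j assume "j \<in> {..<J}"
        then have "(\<Sum>g\<in>H n. cvar j (\<phi> g x)) / card (H n) < \<eta>" using small by simp
        then show "(\<Sum>g\<in>H n. cvar j (\<phi> g x)) \<le> \<eta> * card (H n)" using c by (simp add: pos_divide_less_eq)
      qed
      also have "\<dots> \<le> real (Suc J) * (\<eta> * card (H n))" using \<eta> by (simp add: mult_right_mono)
      also have "\<dots> = card (H n) / 2 / real (Suc J)" by (simp add: \<eta>_def)
      finally show False by simp
    qed
    have "\<exists>j\<in>{..<J}. \<exists>\<^sub>F n in sequentially. \<eta> \<le> (\<Sum>g\<in>H n. cvar j (\<phi> g x)) / card (H n)"
    proof (rule ccontr)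
      assume "\<not> ?thesis"
      then have "\<forall>j\<in>{..<J}. \<forall>\<^sub>F n in sequentially. \<not> \<eta> \<le> (\<Sum>g\<in>H n. cvar j (\<phi> g x)) / card (H n)"
        by (simp add: frequently_def)
      then have "\<forall>\<^sub>F n in sequentially. \<forall>j\<in>{..<J}. \<not> \<eta> \<le> (\<Sum>g\<in>H n. cvar j (\<phi> g x)) / card (H n)"
        by (rule eventually_ball_finite[OF finite_lessThan])
      then have "\<forall>\<^sub>F n in sequentially. \<not> x \<notin> D J n"
        by eventually_elim (use step in blast)
      then show False using fr by (simp add: frequently_def)
    qed
    then show ?case using \<eta> by blast
  qed
qed

end

section \<open>Mean scrambled sets in the supports of the fibre measures\<close>

lemma mean_dist_nonneg: "0 \<le> mean_dist \<phi> F x y"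
  unfolding mean_dist_def by (intro divide_nonneg_nonneg sum_nonneg) auto

lemma mean_dist_self: "mean_dist \<phi> F x x = 0"
  unfolding mean_dist_def by simp

lemma mean_dist_commute: "mean_dist \<phi> F x y = mean_dist \<phi> F y x"
  unfolding mean_dist_def by (simp add: dist_commute)

lemma mean_dist_triangle: "mean_dist \<phi> F x z \<le> mean_dist \<phi> F x y + mean_dist \<phi> F y z"
  unfolding mean_dist_def add_divide_distrib[symmetric] sum.distrib[symmetric]
  by (intro divide_right_mono sum_mono dist_triangle) auto

lemma closed_supp: "closed (supp \<nu>)"
  unfolding supp_def by (rule closed_Inter) auto

lemma supp_disjoint_null:
  assumes "open V" "AE y in \<nu>. y \<notin> V"
  shows "V \<inter> supp \<nu> = {}"
proof -
  have "closed (- V)" "AE y in \<nu>. y \<in> - V" using assms by auto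
  then have "supp \<nu> \<subseteq> - V" unfolding supp_def by blast
  then show ?thesis by auto
qed

context pinsker_disintegration
begin

text \<open>The complement of the support is a union of null open sets, and countably many members of the base
  suffice for it.\<close>

lemma AE_supp_kernel: "AE y in \<kappa> x. y \<in> supp (\<kappa> x)"
proof -
  obtain V :: "nat \<Rightarrow> 'x set" where V:
    "\<And>U x. open U \<Longrightarrow> x \<in> U \<Longrightarrow> x \<in> UNIV \<Longrightarrow> \<exists>i. x \<in> V i \<and> V i \<subseteq> U"
    using compact_countable_pseudobase[OF compact_UNIV UNIV_not_empty] by metis
  have "AE y in \<kappa> x. \<forall>i. (AE z in \<kappa> x. z \<notin> V i) \<longrightarrow> y \<notin> V i"
    unfolding AE_all_countable
  proof
    fix i
    show "AE y in \<kappa> x. (AE z in \<kappa> x. z \<notin> V i) \<longrightarrow> y \<notin> V i"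
      by (cases "AE z in \<kappa> x. z \<notin> V i") auto
  qed
  then show ?thesis
  proof eventually_elim
    case (elim y)
    show ?case
      unfolding supp_def
    proof (rule InterI)
      fix C assume "C \<in> {C. closed C \<and> (AE z in \<kappa> x. z \<in> C)}"
      then have C: "closed C" "AE z in \<kappa> x. z \<in> C" by auto
      show "y \<in> C"
      proof (rule ccontr)
        assume "y \<notin> C"
        then obtain i where i: "y \<in> V i" "V i \<subseteq> - C" using V[of "- C" y] C(1) by auto
        have "AE z in \<kappa> x. z \<notin> V i" using C(2) by eventually_elim (use i in auto)
        then show False using elim i by blast
      qed
    qed
  qed
qed

lemma supp_kernel_nonempty: "supp (\<kappa> x) \<noteq> {}"
proof -
  interpret k: prob_space "\<kappa> x" by (rule kernel_prob)
  show ?thesis using k.AE_ex[OF AE_supp_kernel] by auto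
qed

lemma mean_dist_continuous:
  assumes F: "finite F" "F \<subseteq> carrier G"
  shows "continuous_on UNIV (\<lambda>p. mean_dist \<phi> F (fst p) (snd p))"
proof -
  have "continuous_on UNIV (\<lambda>p. dist (\<phi> g (fst p)) (\<phi> g (snd p)))" if "g \<in> F" for g
  proof -
    have g: "continuous_on UNIV (\<phi> g)" using continuous_action that F by auto
    have "continuous_on UNIV (\<lambda>p :: 'x \<times> 'x. \<phi> g (fst p))" "continuous_on UNIV (\<lambda>p :: 'x \<times> 'x. \<phi> g (snd p))"
      by (auto intro!: continuous_on_compose2[OF g] continuous_intros)
    then show ?thesis by (intro continuous_intros)
  qed
  then show ?thesis unfolding mean_dist_def divide_inverse
    by (intro continuous_on_mult continuous_on_sum continuous_on_const)
qed

lemma mean_dist_borel: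
  assumes F: "finite F" "F \<subseteq> carrier G"
  shows "mean_dist \<phi> F x \<in> borel_measurable borel"
proof -
  have "continuous_on UNIV (\<lambda>y. (x, y) :: 'x \<times> 'x)" by (intro continuous_intros)
  then have "continuous_on UNIV (\<lambda>y. mean_dist \<phi> F (fst (x, y)) (snd (x, y)))"
    by (rule continuous_on_compose2[OF mean_dist_continuous[OF F]]) auto
  then show ?thesis by (intro borel_measurable_continuous_onI) simp
qed

lemma mean_dist_le_diam: "mean_dist \<phi> F x y \<le> diam"
proof (cases "card F = 0")
  case True then show ?thesis using diam(1) by (auto simp: mean_dist_def)
next
  case False
  have "(\<Sum>g\<in>F. dist (\<phi> g x) (\<phi> g y)) \<le> (\<Sum>g\<in>F. diam)" by (rule sum_mono) (rule diam)
  then show ?thesis using False by (simp add: mean_dist_def pos_divide_le_eq mult.commute)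
qed

text \<open>The spread is \<open>P * a - b\<^sup>2\<close>, where replacing the mean by the constant \<open>c = dfun j (\<phi> g x)\<close> only
  increases the quadratic expression. So the second point of the pair may be taken to be \<open>x\<close>, and
  \<open>(dfun j (\<phi> g y) - c)\<^sup>2 \<le> diam * dist (\<phi> g x) (\<phi> g y)\<close>.\<close>

lemma spread_le:
  assumes V: "V \<in> sets borel" and g: "g \<in> carrier G"
    and p: "condE (indicator V) x = (\<integral>y. indicator V y \<partial>\<kappa> x)"
    and q1: "condE (\<lambda>x. dfun j (\<phi> g x) * indicator V x) x = (\<integral>y. dfun j (\<phi> g y) * indicator V y \<partial>\<kappa> x)"
    and q2: "condE (\<lambda>x. (dfun j (\<phi> g x))\<^sup>2 * indicator V x) x = (\<integral>y. (dfun j (\<phi> g y))\<^sup>2 * indicator V y \<partial>\<kappa> x)"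
  shows "spread j V g x \<le> measure (\<kappa> x) V * diam * (\<integral>y. indicator V y * dist (\<phi> g x) (\<phi> g y) \<partial>\<kappa> x)"
proof -
  interpret k: prob_space "\<kappa> x" by (rule kernel_prob)
  have Vk: "V \<in> sets (\<kappa> x)" using V kernel_sets by simp
  let ?f = "\<lambda>y. dfun j (\<phi> g y)"
  let ?i = "indicator V :: 'x \<Rightarrow> real"
  define P where "P = measure (\<kappa> x) V"
  define a b c where "a = (\<integral>y. (?f y)\<^sup>2 * ?i y \<partial>\<kappa> x)" "b = (\<integral>y. ?f y * ?i y \<partial>\<kappa> x)" "c = ?f x"
  note abc = a_b_c_def
  have f_meas: "?f \<in> borel_measurable (\<kappa> x)" by (rule borel_measurable_kernel[OF dfun_action_borel[OF g]])
  have i0: "integrable (\<kappa> x) ?i" using Vk by (intro k.integrable_bounded[of _ 1]) (auto simp: indicator_def)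
  have i1: "integrable (\<kappa> x) (\<lambda>y. ?f y * ?i y)"
    by (rule k.integrable_bounded[of _ diam]) (use f_meas Vk diam in \<open>auto simp: indicator_def less_imp_le\<close>)
  have i2: "integrable (\<kappa> x) (\<lambda>y. (?f y)\<^sup>2 * ?i y)"
    by (rule k.integrable_bounded[of _ "diam\<^sup>2"]) (use f_meas Vk dfun2_bound in \<open>auto simp: indicator_def\<close>)
  have Pi: "(\<integral>y. ?i y \<partial>\<kappa> x) = P" using Vk by (simp add: P_def)
  have P0: "0 \<le> P" by (simp add: P_def)
  have dist_meas: "(\<lambda>y. dist (\<phi> g x) (\<phi> g y)) \<in> borel_measurable (\<kappa> x)"
    by (intro borel_measurable_kernel borel_measurable_continuous_onI continuous_intros continuous_action g)
  have id: "integrable (\<kappa> x) (\<lambda>y. ?i y * dist (\<phi> g x) (\<phi> g y))"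
    by (rule k.integrable_bounded[of _ diam]) (use dist_meas Vk diam in \<open>auto simp: indicator_def less_imp_le\<close>)
  have "(\<lambda>y. ?i y * (?f y - c)\<^sup>2) = (\<lambda>y. (?f y)\<^sup>2 * ?i y - (2 * c) * (?f y * ?i y) + c\<^sup>2 * ?i y)"
    by (auto simp: power2_eq_square algebra_simps)
  then have sq: "integrable (\<kappa> x) (\<lambda>y. ?i y * (?f y - c)\<^sup>2)"
    "(\<integral>y. ?i y * (?f y - c)\<^sup>2 \<partial>\<kappa> x) = a - 2 * c * b + c\<^sup>2 * P"
    using i0 i1 i2 Pi by (auto simp: abc)
  have "spread j V g x = P * a - b\<^sup>2" unfolding spread_def p q1 q2 Pi abc by simp
  also have "\<dots> \<le> P * a - b\<^sup>2 + (b - c * P)\<^sup>2" by simp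
  also have "\<dots> = P * (a - 2 * c * b + c\<^sup>2 * P)" by (simp add: power2_eq_square algebra_simps)
  also have "\<dots> = P * (\<integral>y. ?i y * (?f y - c)\<^sup>2 \<partial>\<kappa> x)" by (simp add: sq)
  also have "\<dots> \<le> P * (\<integral>y. diam * (?i y * dist (\<phi> g x) (\<phi> g y)) \<partial>\<kappa> x)"
  proof (rule mult_left_mono[OF _ P0], rule integral_mono)
    fix y
    have "\<bar>?f y - c\<bar> \<le> dist (\<phi> g x) (\<phi> g y)" unfolding abc by (metis abs_dist_diff_le dist_commute)
    then have "\<bar>?f y - c\<bar> * \<bar>?f y - c\<bar> \<le> diam * dist (\<phi> g x) (\<phi> g y)"
      by (intro mult_mono) (use diam(1) diam(2)[of "\<phi> g x" "\<phi> g y"] in auto)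
    then show "?i y * (?f y - c)\<^sup>2 \<le> diam * (?i y * dist (\<phi> g x) (\<phi> g y))"
      by (auto simp: indicator_def power2_eq_square)
  qed (use sq id in auto)
  finally show ?thesis by (simp add: P_def)
qed

text \<open>Suppose that all points of \<open>V i\<close> in the support have mean distance to \<open>x\<close> at most \<open>\<delta>\<close> eventually.
  By dominated convergence, the integral over \<open>V i\<close> of the mean distance is eventually at most about
  \<open>P * \<delta>\<close>, where \<open>P\<close> is the measure of \<open>V i\<close>. By \<open>spread_le\<close> the averaged spreads are eventually at most
  about \<open>P\<^sup>2 * \<delta> * diam\<close>. But along the subsequence with vanishing averaged defects they are infinitely
  often at least about \<open>P\<^sup>2 * \<eta>\<close>. Both sides scale with \<open>P\<^sup>2\<close>, so \<open>\<delta>\<close> does not depend on \<open>i\<close>. The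
  subsequence has to serve all \<open>i\<close> and \<open>j\<close> because \<open>\<eta>\<close> depends on it.\<close>

lemma AE_far_points:
  fixes V :: "nat \<Rightarrow> 'x set" and H :: "nat \<Rightarrow> 'g set"
  assumes V: "\<And>i. open (V i)"
    and H: "\<And>n. finite (H n)" "\<And>n. H n \<noteq> {}" "\<And>n. H n \<subseteq> carrier G" "filterlim (\<lambda>n. card (H n)) at_top sequentially"
  shows "AE x in completion \<mu>. \<exists>\<delta>>0. \<forall>i. V i \<inter> supp (\<kappa> x) \<noteq> {} \<longrightarrow>
    (\<exists>z\<in>V i \<inter> supp (\<kappa> x). \<exists>\<^sub>F n in sequentially. mean_dist \<phi> (H n) x z > \<delta>)"
proof -
  have Vb: "V i \<in> sets borel" for i using V by auto
  obtain r :: "nat \<Rightarrow> nat" where r: "strict_mono r"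
    and def0: "AE x in completion \<mu>. \<forall>i j. (\<lambda>n. (\<Sum>g\<in>H (r n). defect j (V i) g x) / card (H (r n))) \<longlonglongrightarrow> 0"
    using defect_cesaro_subsequence[of V H, OF Vb H] by blast
  have freq: "AE x in completion \<mu>. \<exists>j. \<exists>\<eta>>0. \<exists>\<^sub>F n in sequentially.
      \<eta> \<le> (\<Sum>g\<in>H (r n). cvar j (\<phi> g x)) / card (H (r n))"
    by (rule AE_frequent_variance) (use H in auto)
  have kp: "AE x in completion \<mu>. \<forall>i. condE (indicator (V i)) x = (\<integral>y. indicator (V i) y \<partial>\<kappa> x)"
    unfolding AE_all_countable
    by (intro allI disintegrate[where C = 1]) (use Vb in \<open>auto simp: indicator_def\<close>)
  have kq: "AE x in completion \<mu>. \<forall>g\<in>carrier G. \<forall>i j.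
      condE (\<lambda>x. dfun j (\<phi> g x) * indicator (V i) x) x = (\<integral>y. dfun j (\<phi> g y) * indicator (V i) y \<partial>\<kappa> x) \<and>
      condE (\<lambda>x. (dfun j (\<phi> g x))\<^sup>2 * indicator (V i) x) x = (\<integral>y. (dfun j (\<phi> g y))\<^sup>2 * indicator (V i) y \<partial>\<kappa> x)"
    unfolding AE_ball_countable[OF countable_carrier] AE_all_countable
  proof (intro ballI allI)
    fix g i j assume g: "g \<in> carrier G"
    have "AE x in completion \<mu>. condE (\<lambda>x. dfun j (\<phi> g x) * indicator (V i) x) x = (\<integral>y. dfun j (\<phi> g y) * indicator (V i) y \<partial>\<kappa> x)"
      by (rule disintegrate[where C = diam]) (use dfun_action_borel[OF g] Vb diam in \<open>auto simp: indicator_def less_imp_le\<close>)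
    moreover have "AE x in completion \<mu>. condE (\<lambda>x. (dfun j (\<phi> g x))\<^sup>2 * indicator (V i) x) x = (\<integral>y. (dfun j (\<phi> g y))\<^sup>2 * indicator (V i) y \<partial>\<kappa> x)"
      by (rule disintegrate[where C = "diam\<^sup>2"]) (use dfun_action_borel[OF g] Vb dfun2_bound in \<open>auto simp: indicator_def\<close>)
    ultimately show "AE x in completion \<mu>. condE (\<lambda>x. dfun j (\<phi> g x) * indicator (V i) x) x = (\<integral>y. dfun j (\<phi> g y) * indicator (V i) y \<partial>\<kappa> x) \<and>
      condE (\<lambda>x. (dfun j (\<phi> g x))\<^sup>2 * indicator (V i) x) x = (\<integral>y. (dfun j (\<phi> g y))\<^sup>2 * indicator (V i) y \<partial>\<kappa> x)"
      by eventually_elim simp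
  qed
  from def0 freq kp kq show ?thesis
  proof eventually_elim
    case (elim x)
    note elim_def = elim(1) and elim_p = elim(3) and elim_q = elim(4)
    interpret k: prob_space "\<kappa> x" by (rule kernel_prob)
    obtain j \<eta> where \<eta>: "\<eta> > 0" and fr: "\<exists>\<^sub>F n in sequentially. \<eta> \<le> (\<Sum>g\<in>H (r n). cvar j (\<phi> g x)) / card (H (r n))"
      using elim(2) by blast
    have d0: "diam > 0" by (rule diam)
    define \<delta> where "\<delta> = \<eta> / (2 * diam)"
    have \<delta>: "\<delta> > 0" using \<eta> d0 by (simp add: \<delta>_def)
    have "\<exists>z\<in>V i \<inter> supp (\<kappa> x). \<exists>\<^sub>F n in sequentially. mean_dist \<phi> (H n) x z > \<delta>" if ne: "V i \<inter> supp (\<kappa> x) \<noteq> {}" for i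
    proof (rule ccontr)
      assume no: "\<not> ?thesis"
      have Vk: "V i \<in> sets (\<kappa> x)" using Vb kernel_sets by simp
      let ?i = "indicator (V i) :: 'x \<Rightarrow> real"
      let ?m = "\<lambda>n y. mean_dist \<phi> (H n) x y"
      define P where "P = measure (\<kappa> x) (V i)"
      have P: "P > 0"
      proof (rule ccontr)
        assume "\<not> P > 0"
        then have "P = 0" using measure_nonneg[of "\<kappa> x" "V i"] by (simp add: P_def)
        then have "AE y in \<kappa> x. y \<notin> V i" using k.prob_eq_0[OF Vk] by (simp add: P_def)
        then show False using supp_disjoint_null[OF V] ne by blast
      qed
      have m_meas: "?m n \<in> borel_measurable (\<kappa> x)" for n
        using borel_measurable_kernel[OF mean_dist_borel[OF H(1) H(3)]] .
      have mb: "\<bar>?i y * ?m n y\<bar> \<le> diam" "\<bar>?i y * max (?m n y) \<delta>\<bar> \<le> diam + \<delta>" for n y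
        using mean_dist_nonneg[of \<phi> "H n" x y] mean_dist_le_diam[of "H n" x y] d0 \<delta>
        by (auto simp: indicator_def)
      have im: "integrable (\<kappa> x) (\<lambda>y. ?i y * ?m n y)" for n
        by (rule k.integrable_bounded[of _ diam]) (use m_meas Vk mb(1) in auto)
      have imx: "integrable (\<kappa> x) (\<lambda>y. ?i y * max (?m n y) \<delta>)" for n
        by (rule k.integrable_bounded[of _ "diam + \<delta>"]) (use m_meas Vk mb(2) in auto)
      \<comment> \<open>the mean distances need not converge, but their maxima with \<open>\<delta>\<close> are eventually constant\<close>
      have "(\<lambda>n. \<integral>y. ?i y * max (?m n y) \<delta> \<partial>\<kappa> x) \<longlonglongrightarrow> (\<integral>y. ?i y * \<delta> \<partial>\<kappa> x)"
      proof (rule integral_dominated_convergence[where w = "\<lambda>_. diam + \<delta>"])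
        show "AE y in \<kappa> x. (\<lambda>n. ?i y * max (?m n y) \<delta>) \<longlonglongrightarrow> ?i y * \<delta>"
          using AE_supp_kernel[of x]
        proof eventually_elim
          case (elim y)
          show ?case
          proof (cases "y \<in> V i")
            case True
            then have "\<not> (\<exists>\<^sub>F n in sequentially. ?m n y > \<delta>)" using no elim by blast
            then have "\<forall>\<^sub>F n in sequentially. \<not> ?m n y > \<delta>" by (simp add: frequently_def)
            then have "\<forall>\<^sub>F n in sequentially. ?i y * max (?m n y) \<delta> = ?i y * \<delta>"
              by eventually_elim simp
            then show ?thesis by (rule tendsto_eventually)
          qed simp
        qed
        show "AE y in \<kappa> x. norm (?i y * max (?m n y) \<delta>) \<le> diam + \<delta>" for n using mb(2) by auto
      qed (use m_meas Vk in auto)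
      also have "(\<integral>y. ?i y * \<delta> \<partial>\<kappa> x) = P * \<delta>" using Vk by (simp add: P_def)
      finally have "(\<lambda>n. \<integral>y. ?i y * max (?m (r n) y) \<delta> \<partial>\<kappa> x) \<longlonglongrightarrow> P * \<delta>"
        using LIMSEQ_subseq_LIMSEQ[OF _ r] by (auto simp: o_def)
      then have ev1: "\<forall>\<^sub>F n in sequentially. (\<integral>y. ?i y * max (?m (r n) y) \<delta> \<partial>\<kappa> x) < P * \<delta> + P * \<eta> / (8 * diam)"
        by (rule order_tendstoD) (use P \<eta> d0 in simp)
      have "(\<lambda>n. (\<Sum>g\<in>H (r n). defect j (V i) g x) / card (H (r n))) \<longlonglongrightarrow> 0" using elim_def by blast
      then have ev2: "\<forall>\<^sub>F n in sequentially. (\<Sum>g\<in>H (r n). defect j (V i) g x) / card (H (r n)) > - (P\<^sup>2 * \<eta> / 8)"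
        by (rule order_tendstoD) (use P \<eta> in simp)
      have "\<exists>\<^sub>F n in sequentially. \<eta> \<le> (\<Sum>g\<in>H (r n). cvar j (\<phi> g x)) / card (H (r n)) \<and>
         (\<integral>y. ?i y * max (?m (r n) y) \<delta> \<partial>\<kappa> x) < P * \<delta> + P * \<eta> / (8 * diam) \<and>
         (\<Sum>g\<in>H (r n). defect j (V i) g x) / card (H (r n)) > - (P\<^sup>2 * \<eta> / 8)"
        by (rule frequently_eventually_frequently[OF fr eventually_conj[OF ev1 ev2]])
      then obtain n where n1: "\<eta> \<le> (\<Sum>g\<in>H (r n). cvar j (\<phi> g x)) / card (H (r n))"
        and n2: "(\<integral>y. ?i y * max (?m (r n) y) \<delta> \<partial>\<kappa> x) < P * \<delta> + P * \<eta> / (8 * diam)"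
        and n3: "(\<Sum>g\<in>H (r n). defect j (V i) g x) / card (H (r n)) > - (P\<^sup>2 * \<eta> / 8)"
        by (auto dest: frequently_ex)
      let ?F = "H (r n)"
      have c: "real (card ?F) > 0" using H by (simp add: card_gt_0_iff)
      have Fc: "g \<in> carrier G" if "g \<in> ?F" for g using that H(3) by auto
      have di: "integrable (\<kappa> x) (\<lambda>y. ?i y * dist (\<phi> g x) (\<phi> g y))" if g: "g \<in> ?F" for g
      proof (rule k.integrable_bounded[of _ diam])
        have "(\<lambda>y. dist (\<phi> g x) (\<phi> g y)) \<in> borel_measurable (\<kappa> x)"
          by (intro borel_measurable_kernel borel_measurable_continuous_onI continuous_intros continuous_action Fc g)
        then show "(\<lambda>y. ?i y * dist (\<phi> g x) (\<phi> g y)) \<in> borel_measurable (\<kappa> x)" using Vk by measurable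
        show "\<bar>?i y * dist (\<phi> g x) (\<phi> g y)\<bar> \<le> diam" for y using diam by (auto simp: indicator_def less_imp_le)
      qed
      have pval: "condE ?i x = P" using elim_p Vk by (simp add: P_def)
      have "P\<^sup>2 * \<eta> \<le> P\<^sup>2 * ((\<Sum>g\<in>?F. cvar j (\<phi> g x)) / card ?F)"
        using n1 by (intro mult_left_mono) auto
      also have "\<dots> = (\<Sum>g\<in>?F. P\<^sup>2 * cvar j (\<phi> g x)) / card ?F" by (simp add: sum_distrib_left)
      also have "\<dots> = (\<Sum>g\<in>?F. spread j (V i) g x) / card ?F - (\<Sum>g\<in>?F. defect j (V i) g x) / card ?F"
        unfolding defect_def pval by (simp add: sum_subtractf diff_divide_distrib)
      also have "(\<Sum>g\<in>?F. spread j (V i) g x) \<le> (\<Sum>g\<in>?F. P * diam * (\<integral>y. ?i y * dist (\<phi> g x) (\<phi> g y) \<partial>\<kappa> x))"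
      proof (rule sum_mono)
        fix g assume "g \<in> ?F"
        then have g: "g \<in> carrier G" by (rule Fc)
        show "spread j (V i) g x \<le> P * diam * (\<integral>y. ?i y * dist (\<phi> g x) (\<phi> g y) \<partial>\<kappa> x)"
          unfolding P_def by (rule spread_le[OF Vb g]) (use elim_p elim_q g in auto)
      qed
      also have "\<dots> = P * diam * (\<Sum>g\<in>?F. (\<integral>y. ?i y * dist (\<phi> g x) (\<phi> g y) \<partial>\<kappa> x))"
        by (simp add: sum_distrib_left)
      also have "(\<Sum>g\<in>?F. (\<integral>y. ?i y * dist (\<phi> g x) (\<phi> g y) \<partial>\<kappa> x)) = (\<integral>y. (\<Sum>g\<in>?F. ?i y * dist (\<phi> g x) (\<phi> g y)) \<partial>\<kappa> x)"
        by (rule Bochner_Integration.integral_sum[symmetric]) (rule di)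
      also have "\<dots> = (\<integral>y. card ?F * (?i y * ?m (r n) y) \<partial>\<kappa> x)"
      proof -
        have "(\<Sum>g\<in>?F. ?i y * dist (\<phi> g x) (\<phi> g y)) = card ?F * (?i y * ?m (r n) y)" for y
          using c by (simp add: mean_dist_def sum_distrib_left[symmetric])
        then show ?thesis by simp
      qed
      also have "\<dots> = card ?F * (\<integral>y. ?i y * ?m (r n) y \<partial>\<kappa> x)" by simp
      finally have "P\<^sup>2 * \<eta> \<le> P * diam * (card ?F * (\<integral>y. ?i y * ?m (r n) y \<partial>\<kappa> x)) / card ?F
          - (\<Sum>g\<in>?F. defect j (V i) g x) / card ?F" by (simp add: divide_right_mono)
      then have "P\<^sup>2 * \<eta> \<le> P * diam * (\<integral>y. ?i y * ?m (r n) y \<partial>\<kappa> x) - (\<Sum>g\<in>?F. defect j (V i) g x) / card ?F"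
        using c by simp
      then have le: "P\<^sup>2 * \<eta> \<le> P * diam * (\<integral>y. ?i y * ?m (r n) y \<partial>\<kappa> x) + P\<^sup>2 * \<eta> / 8" using n3 by linarith
      have "(\<integral>y. ?i y * ?m (r n) y \<partial>\<kappa> x) \<le> (\<integral>y. ?i y * max (?m (r n) y) \<delta> \<partial>\<kappa> x)"
        by (rule integral_mono[OF im imx]) (auto simp: indicator_def)
      also have "\<dots> \<le> P * \<delta> + P * \<eta> / (8 * diam)" using n2 by simp
      finally have "P * diam * (\<integral>y. ?i y * ?m (r n) y \<partial>\<kappa> x) \<le> P * diam * (P * \<delta> + P * \<eta> / (8 * diam))"
        by (rule mult_left_mono) (use P d0 in simp)
      also have "\<dots> = P\<^sup>2 * \<eta> / 2 + P\<^sup>2 * \<eta> / 8"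
        using d0 by (simp add: \<delta>_def power2_eq_square field_simps)
      finally have "P\<^sup>2 * \<eta> \<le> P\<^sup>2 * \<eta> / 2 + P\<^sup>2 * \<eta> / 8 + P\<^sup>2 * \<eta> / 8" using le by linarith
      moreover have "P\<^sup>2 * \<eta> > 0" using P \<eta> by simp
      ultimately show False by linarith
    qed
    then show ?case using \<delta> by blast
  qed
qed

text \<open>Even indices of \<open>Q\<close> ask for a large, odd ones for a small mean distance at some late time. Both are
  open relations. For density, let \<open>y\<close> be mean asymptotic to \<open>x\<close>: pairing it with another such point
  gives small mean distances, and pairing it with a point far from \<open>x\<close> gives large ones.\<close>

theorem AE_mean_scrambled:
  fixes H :: "nat \<Rightarrow> 'g set"
  assumes H: "\<And>n. finite (H n)" "\<And>n. H n \<noteq> {}" "\<And>n. H n \<subseteq> carrier G" "filterlim (\<lambda>n. card (H n)) at_top sequentially"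
    and stable: "AE x in completion \<mu>. closure (supp (\<kappa> x) \<inter> mean_stable_set \<phi> H x) = supp (\<kappa> x)"
  shows "AE x in completion \<mu>. \<exists>\<delta>>0. \<exists>K \<subseteq> supp (\<kappa> x). supp (\<kappa> x) \<subseteq> closure K \<and> mycielski_set K \<and>
    (\<exists>y\<in>K. \<exists>z\<in>K. y \<noteq> z) \<and>
    (\<forall>y\<in>K. \<forall>z\<in>K. y \<noteq> z \<longrightarrow> (\<exists>\<^sub>F n in sequentially. mean_dist \<phi> (H n) y z > \<delta>) \<and>
       (\<forall>e>0. \<exists>\<^sub>F n in sequentially. mean_dist \<phi> (H n) y z < e))"
proof -
  obtain V :: "nat \<Rightarrow> 'x set" where V: "\<And>i. open (V i)"
    "\<And>U x. open U \<Longrightarrow> x \<in> U \<Longrightarrow> x \<in> UNIV \<Longrightarrow> \<exists>i. x \<in> V i \<and> V i \<subseteq> U"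
    using compact_countable_pseudobase[OF compact_UNIV UNIV_not_empty] by metis
  from stable AE_far_points[of V H, OF V(1) H] show ?thesis
  proof eventually_elim
    case (elim x)
    let ?S = "supp (\<kappa> x)"
    obtain \<delta> where \<delta>: "\<delta> > 0" and far: "\<And>i. V i \<inter> ?S \<noteq> {} \<Longrightarrow>
        \<exists>z\<in>V i \<inter> ?S. \<exists>\<^sub>F n in sequentially. mean_dist \<phi> (H n) x z > \<delta>"
      using elim(2) by blast
    let ?m = "\<lambda>n p. mean_dist \<phi> (H n) (fst p) (snd p)"
    define Q where "Q k = (if even k then {p. \<exists>n\<ge>k. ?m n p > \<delta> / 2} else {p. \<exists>n\<ge>k. ?m n p < 1 / real (Suc k)})" for k
    have stab: "\<exists>y\<in>U \<inter> ?S. (\<lambda>n. mean_dist \<phi> (H n) x y) \<longlonglongrightarrow> 0" if U: "open U" "U \<inter> ?S \<noteq> {}" for U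
    proof -
      obtain s where s: "s \<in> U" "s \<in> closure (?S \<inter> mean_stable_set \<phi> H x)" using U elim(1) by auto
      then have "U \<inter> (?S \<inter> mean_stable_set \<phi> H x) \<noteq> {}"
        using open_Int_closure_eq_empty[OF U(1), of "?S \<inter> mean_stable_set \<phi> H x"] by blast
      then show ?thesis by (auto simp: mean_stable_set_def)
    qed
    have comp: "compact ?S" by (metis closed_supp compact_UNIV compact_Int_closed inf_top_left)
    show ?case
    proof (rule mycielski_independent_set[OF comp supp_kernel_nonempty, of Q])
      show "open (Q k)" for k
      proof (cases "even k")
        case True
        have Q_eq: "Q k = (\<Union>n\<in>{k..}. {p. \<delta> / 2 < ?m n p})" using True by (auto simp: Q_def)
        show ?thesis
          unfolding Q_eq by (intro open_UN ballI open_Collect_less continuous_on_const mean_dist_continuous H)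
      next
        case False
        have Q_eq: "Q k = (\<Union>n\<in>{k..}. {p. ?m n p < 1 / real (Suc k)})" using False by (auto simp: Q_def)
        show ?thesis
          unfolding Q_eq by (intro open_UN ballI open_Collect_less continuous_on_const mean_dist_continuous H)
      qed
      show "\<exists>y\<in>U \<inter> ?S. \<exists>z\<in>W \<inter> ?S. (y, z) \<in> Q k"
        if UW: "open U" "open W" "U \<inter> ?S \<noteq> {}" "W \<inter> ?S \<noteq> {}" for k U W
      proof -
        obtain y where y: "y \<in> U \<inter> ?S" "(\<lambda>n. mean_dist \<phi> (H n) x y) \<longlonglongrightarrow> 0" using stab UW by blast
        show ?thesis
        proof (cases "even k")
          case True
          obtain s i where s: "s \<in> W \<inter> ?S" "s \<in> V i" "V i \<subseteq> W" using UW V(2)[OF UW(2)] by blast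
          obtain z where z: "z \<in> V i \<inter> ?S" "\<exists>\<^sub>F n in sequentially. mean_dist \<phi> (H n) x z > \<delta>"
            using far[of i] s by blast
          have "\<forall>\<^sub>F n in sequentially. mean_dist \<phi> (H n) x y < \<delta> / 2" using y(2) \<delta> by (intro order_tendstoD) auto
          then have "\<forall>\<^sub>F n in sequentially. mean_dist \<phi> (H n) x y < \<delta> / 2 \<and> n \<ge> k"
            using eventually_ge_at_top[of k] by eventually_elim simp
          from frequently_eventually_frequently[OF z(2) this]
          obtain n where n: "mean_dist \<phi> (H n) x z > \<delta>" "mean_dist \<phi> (H n) x y < \<delta> / 2" "n \<ge> k"
            by (auto dest: frequently_ex)
          have "mean_dist \<phi> (H n) y z > \<delta> / 2" using mean_dist_triangle[of \<phi> "H n" x z y] n by simp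
          then have "(y, z) \<in> Q k" using n True by (auto simp: Q_def)
          then show ?thesis using y z s by blast
        next
          case False
          obtain z where z: "z \<in> W \<inter> ?S" "(\<lambda>n. mean_dist \<phi> (H n) x z) \<longlonglongrightarrow> 0" using stab UW by blast
          have "(\<lambda>n. mean_dist \<phi> (H n) x y + mean_dist \<phi> (H n) x z) \<longlonglongrightarrow> 0 + 0" by (intro tendsto_add y z)
          then have "\<forall>\<^sub>F n in sequentially. mean_dist \<phi> (H n) x y + mean_dist \<phi> (H n) x z < 1 / real (Suc k)"
            by (rule order_tendstoD) simp
          then have "\<forall>\<^sub>F n in sequentially. mean_dist \<phi> (H n) x y + mean_dist \<phi> (H n) x z < 1 / real (Suc k) \<and> n \<ge> k"
            using eventually_ge_at_top[of k] by eventually_elim simp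
          then obtain n where n: "mean_dist \<phi> (H n) x y + mean_dist \<phi> (H n) x z < 1 / real (Suc k)" "n \<ge> k"
            by (auto dest!: eventually_happens'[OF sequentially_bot])
          have "mean_dist \<phi> (H n) y z < 1 / real (Suc k)"
            using mean_dist_triangle[of \<phi> "H n" y z x] mean_dist_commute[of \<phi> "H n" x y] n by linarith
          then have "(y, z) \<in> Q k" using n False by (auto simp: Q_def)
          then show ?thesis using y z by blast
        qed
      qed
      show "\<exists>n\<ge>N. \<forall>y. (y, y) \<notin> Q n" for N
        using \<delta> by (intro exI[of _ "2 * N"]) (auto simp: Q_def mean_dist_self)
      fix K assume K: "K \<subseteq> ?S" "?S \<subseteq> closure K" "mycielski_set K"
        "\<And>y z. y \<in> K \<Longrightarrow> z \<in> K \<Longrightarrow> y \<noteq> z \<Longrightarrow> \<forall>\<^sub>F n in sequentially. (y, z) \<in> Q n" "\<exists>y\<in>K. \<exists>z\<in>K. y \<noteq> z"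
      have pair: "(\<exists>\<^sub>F n in sequentially. mean_dist \<phi> (H n) y z > \<delta> / 2) \<and>
          (\<forall>e>0. \<exists>\<^sub>F n in sequentially. mean_dist \<phi> (H n) y z < e)" if yz: "y \<in> K" "z \<in> K" "y \<noteq> z" for y z
      proof (intro conjI allI impI)
        obtain N where N: "\<And>n. n \<ge> N \<Longrightarrow> (y, z) \<in> Q n" using K(4)[OF yz] by (auto simp: eventually_sequentially)
        show "\<exists>\<^sub>F n in sequentially. mean_dist \<phi> (H n) y z > \<delta> / 2"
          unfolding frequently_sequentially
        proof
          fix l
          have "(y, z) \<in> Q (2 * max N l)" by (rule N) simp
          then obtain n where "n \<ge> 2 * max N l" "mean_dist \<phi> (H n) y z > \<delta> / 2" by (auto simp: Q_def)
          then show "\<exists>n\<ge>l. mean_dist \<phi> (H n) y z > \<delta> / 2" by (intro exI[of _ n]) auto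
        qed
        fix e :: real assume e: "e > 0"
        obtain n0 where n0: "1 / real (Suc n0) < e" using e nat_approx_posE by blast
        show "\<exists>\<^sub>F n in sequentially. mean_dist \<phi> (H n) y z < e"
          unfolding frequently_sequentially
        proof
          fix l
          define k where "k = Suc (2 * max n0 (max N l))"
          have k: "odd k" "k \<ge> N" "k \<ge> l" "k \<ge> n0" by (auto simp: k_def)
          have "(y, z) \<in> Q k" by (rule N) (rule k)
          then obtain n where n: "n \<ge> k" "mean_dist \<phi> (H n) y z < 1 / real (Suc k)" using k(1) by (auto simp: Q_def)
          have "1 / real (Suc k) \<le> 1 / real (Suc n0)" using k by (intro divide_left_mono) auto
          then show "\<exists>n\<ge>l. mean_dist \<phi> (H n) y z < e" using n n0 k by (intro exI[of _ n]) auto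
        qed
      qed
      show ?case
        by (rule exI[of _ "\<delta> / 2"], intro conjI exI[of _ K] K pair ballI impI) (use \<delta> pair in auto)
    qed
  qed
qed

end

lemma mean_scrambled_pairI:
  assumes far: "\<exists>\<^sub>F n in sequentially. mean_dist \<phi> (Gs n) y z > \<delta>"
    and near: "\<And>e. e > 0 \<Longrightarrow> \<exists>\<^sub>F n in sequentially. mean_dist \<phi> (Gs n) y z < e"
    and \<delta>': "\<delta>' < \<delta>"
  shows "mean_scrambled_pair \<phi> Gs \<delta>' y z"
  unfolding mean_scrambled_pair_def
proof
  let ?m = "\<lambda>n. ereal (mean_dist \<phi> (Gs n) y z)"
  show "liminf ?m = 0"
  proof (rule antisym)
    show "0 \<le> liminf ?m" by (rule Liminf_bounded) (simp add: mean_dist_nonneg)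
    show "liminf ?m \<le> 0"
    proof (rule ccontr)
      assume "\<not> liminf ?m \<le> 0"
      then have "0 < liminf ?m" by simp
      then obtain e where e: "0 < ereal e" "ereal e < liminf ?m" using ereal_dense2 by blast
      have "\<forall>\<^sub>F n in sequentially. ereal e < ?m n" by (rule less_LiminfD[OF e(2)])
      then have "\<forall>\<^sub>F n in sequentially. \<not> mean_dist \<phi> (Gs n) y z < e" by eventually_elim simp
      then show False using near[of e] e(1) by (simp add: frequently_def)
    qed
  qed
  show "limsup ?m > ereal \<delta>'"
  proof (rule ccontr)
    assume "\<not> ?thesis"
    then have "limsup ?m \<le> ereal \<delta>'" by simp
    also have "ereal \<delta>' < ereal \<delta>" using \<delta>' by simp
    finally have "limsup ?m < ereal \<delta>" .
    then have "\<forall>\<^sub>F n in sequentially. ?m n < ereal \<delta>" by (rule Limsup_lessD)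
    then have "\<forall>\<^sub>F n in sequentially. \<not> mean_dist \<phi> (Gs n) y z > \<delta>" by eventually_elim simp
    then show False using far by (simp add: frequently_def)
  qed
qed

section \<open>Dense Mycielski mean scrambled sets\<close>

text \<open>All members of the joins are Borel sets, on which a measure and its completion agree.\<close>

lemma entropy_wrt_completion:
  fixes \<mu> :: "'x::metric_space measure"
  assumes tds: "G_tds G \<phi>" and sets: "sets \<mu> = sets borel" and \<alpha>: "\<alpha> \<subseteq> sets borel"
  shows "entropy_wrt G \<phi> (completion \<mu>) \<alpha> = entropy_wrt G \<phi> \<mu> \<alpha>"
proof -
  interpret G_tds G \<phi> by (rule tds)
  have "partition_entropy (completion \<mu>) (dynamical_join \<phi> F \<alpha>) = partition_entropy \<mu> (dynamical_join \<phi> F \<alpha>)"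
    if F: "finite F" "F \<noteq> {}" "F \<subseteq> carrier G" for F
  proof -
    have "A \<in> sets \<mu>" if A: "A \<in> dynamical_join \<phi> F \<alpha>" for A
    proof -
      obtain c where c: "A = (\<Inter>g\<in>F. \<phi> g -` c g)" "\<forall>g\<in>F. c g \<in> \<alpha>" using A by (auto simp: dynamical_join_def)
      have "\<phi> g -` c g \<in> sets borel" if g: "g \<in> F" for g
      proof -
        have "\<phi> g \<in> borel \<rightarrow>\<^sub>M borel" using g F(3) by (intro borel_measurable_continuous_onI continuous_action) auto
        from measurable_sets[OF this, of "c g"] show ?thesis using c g \<alpha> by auto
      qed
      then show ?thesis unfolding c(1) sets using F by (intro sets.finite_INT) auto
    qed
    then show ?thesis unfolding partition_entropy_def by (simp cong: sum.cong)
  qed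
  then have "folner_seq G F \<Longrightarrow> partition_entropy (completion \<mu>) (dynamical_join \<phi> (F n) \<alpha>) =
      partition_entropy \<mu> (dynamical_join \<phi> (F n) \<alpha>)" for F n
    unfolding folner_seq_def by blast
  then show ?thesis unfolding entropy_wrt_def by (simp cong: imp_cong)
qed

text \<open>If all Borel sets had zero entropy, then so would all finite Borel partitions, as a partition is
  determined by its members; so positive entropy provides a Borel set outside the Pinsker algebra.\<close>

lemma pinsker_disintegrationI:
  fixes \<mu> :: "'x::metric_space measure"
  assumes G: "countable_amenable_group G" and tds: "G_tds G \<phi>" and erg: "ergodic_measure G \<phi> \<mu>"
    and pos: "measure_entropy G \<phi> \<mu> > 0" and dis: "disintegration \<mu> (pinsker_sets G \<phi> \<mu>) \<kappa>"
  shows "pinsker_disintegration G \<mu> \<phi> \<kappa>"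
proof -
  interpret tds: G_tds G \<phi> by (rule tds)
  have inv: "invariant_measure G \<phi> \<mu>" using erg by (simp add: ergodic_measure_def)
  have sets: "sets \<mu> = sets borel" using inv by (simp add: invariant_measure_def)
  have space: "space \<mu> = UNIV" using sets_eq_imp_space_eq[OF sets] by simp
  have ex: "\<exists>F. folner_seq G F" and cnt: "countable (carrier G)"
    using G by (auto simp: countable_amenable_group_def)
  interpret mp_action G "completion \<mu>" \<phi> by (rule mp_action_completion[OF tds inv])
  have ps: "pinsker_sets G \<phi> \<mu> = {B. zero_entropy_set B}"
    unfolding pinsker_sets_def space
    using zero_entropy_set_iff_entropy_wrt[OF ex] zero_entropy_setD(1) by blast
  have pin: "sigma (space \<mu>) (pinsker_sets G \<phi> \<mu>) = pinsker" unfolding ps space pinsker_def ..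
  have \<kappa>: "\<kappa> y \<in> space (prob_algebra borel)" for y
    using dis measurable_space[of \<kappa> "completion \<mu>" "prob_algebra borel" y] space by (simp add: disintegration_def)
  show ?thesis
  proof (intro pinsker_disintegration.intro pinsker_disintegration_axioms.intro mp_action_axioms)
    show "sets \<mu> = sets borel" "compact (UNIV :: 'x set)" "countable (carrier G)"
      by (fact sets tds.compact_phase_space cnt)+
    show "continuous_on UNIV (\<phi> g)" if "g \<in> carrier G" for g using that by (rule tds.continuous_action)
    show "measure \<mu> (\<Union>g\<in>carrier G. \<phi> g ` A) \<in> {0, 1}" if "A \<in> sets borel" for A
      using erg that by (simp add: ergodic_measure_def)
    show "prob_space (\<kappa> y)" "sets (\<kappa> y) = sets borel" for y
      using \<kappa>[of y] by (auto simp: space_prob_algebra)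
    show "AE y in completion \<mu>. condE f y = (\<integral>x. f x \<partial>\<kappa> y)"
      if f: "f \<in> borel_measurable borel" "\<And>x. \<bar>f x\<bar> \<le> C" for f :: "'x \<Rightarrow> real" and C
    proof -
      have fM: "f \<in> borel_measurable (completion \<mu>)"
        by (rule measurable_completion) (use f sets in \<open>simp cong: measurable_cong_sets\<close>)
      have "AE y in \<mu>. condE f y = (\<integral>x. f x \<partial>completion (\<kappa> y))"
        using dis integrable_bounded[OF fM f(2)] unfolding disintegration_def pin by blast
      moreover have "(\<integral>x. f x \<partial>completion (\<kappa> y)) = (\<integral>x. f x \<partial>\<kappa> y)" for y
        by (rule integral_completion) (use f \<kappa>[of y] in \<open>simp add: space_prob_algebra cong: measurable_cong_sets\<close>)
      ultimately show ?thesis by (intro AE_completion) simp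
    qed
    show "\<exists>A\<in>sets borel. \<not> zero_entropy_set A"
    proof (rule ccontr)
      assume "\<not> ?thesis"
      then have zero: "\<And>A. A \<in> sets borel \<Longrightarrow> zero_entropy_set A" by blast
      have "measure_entropy G \<phi> \<mu> \<le> 0"
        unfolding measure_entropy_def
      proof (rule SUP_least)
        fix \<alpha> assume "\<alpha> \<in> {\<alpha>. finite \<alpha> \<and> partition_on (space \<mu>) \<alpha> \<and> \<alpha> \<subseteq> sets \<mu>}"
        then have \<alpha>: "finite \<alpha>" "partition_on UNIV \<alpha>" "\<alpha> \<subseteq> sets borel" using space sets by auto
        have "entropy_wrt G \<phi> (completion \<mu>) \<alpha> = 0"
          by (rule entropy_wrt_zero_if_zero_entropy_sets[OF ex \<alpha>(1,2)]) (use zero \<alpha>(3) in auto)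
        then show "ereal (entropy_wrt G \<phi> \<mu> \<alpha>) \<le> 0"
          using entropy_wrt_completion[OF tds sets \<alpha>(3)] by simp
      qed
      then show False using pos by simp
    qed
  qed
qed

theorem theorem1p6:
  fixes G :: "('g, 'm) monoid_scheme" (structure)
    and \<phi> :: "'g \<Rightarrow> 'x::metric_space \<Rightarrow> 'x"
    and Gs :: "nat \<Rightarrow> 'g set"
    and \<mu> :: "'x measure"
    and \<kappa> :: "'x \<Rightarrow> 'x measure"
  assumes "countable_amenable_group G" and "infinite (carrier G)"
    and "G_tds G \<phi>"
    and "\<And>n. n \<ge> 1 \<Longrightarrow> finite (Gs n) \<and> Gs n \<noteq> {} \<and> Gs n \<subseteq> carrier G"
    and "ergodic_measure G \<phi> \<mu>"
    and "measure_entropy G \<phi> \<mu> > 0"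
    and "filterlim (\<lambda>n. card (Gs n)) at_top sequentially"
    and "disintegration \<mu> (pinsker_sets G \<phi> \<mu>) \<kappa>"
    and "AE x in \<mu>. closure (supp (\<kappa> x) \<inter> mean_stable_set \<phi> Gs x) = supp (\<kappa> x)"
  shows "AE x in \<mu>. \<exists>\<delta>>0. \<exists>K \<subseteq> supp (\<kappa> x).
           supp (\<kappa> x) \<subseteq> closure K \<and> mycielski_set K \<and> mean_scrambled_set \<phi> Gs \<delta> K"
proof -
  interpret pinsker_disintegration G \<mu> \<phi> \<kappa>
    by (rule pinsker_disintegrationI[OF assms(1,3,5,6,8)])
  \<comment> \<open>only the sets from index \<open>1\<close> on are known to be finite, nonempty subsets of the group\<close>
  define H where "H n = Gs (Suc n)" for n
  have H: "finite (H n)" "H n \<noteq> {}" "H n \<subseteq> carrier G" for n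
    using assms(4)[of "Suc n"] by (auto simp: H_def)
  have Hcard: "filterlim (\<lambda>n. card (H n)) at_top sequentially"
    unfolding H_def by (rule filterlim_compose[OF assms(7) filterlim_Suc])
  have stab: "mean_stable_set \<phi> H x = mean_stable_set \<phi> Gs x" for x
    unfolding mean_stable_set_def H_def
    using filterlim_sequentially_Suc[of "\<lambda>n. mean_dist \<phi> (Gs n) x _"] by auto
  have freq: "\<exists>\<^sub>F n in sequentially. P (Gs n)" if "\<exists>\<^sub>F n in sequentially. P (H n)" for P
    using that eventually_sequentially_Suc[of "\<lambda>n. \<not> P (Gs n)"] unfolding frequently_def H_def by simp
  have "AE x in completion \<mu>. closure (supp (\<kappa> x) \<inter> mean_stable_set \<phi> H x) = supp (\<kappa> x)"
    unfolding stab by (rule AE_completion[OF assms(9)])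
  from AE_mean_scrambled[OF H Hcard this]
  have "AE x in completion \<mu>. \<exists>\<delta>>0. \<exists>K \<subseteq> supp (\<kappa> x).
           supp (\<kappa> x) \<subseteq> closure K \<and> mycielski_set K \<and> mean_scrambled_set \<phi> Gs \<delta> K"
  proof eventually_elim
    case (elim x)
    then obtain \<delta> K where \<delta>: "\<delta> > 0" and K: "K \<subseteq> supp (\<kappa> x)" "supp (\<kappa> x) \<subseteq> closure K" "mycielski_set K"
      "\<exists>y\<in>K. \<exists>z\<in>K. y \<noteq> z"
      and pair: "\<And>y z. y \<in> K \<Longrightarrow> z \<in> K \<Longrightarrow> y \<noteq> z \<Longrightarrow>
        (\<exists>\<^sub>F n in sequentially. mean_dist \<phi> (H n) y z > \<delta>) \<and>
        (\<forall>e>0. \<exists>\<^sub>F n in sequentially. mean_dist \<phi> (H n) y z < e)"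
      by metis
    have "mean_scrambled_pair \<phi> Gs (\<delta> / 2) y z" if yz: "y \<in> K" "z \<in> K" "y \<noteq> z" for y z
    proof (rule mean_scrambled_pairI)
      show "\<exists>\<^sub>F n in sequentially. mean_dist \<phi> (Gs n) y z > \<delta>"
        by (rule freq[of "\<lambda>F. mean_dist \<phi> F y z > \<delta>"]) (use pair[OF yz] in blast)
      show "\<exists>\<^sub>F n in sequentially. mean_dist \<phi> (Gs n) y z < e" if "e > 0" for e
        by (rule freq[of "\<lambda>F. mean_dist \<phi> F y z < e"]) (use pair[OF yz] that in blast)
    qed (use \<delta> in simp)
    then have "mean_scrambled_set \<phi> Gs (\<delta> / 2) K" unfolding mean_scrambled_set_def using K(4) by blast
    then show ?case using \<delta> K(1-3) half_gt_zero by blast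
  qed
  then show ?thesis by (simp add: AE_completion_iff)
qed

end
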